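(* There exist real Banach spaces $Z$ and $Y$ such that $Z$ has property $\alpha$ and $\mathrm{NA}_\pi(Z\widehat{\otimes}_\pi Y)\neq Z\widehat{\otimes}_\pi Y$. More precisely, whenever $X,Y$ are real Banach spaces and $u\in X\widehat{\otimes}_\pi Y$ does not attain its projective norm, there is a Banach space $Z$ with property $\alpha$ in which $X$ is $1$-complemented, so that $X\widehat{\otimes}_\pi Y$ is isometrically a subspace of $Z\widehat{\otimes}_\pi Y$, and $u\notin\mathrm{NA}_\pi(Z\widehat{\otimes}_\pi Y)$.
   Context: A Banach space $Z$ has property $\alpha$ (Schachermayer) if there are a family $\{(z_i,z_i^* )\}_{i\in I}\subseteq Z\times Z^*$ and $0\leq\rho<1$ such that $\|z_i\|=\|z_i^*\|=z_i^*(z_i)=1$ for all $i$, $|z_i^*(z_j)|\leq\rho$ for $i\neq j$, and the closed unit ball of $Z$ is the closed absolutely convex hull of $\{z_i:i\in I\}$. $X$ is $1$-complemented in $Z$ if $X$ is (isometrically) the range of a norm-one projection on $Z$. $X\widehat{\otimes}_\pi Y$ denotes the projective tensor product. An element $u\in X\widehat{\otimes}_\pi Y$ attains its projective norm if there are $(x_i)\subseteq X$, $(y_i)\subseteq Y$ with $u=\sum_{i=1}^\infty x_i\otimes y_i$ and $\|u\|_\pi=\sum_{i=1}^\infty\|x_i\|\|y_i\|$; $\mathrm{NA}_\pi(X\widehat{\otimes}_\pi Y)$ is the set of such elements. *)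

theory Defs
  imports "HOL-Analysis.Analysis" "HOL-Library.Function_Algebras"
begin

text \<open>Function spaces are real vector spaces with the pointwise operations.\<close>

instantiation "fun" :: (type, real_vector) real_vector
begin

definition scaleR_fun :: "real \<Rightarrow> ('a \<Rightarrow> 'b) \<Rightarrow> 'a \<Rightarrow> 'b"
  where "scaleR_fun c f = (\<lambda>x. c *\<^sub>R f x)"

instance
  by standard (simp_all add: scaleR_fun_def fun_eq_iff scaleR_add_right scaleR_add_left)

end

section \<open>Normed and Banach spaces\<close>

text \<open>
  The theorem asserts the existence of Banach spaces, so a space has to be an object rather than
  a type: it is a linear subspace \<open>spc V\<close> of an ambient real vector space together with a
  norm. The ambient type only provides the linear structure, and the values of \<open>nrm V\<close>
  outside \<open>spc V\<close> are irrelevant.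
\<close>

record 'a nspace =
  spc :: "'a set"
  nrm :: "'a \<Rightarrow> real"

definition ndist :: "'a::real_vector nspace \<Rightarrow> 'a \<Rightarrow> 'a \<Rightarrow> real"
  where "ndist V x y = (if x \<in> spc V \<and> y \<in> spc V then nrm V (x - y) else 0)"

definition normed_space :: "'a::real_vector nspace \<Rightarrow> bool"
  where "normed_space V \<longleftrightarrow>
    subspace (spc V) \<and>
    (\<forall>x\<in>spc V. 0 \<le> nrm V x \<and> (nrm V x = 0 \<longleftrightarrow> x = 0)) \<and>
    (\<forall>x\<in>spc V. \<forall>c. nrm V (c *\<^sub>R x) = \<bar>c\<bar> * nrm V x) \<and>
    (\<forall>x\<in>spc V. \<forall>y\<in>spc V. nrm V (x + y) \<le> nrm V x + nrm V y)"

lemma Metric_space_ndist: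
  assumes "normed_space V"
  shows "Metric_space (spc V) (ndist V)"
proof -
  have sub: "subspace (spc V)" using assms by (simp add: normed_space_def)
  have comm: "nrm V (x - y) = nrm V (y - x)" if "x \<in> spc V" "y \<in> spc V" for x y
  proof -
    have "nrm V ((-1) *\<^sub>R (y - x)) = \<bar>-1\<bar> * nrm V (y - x)"
      using assms that sub unfolding normed_space_def by (blast intro: subspace_diff)
    then show ?thesis by simp
  qed
  have tri: "nrm V (x - z) \<le> nrm V (x - y) + nrm V (y - z)"
    if "x \<in> spc V" "y \<in> spc V" "z \<in> spc V" for x y z
  proof -
    have "nrm V ((x - y) + (y - z)) \<le> nrm V (x - y) + nrm V (y - z)"
      using assms that sub unfolding normed_space_def by (blast intro: subspace_diff)
    then show ?thesis by simp
  qed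
  show ?thesis
  proof
    show "0 \<le> ndist V x y" for x y
      using assms sub by (auto simp: ndist_def normed_space_def intro: subspace_diff)
    show "ndist V x y = ndist V y x" for x y
      using comm by (auto simp: ndist_def)
    show "ndist V x y = 0 \<longleftrightarrow> x = y" if "x \<in> spc V" "y \<in> spc V" for x y
      using assms that sub subspace_diff[OF sub that] by (auto simp: ndist_def normed_space_def)
    show "ndist V x z \<le> ndist V x y + ndist V y z"
      if "x \<in> spc V" "y \<in> spc V" "z \<in> spc V" for x y z
      using tri that by (auto simp: ndist_def)
  qed
qed

definition banach_space :: "'a::real_vector nspace \<Rightarrow> bool"
  where "banach_space V \<longleftrightarrow> normed_space V \<and> Metric_space.mcomplete (spc V) (ndist V)"

lemma banach_space_type: "banach_space \<lparr>spc = (UNIV :: 'a::banach set), nrm = norm\<rparr>"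
proof -
  have "ndist \<lparr>spc = (UNIV :: 'a set), nrm = norm\<rparr> = dist"
    by (simp add: fun_eq_iff ndist_def dist_norm)
  moreover have "complete (UNIV :: 'a set)"
    by (simp add: complete_UNIV)
  ultimately show ?thesis
    by (simp add: banach_space_def normed_space_def norm_triangle_ineq)
qed

definition real_line :: "real nspace"
  where "real_line = \<lparr>spc = UNIV, nrm = abs\<rparr>"

definition unit_ball :: "'a::real_vector nspace \<Rightarrow> 'a set"
  where "unit_ball V = {x \<in> spc V. nrm V x \<le> 1}"

section \<open>Operators, functionals, complemented subspaces\<close>

definition linear_map_on :: "'a::real_vector set \<Rightarrow> ('a \<Rightarrow> 'b::real_vector) \<Rightarrow> bool"
  where "linear_map_on S f \<longleftrightarrow>
    (\<forall>x\<in>S. \<forall>y\<in>S. f (x + y) = f x + f y) \<and> (\<forall>x\<in>S. \<forall>c. f (c *\<^sub>R x) = c *\<^sub>R f x)"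

definition bounded_operator ::
    "'a::real_vector nspace \<Rightarrow> 'b::real_vector nspace \<Rightarrow> ('a \<Rightarrow> 'b) \<Rightarrow> bool"
  where "bounded_operator V W f \<longleftrightarrow>
    linear_map_on (spc V) f \<and> f ` spc V \<subseteq> spc W \<and>
    (\<exists>K. \<forall>x\<in>spc V. nrm W (f x) \<le> K * nrm V x)"

text \<open>Meaningful for bounded operators only.\<close>

definition operator_norm ::
    "'a::real_vector nspace \<Rightarrow> 'b::real_vector nspace \<Rightarrow> ('a \<Rightarrow> 'b) \<Rightarrow> real"
  where "operator_norm V W f = (SUP x\<in>unit_ball V. nrm W (f x))"

abbreviation dual_space :: "'a::real_vector nspace \<Rightarrow> ('a \<Rightarrow> real) set"
  where "dual_space V \<equiv> {f. bounded_operator V real_line f}"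

abbreviation dual_norm :: "'a::real_vector nspace \<Rightarrow> ('a \<Rightarrow> real) \<Rightarrow> real"
  where "dual_norm V \<equiv> operator_norm V real_line"

definition linear_isometry ::
    "'a::real_vector nspace \<Rightarrow> 'b::real_vector nspace \<Rightarrow> ('a \<Rightarrow> 'b) \<Rightarrow> bool"
  where "linear_isometry V W f \<longleftrightarrow>
    linear_map_on (spc V) f \<and> f ` spc V \<subseteq> spc W \<and> (\<forall>x\<in>spc V. nrm W (f x) = nrm V x)"

definition norm_one_projection :: "'a::real_vector nspace \<Rightarrow> ('a \<Rightarrow> 'a) \<Rightarrow> bool"
  where "norm_one_projection Z P \<longleftrightarrow>
    bounded_operator Z Z P \<and> (\<forall>z\<in>spc Z. P (P z) = P z) \<and> operator_norm Z Z P = 1"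

text \<open>The space \<open>X\<close> is 1-complemented in \<open>Z\<close> by means of the isometric embedding \<open>\<iota>\<close>.\<close>

definition one_complemented_via ::
    "('a \<Rightarrow> 'b) \<Rightarrow> 'a::real_vector nspace \<Rightarrow> 'b::real_vector nspace \<Rightarrow> bool"
  where "one_complemented_via \<iota> X Z \<longleftrightarrow>
    linear_isometry X Z \<iota> \<and> (\<exists>P. norm_one_projection Z P \<and> P ` spc Z = \<iota> ` spc X)"

section \<open>Property alpha\<close>

definition absolutely_convex :: "'a::real_vector set \<Rightarrow> bool"
  where "absolutely_convex S \<longleftrightarrow> S \<noteq> {} \<and>
    (\<forall>x\<in>S. \<forall>y\<in>S. \<forall>a b. \<bar>a\<bar> + \<bar>b\<bar> \<le> 1 \<longrightarrow> a *\<^sub>R x + b *\<^sub>R y \<in> S)"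

definition closed_abs_convex_hull :: "'a::real_vector nspace \<Rightarrow> 'a set \<Rightarrow> 'a set"
  where "closed_abs_convex_hull V A =
    Metric_space.mtopology (spc V) (ndist V) closure_of (absolutely_convex hull A)"

text \<open>
  The family may be indexed by a set of elements of the ambient type: the conditions force
  \<open>i \<mapsto> z i\<close> to be injective.
\<close>

definition property_alpha :: "'a::real_vector nspace \<Rightarrow> bool"
  where "property_alpha Z \<longleftrightarrow>
    (\<exists>(I::'a set) (z::'a \<Rightarrow> 'a) (zs::'a \<Rightarrow> 'a \<Rightarrow> real) (\<rho>::real).
      0 \<le> \<rho> \<and> \<rho> < 1 \<and>
      (\<forall>i\<in>I. z i \<in> spc Z \<and> zs i \<in> dual_space Z \<and>
             nrm Z (z i) = 1 \<and> dual_norm Z (zs i) = 1 \<and> zs i (z i) = 1) \<and>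
      (\<forall>i\<in>I. \<forall>j\<in>I. i \<noteq> j \<longrightarrow> \<bar>zs i (z j)\<bar> \<le> \<rho>) \<and>
      unit_ball Z = closed_abs_convex_hull Z (z ` I))"

section \<open>Completion of a normed space\<close>

text \<open>Elements of the completion are classes of Cauchy sequences modulo null sequences.\<close>

definition cauchy_seqs :: "'a::real_vector nspace \<Rightarrow> (nat \<Rightarrow> 'a) set"
  where "cauchy_seqs V = {s. Metric_space.MCauchy (spc V) (ndist V) s}"

definition cauchy_class :: "'a::real_vector nspace \<Rightarrow> (nat \<Rightarrow> 'a) \<Rightarrow> (nat \<Rightarrow> 'a) set"
  where "cauchy_class V s = {t \<in> cauchy_seqs V. (\<lambda>n. ndist V (s n) (t n)) \<longlonglongrightarrow> 0}"

definition completion :: "'a::real_vector nspace \<Rightarrow> (nat \<Rightarrow> 'a) set set"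
  where "completion V = cauchy_class V ` cauchy_seqs V"

definition completion_norm :: "'a::real_vector nspace \<Rightarrow> (nat \<Rightarrow> 'a) set \<Rightarrow> real"
  where "completion_norm V U = (THE r. \<forall>s\<in>U. (\<lambda>n. nrm V (s n)) \<longlonglongrightarrow> r)"

definition completion_add ::
    "'a::real_vector nspace \<Rightarrow> (nat \<Rightarrow> 'a) set \<Rightarrow> (nat \<Rightarrow> 'a) set \<Rightarrow> (nat \<Rightarrow> 'a) set"
  where "completion_add V U U' = (\<Union>s\<in>U. \<Union>t\<in>U'. cauchy_class V (\<lambda>n. s n + t n))"

definition completion_scale ::
    "'a::real_vector nspace \<Rightarrow> real \<Rightarrow> (nat \<Rightarrow> 'a) set \<Rightarrow> (nat \<Rightarrow> 'a) set"
  where "completion_scale V c U = (\<Union>s\<in>U. cauchy_class V (\<lambda>n. c *\<^sub>R s n))"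

definition completion_dist ::
    "'a::real_vector nspace \<Rightarrow> (nat \<Rightarrow> 'a) set \<Rightarrow> (nat \<Rightarrow> 'a) set \<Rightarrow> real"
  where "completion_dist V U U' = completion_norm V (completion_add V U (completion_scale V (-1) U'))"

definition to_completion :: "'a::real_vector nspace \<Rightarrow> 'a \<Rightarrow> (nat \<Rightarrow> 'a) set"
  where "to_completion V v = cauchy_class V (\<lambda>_. v)"

definition completion_isometry ::
    "'a::real_vector nspace \<Rightarrow> 'b::real_vector nspace \<Rightarrow> ((nat \<Rightarrow> 'a) set \<Rightarrow> (nat \<Rightarrow> 'b) set) \<Rightarrow> bool"
  where "completion_isometry V W J \<longleftrightarrow>
    J ` completion V \<subseteq> completion W \<and>
    (\<forall>u\<in>completion V. \<forall>v\<in>completion V.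
       J (completion_add V u v) = completion_add W (J u) (J v)) \<and>
    (\<forall>u\<in>completion V. \<forall>c. J (completion_scale V c u) = completion_scale W c (J u)) \<and>
    (\<forall>u\<in>completion V. completion_norm W (J u) = completion_norm V u)"

section \<open>Projective tensor product\<close>

definition bilinear_form_on ::
    "'a::real_vector set \<Rightarrow> 'b::real_vector set \<Rightarrow> ('a \<Rightarrow> 'b \<Rightarrow> real) \<Rightarrow> bool"
  where "bilinear_form_on S T B \<longleftrightarrow>
    (\<forall>x\<in>S. linear_map_on T (B x)) \<and> (\<forall>y\<in>T. linear_map_on S (\<lambda>x. B x y))"

text \<open>
  The algebraic tensor product is realised in the algebraic dual of the space of bilinear forms:
  \<open>x \<otimes> y\<close> is evaluation at \<open>(x, y)\<close>. The default value 0 on arguments that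
  are not bilinear forms makes equality of functions the equality of tensors.
\<close>

type_synonym ('a, 'b) tensor = "('a \<Rightarrow> 'b \<Rightarrow> real) \<Rightarrow> real"

definition elem_tensor ::
    "'a::real_vector nspace \<Rightarrow> 'b::real_vector nspace \<Rightarrow> 'a \<Rightarrow> 'b \<Rightarrow> ('a, 'b) tensor"
  where "elem_tensor X Y x y = (\<lambda>B. if bilinear_form_on (spc X) (spc Y) B then B x y else 0)"

definition algebraic_tensor ::
    "'a::real_vector nspace \<Rightarrow> 'b::real_vector nspace \<Rightarrow> ('a, 'b) tensor set"
  where "algebraic_tensor X Y = span {elem_tensor X Y x y |x y. x \<in> spc X \<and> y \<in> spc Y}"

definition projective_norm ::
    "'a::real_vector nspace \<Rightarrow> 'b::real_vector nspace \<Rightarrow> ('a, 'b) tensor \<Rightarrow> real"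
  where "projective_norm X Y u =
    Inf {(\<Sum>i<n. nrm X (x i) * nrm Y (y i)) |(n::nat) x y.
           (\<forall>i<n. x i \<in> spc X \<and> y i \<in> spc Y) \<and> u = (\<Sum>i<n. elem_tensor X Y (x i) (y i))}"

definition tensor_nspace ::
    "'a::real_vector nspace \<Rightarrow> 'b::real_vector nspace \<Rightarrow> ('a, 'b) tensor nspace"
  where "tensor_nspace X Y = \<lparr>spc = algebraic_tensor X Y, nrm = projective_norm X Y\<rparr>"

definition proj_tensor ::
    "'a::real_vector nspace \<Rightarrow> 'b::real_vector nspace \<Rightarrow> (nat \<Rightarrow> ('a, 'b) tensor) set set"
  where "proj_tensor X Y = completion (tensor_nspace X Y)"

definition proj_tensor_norm ::
    "'a::real_vector nspace \<Rightarrow> 'b::real_vector nspace \<Rightarrow> (nat \<Rightarrow> ('a, 'b) tensor) set \<Rightarrow> real"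
  where "proj_tensor_norm X Y = completion_norm (tensor_nspace X Y)"

text \<open>The series of the \<open>x i \<otimes> y i\<close> converges to \<open>u\<close> in the projective norm.\<close>

definition tensor_sums ::
    "'a::real_vector nspace \<Rightarrow> 'b::real_vector nspace \<Rightarrow>
     (nat \<Rightarrow> 'a) \<Rightarrow> (nat \<Rightarrow> 'b) \<Rightarrow> (nat \<Rightarrow> ('a, 'b) tensor) set \<Rightarrow> bool"
  where "tensor_sums X Y x y u \<longleftrightarrow>
    (\<lambda>n. completion_dist (tensor_nspace X Y) u
           (to_completion (tensor_nspace X Y) (\<Sum>i<n. elem_tensor X Y (x i) (y i)))) \<longlonglongrightarrow> 0"

definition NA_proj ::
    "'a::real_vector nspace \<Rightarrow> 'b::real_vector nspace \<Rightarrow> (nat \<Rightarrow> ('a, 'b) tensor) set set"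
  where "NA_proj X Y = {u \<in> proj_tensor X Y.
    \<exists>x y. (\<forall>i. x i \<in> spc X \<and> y i \<in> spc Y) \<and> tensor_sums X Y x y u \<and>
          (\<lambda>i. nrm X (x i) * nrm Y (y i)) sums proj_tensor_norm X Y u}"

text \<open>
  The map \<open>J\<close> is the canonical map \<open>\<iota> \<otimes> id\<close> between the completed tensor products,
  and it is isometric; by density of the algebraic tensor product it is determined by \<open>\<iota>\<close>
  on \<open>proj_tensor X Y\<close>.
\<close>

definition canonical_tensor_embedding ::
    "('a \<Rightarrow> 'c) \<Rightarrow> 'a::real_vector nspace \<Rightarrow> 'c::real_vector nspace \<Rightarrow> 'b::real_vector nspace \<Rightarrow>
     ((nat \<Rightarrow> ('a, 'b) tensor) set \<Rightarrow> (nat \<Rightarrow> ('c, 'b) tensor) set) \<Rightarrow> bool"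
  where "canonical_tensor_embedding \<iota> X Z Y J \<longleftrightarrow>
    completion_isometry (tensor_nspace X Y) (tensor_nspace Z Y) J \<and>
    (\<forall>x\<in>spc X. \<forall>y\<in>spc Y.
       J (to_completion (tensor_nspace X Y) (elem_tensor X Y x y)) =
       to_completion (tensor_nspace Z Y) (elem_tensor Z Y (\<iota> x) y))"

end

(*
Idea. A norm-one retraction of Z onto X pushes an optimal representation of a tensor in Z (x) Y that
comes from X (x) Y forward to an optimal representation in X (x) Y, so nonattainment passes from X to
every Z in which X is 1-complemented. For Z take X + l1(S) with S the unit sphere of X, normed so that
the unit ball is the closed absolutely convex hull of the points (y, e_y) and (y, - e_y) for y in S.
With f_y norming y and a_y the coordinate functional at y, the functionals (f_y + a_y) / 2 and
(f_y - a_y) / 2 show that Z has property alpha with rho = 1/2.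

A tensor without optimal representation: let Y be a plane with hexagonal norm, X a renorming of
Y' + c_0, where Y' is the dual of Y, and T the projection of X onto Y'. The norm of X is such that
|T x| < |x| unless T x = 0, so the functional on X (x) Y induced by T cannot be exact on every term of
a representation, and a tensor on which this functional attains its norm has no optimal one. Half the
identity of Y is such a tensor: take unit vectors with y_1 + y_2 + y_3 = 0 in Y and norming p_j in Y'.
For every r < 1 close to 1 there is s such that all (r p_j, s) have norm at most 1 in X, and the sum of
the (r p_j, s) (x) y_j does not involve s.
*)

theory Submission
  imports Defs "HOL-Real_Asymp.Real_Asymp"
begin

section \<open>Elementary facts on normed spaces\<close>

text \<open>The unit sphere of X alone need not serve as a family for property alpha: the norming
  functional of one unit vector may come arbitrarily close to 1 at another. The l1 coordinate
  separates them, and using both signs makes (y, 0) the midpoint of two generators, so X keeps its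
  norm in Z. The inequality for T must be strict at every vector outside its kernel without being
  uniform; compactness forbids this in finite dimensions, hence the summand c_0. Let v_1 + v_2 + v_3
  = 0 be the coordinates of the plane part, s the null sequence and t_n > 0 decreasing to 0. The
  added norming functionals are (1 + t_n) v_i - t_n s_n. Since s_n tends to 0, late ones exceed
  |v_i| in modulus if v_i is not 0; but s_n = 1 on a long initial segment cancels the excess there.
  This cancellation helps only where v_i is positive. So the p_j are (1, -1/2, -1/2) and its
  permutations, midpoints of edges of the hexagon max |v_i| = 1: the value -1 does not occur, and
  one s serves all three.\<close>

lemma normed_spaceD:
  assumes "normed_space V"
  shows subspace_spc: "subspace (spc V)"
    and zero_in_spc: "0 \<in> spc V"
    and add_in_spc: "x \<in> spc V \<Longrightarrow> y \<in> spc V \<Longrightarrow> x + y \<in> spc V"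
    and diff_in_spc: "x \<in> spc V \<Longrightarrow> y \<in> spc V \<Longrightarrow> x - y \<in> spc V"
    and minus_in_spc: "x \<in> spc V \<Longrightarrow> - x \<in> spc V"
    and scaleR_in_spc: "x \<in> spc V \<Longrightarrow> c *\<^sub>R x \<in> spc V"
    and nrm_nonneg: "x \<in> spc V \<Longrightarrow> 0 \<le> nrm V x"
    and nrm_eq_0_iff: "x \<in> spc V \<Longrightarrow> nrm V x = 0 \<longleftrightarrow> x = 0"
    and nrm_zero: "nrm V 0 = 0"
    and nrm_scaleR: "x \<in> spc V \<Longrightarrow> nrm V (c *\<^sub>R x) = \<bar>c\<bar> * nrm V x"
    and nrm_triangle: "x \<in> spc V \<Longrightarrow> y \<in> spc V \<Longrightarrow> nrm V (x + y) \<le> nrm V x + nrm V y"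
    and nrm_minus: "x \<in> spc V \<Longrightarrow> nrm V (- x) = nrm V x"
proof -
  show sub: "subspace (spc V)" using assms by (simp add: normed_space_def)
  show 0: "0 \<in> spc V" using sub by (rule subspace_0)
  show "nrm V 0 = 0" using assms 0 by (simp add: normed_space_def)
  show "x \<in> spc V \<Longrightarrow> nrm V (- x) = nrm V x" 
    using assms unfolding normed_space_def 
    by (metis abs_minus_cancel abs_one mult_1 scaleR_minus1_left)
qed (use assms in \<open>auto simp: normed_space_def intro: subspace_add subspace_diff subspace_neg subspace_scale\<close>)

lemma nrm_minus_commute:
  assumes "normed_space V" "x \<in> spc V" "y \<in> spc V"
  shows "nrm V (x - y) = nrm V (y - x)"
  using nrm_minus[OF assms(1) diff_in_spc[OF assms]] by simp

lemma nrm_triangle_diff: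
  assumes "normed_space V" "x \<in> spc V" "y \<in> spc V"
  shows "\<bar>nrm V x - nrm V y\<bar> \<le> nrm V (x - y)"
  using nrm_triangle[OF assms(1) diff_in_spc[OF assms] assms(3)]
    nrm_triangle[OF assms(1) diff_in_spc[OF assms(1,3,2)] assms(2)] nrm_minus_commute[OF assms]
  by simp

lemma sum_in_spc:
  assumes "normed_space V" "\<And>i. i \<in> A \<Longrightarrow> f i \<in> spc V"
  shows "(\<Sum>i\<in>A. f i) \<in> spc V"
  using subspace_sum[OF subspace_spc[OF assms(1)], of A f] assms(2) by blast

lemma nrm_sum_le:
  assumes "normed_space V" "finite A" "\<And>i. i \<in> A \<Longrightarrow> f i \<in> spc V"
  shows "nrm V (\<Sum>i\<in>A. f i) \<le> (\<Sum>i\<in>A. nrm V (f i))"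
  using assms(2,3)
proof (induction A)
  case empty
  then show ?case by (simp add: nrm_zero[OF assms(1)])
next
  case (insert a A)
  have "(\<Sum>i\<in>A. f i) \<in> spc V" using insert.prems by (intro sum_in_spc[OF assms(1)]) auto
  from nrm_triangle[OF assms(1) _ this, of "f a"] insert show ?case by fastforce
qed

lemma linear_map_onD:
  assumes "linear_map_on S f"
  shows "x \<in> S \<Longrightarrow> y \<in> S \<Longrightarrow> f (x + y) = f x + f y" "x \<in> S \<Longrightarrow> f (c *\<^sub>R x) = c *\<^sub>R f x"
  using assms by (auto simp: linear_map_on_def)

lemma linear_map_on_0:
  assumes "linear_map_on S f" "subspace S"
  shows "f 0 = 0"
  using linear_map_onD(2)[OF assms(1) subspace_0[OF assms(2)], of 0] by simp

lemma linear_map_on_diff: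
  assumes "linear_map_on S f" "subspace S" "x \<in> S" "y \<in> S"
  shows "f (x - y) = f x - f y"
  using linear_map_onD(1)[OF assms(1,3) subspace_neg[OF assms(2,4)]]
    linear_map_onD(2)[OF assms(1,4), of "-1"] by simp

lemma linear_map_on_sum:
  assumes "linear_map_on S f" "subspace S" "\<And>i. i \<in> A \<Longrightarrow> g i \<in> S"
  shows "f (\<Sum>i\<in>A. g i) = (\<Sum>i\<in>A. f (g i))"
  using assms(3)
proof (induction A rule: infinite_finite_induct)
  case (insert a A)
  then show ?case
    using linear_map_onD(1)[OF assms(1), of "g a" "\<Sum>i\<in>A. g i"] subspace_sum[OF assms(2), of A g] by simp
qed (simp_all add: linear_map_on_0[OF assms(1,2)])

section \<open>Norming functionals\<close>

definition sublinear_on :: "'a::real_vector set \<Rightarrow> ('a \<Rightarrow> real) \<Rightarrow> bool"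
  where "sublinear_on S p \<longleftrightarrow>
    (\<forall>x\<in>S. \<forall>y\<in>S. p (x + y) \<le> p x + p y) \<and> (\<forall>x\<in>S. \<forall>c\<ge>0. p (c *\<^sub>R x) = c * p x)"

lemma sublinear_on_0: "sublinear_on S p \<Longrightarrow> subspace S \<Longrightarrow> p 0 = 0"
  unfolding sublinear_on_def by (metis mult_zero_left order_refl scale_zero_left subspace_0)

lemma sublinear_on_minus:
  assumes "sublinear_on S p" "subspace S" "x \<in> S"
  shows "- p (- x) \<le> p x"
proof -
  have "p (x + - x) \<le> p x + p (- x)"
    using assms subspace_neg unfolding sublinear_on_def by blast
  then show ?thesis using sublinear_on_0[OF assms(1,2)] by simp
qed

text \<open>Lowers \<open>p\<close> in the direction \<open>- y\<close> as far as sublinearity permits.\<close>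

lemma sublinear_on_lower:
  fixes p :: "'a::real_vector \<Rightarrow> real"
  assumes p: "sublinear_on S p" and S: "subspace S" and y: "y \<in> S"
  shows "\<exists>q. sublinear_on S q \<and> (\<forall>x\<in>S. q x \<le> p x) \<and> q (- y) \<le> - p y"
proof -
  define q where "q x = (INF t\<in>{0..}. p (x + t *\<^sub>R y) - t * p y)" for x
  have add: "p (x + z) \<le> p x + p z" if "x \<in> S" "z \<in> S" for x z
    using p that by (auto simp: sublinear_on_def)
  have scale: "p (c *\<^sub>R x) = c * p x" if "x \<in> S" "c \<ge> 0" for x c
    using p that by (auto simp: sublinear_on_def)
  note mem = subspace_add[OF S] subspace_scale[OF S] subspace_neg[OF S] y
  \<comment> \<open>The infimum is finite since \<open>t * p y = p (t *\<^sub>R y) \<le> p (x + t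
    *\<^sub>R y) + p (- x)\<close>.\<close>
  have bdd: "bdd_below ((\<lambda>t. p (x + t *\<^sub>R y) - t * p y) ` {0..})" if x: "x \<in> S" for x
  proof (rule bdd_belowI2)
    fix t :: real assume "t \<in> {0..}"
    then show "- p (- x) \<le> p (x + t *\<^sub>R y) - t * p y"
      using add[of "x + t *\<^sub>R y" "- x"] scale[of y t] mem x by simp
  qed
  have le: "q x \<le> p (x + t *\<^sub>R y) - t * p y" if "x \<in> S" "t \<ge> 0" for x t
    unfolding q_def by (rule cINF_lower[OF bdd]) (use that in auto)
  have ge: "r \<le> q x" if "\<And>t. t \<ge> 0 \<Longrightarrow> r \<le> p (x + t *\<^sub>R y) - t * p y" for r x
    unfolding q_def by (rule cINF_greatest) (use that in auto)
  have "q (x + z) \<le> q x + q z" if xz: "x \<in> S" "z \<in> S" for x z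
  proof -
    have "q (x + z) - (p (z + s *\<^sub>R y) - s * p y) \<le> q x" if s: "s \<ge> 0" for s
    proof (rule ge)
      fix t :: real assume t: "t \<ge> 0"
      have "q (x + z) \<le> p ((x + z) + (t + s) *\<^sub>R y) - (t + s) * p y"
        by (rule le) (use xz s t mem in auto)
      moreover have "p ((x + z) + (t + s) *\<^sub>R y) \<le> p (x + t *\<^sub>R y) + p (z + s *\<^sub>R y)"
        using add[of "x + t *\<^sub>R y" "z + s *\<^sub>R y"] xz mem by (simp add: algebra_simps)
      ultimately show "q (x + z) - (p (z + s *\<^sub>R y) - s * p y) \<le> p (x + t *\<^sub>R y) - t * p y"
        by (simp add: algebra_simps)
    qed
    then have "q (x + z) - q x \<le> p (z + s *\<^sub>R y) - s * p y" if "s \<ge> 0" for s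
      using that by (smt (verit, best))
    from ge[OF this] show ?thesis by simp
  qed
  moreover have "q (c *\<^sub>R x) = c * q x" if x: "x \<in> S" and c: "c \<ge> 0" for x c
  proof (cases "c = 0")
    case True
    have "q 0 \<le> 0" using le[of 0 0] subspace_0[OF S] sublinear_on_0[OF p S] by simp
    moreover have "0 \<le> q 0" by (rule ge) (simp add: scale[OF y])
    ultimately show ?thesis using True by simp
  next
    case False
    \<comment> \<open>One inequality suffices: for the vector \<open>c *\<^sub>R x\<close> and the
      factor \<open>1 / c\<close> it becomes the converse.\<close>
    have *: "q (d *\<^sub>R z) \<le> d * q z" if "z \<in> S" "d > 0" for d z
    proof -
      have "q (d *\<^sub>R z) / d \<le> q z"
      proof (rule ge)
        fix t :: real assume t: "t \<ge> 0"
        have "q (d *\<^sub>R z) \<le> p (d *\<^sub>R z + (d * t) *\<^sub>R y) - (d * t) * p y"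
          by (rule le) (use that t mem in auto)
        also have "\<dots> = d * (p (z + t *\<^sub>R y) - t * p y)"
          using scale[of "z + t *\<^sub>R y" d] that mem by (simp add: algebra_simps)
        finally show "q (d *\<^sub>R z) / d \<le> p (z + t *\<^sub>R y) - t * p y"
          using that by (simp add: field_simps)
      qed
      then show ?thesis using that by (simp add: field_simps)
    qed
    have "q x \<le> (1 / c) * q (c *\<^sub>R x)"
      using *[of "c *\<^sub>R x" "1 / c"] x c False mem by simp
    then show ?thesis using *[of x c] x c False by (simp add: field_simps)
  qed
  moreover have "q x \<le> p x" if "x \<in> S" for x using le[OF that, of 0] by simp
  moreover have "q (- y) \<le> - p y" using le[of "- y" 1] mem sublinear_on_0[OF p S] by simp
  ultimately show ?thesis unfolding sublinear_on_def by blast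
qed

text \<open>Zorn's lemma for the reversed pointwise order. The infimum of a chain is subadditive
  because, of two members, one lies below the other, so both summands can be evaluated at one
  member.\<close>

lemma minimal_sublinear_on:
  fixes p :: "'a::real_vector \<Rightarrow> real"
  assumes p: "sublinear_on S p" and S: "subspace S"
  shows "\<exists>m. sublinear_on S m \<and> (\<forall>x\<in>S. m x \<le> p x) \<and>
    (\<forall>q. sublinear_on S q \<and> (\<forall>x\<in>S. q x \<le> m x) \<longrightarrow> (\<forall>x\<in>S. q x = m x))"
proof -
  \<comment> \<open>Members of \<open>A\<close> vanish off \<open>S\<close>, which makes the
    pointwise order antisymmetric on \<open>A\<close>. \<open>P\<close> reverses that order, so a
    maximal element is a minimal functional.\<close>
  define A where "A = {q. sublinear_on S q \<and> (\<forall>x\<in>S. q x \<le> p x) \<and> (\<forall>x. x \<notin> S \<longrightarrow> q x = 0)}"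
  define P where "P q r \<longleftrightarrow> (\<forall>x. r x \<le> q x)" for q r :: "'a \<Rightarrow> real"
  have restr: "sublinear_on S (\<lambda>x. if x \<in> S then q x else 0) \<longleftrightarrow> sublinear_on S q" for q
    using S by (auto simp: sublinear_on_def subspace_add subspace_scale)
  have "\<exists>m\<in>A. \<forall>q\<in>A. P m q \<longrightarrow> q = m"
  proof (rule predicate_Zorn)
    show "partial_order_on A (relation_of P A)"
      by (rule partial_order_on_relation_ofI)
        (auto simp: P_def fun_eq_iff intro: order_trans antisym)
  next
    fix C assume "C \<in> Chains (relation_of P A)"
    then have CA: "C \<subseteq> A" and chain: "\<And>q r. q \<in> C \<Longrightarrow> r \<in> C \<Longrightarrow> P q r \<or> P r q"
      by (auto simp: Chains_def relation_of_def)
    show "\<exists>u\<in>A. \<forall>q\<in>C. P q u"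
    proof (cases "C = {}")
      case True
      have "(\<lambda>x. if x \<in> S then p x else 0) \<in> A" using p by (simp add: A_def restr)
      then show ?thesis using True by blast
    next
      case False
      define u where "u x = (INF q\<in>C. q x)" for x
      have qC: "sublinear_on S q" "x \<in> S \<Longrightarrow> q x \<le> p x" "x \<notin> S \<Longrightarrow> q x = 0" if "q \<in> C" for q x
        using that CA by (auto simp: A_def)
      have bdd: "bdd_below ((\<lambda>q. q x) ` C)" for x
      proof (cases "x \<in> S")
        case True
        show ?thesis
        proof (rule bdd_belowI2)
          fix q assume q: "q \<in> C"
          show "- p (- x) \<le> q x"
            using sublinear_on_minus[OF qC(1)[OF q] S True] qC(2)[OF q subspace_neg[OF S True]]
            by linarith
        qed
      next
        case False
        then show ?thesis using qC(3) by (intro bdd_belowI2[of _ 0]) (metis order_refl)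
      qed
      have le: "u x \<le> q x" if "q \<in> C" for q x
        unfolding u_def by (rule cINF_lower[OF bdd that])
      have ge: "r \<le> u x" if "\<And>q. q \<in> C \<Longrightarrow> r \<le> q x" for r x
        unfolding u_def by (rule cINF_greatest[OF False that])
      have "u (x + y) \<le> u x + u y" if xy: "x \<in> S" "y \<in> S" for x y
      proof -
        have *: "u (x + y) \<le> q x + r y" if "q \<in> C" "r \<in> C" for q r
        proof -
          obtain s where s: "s \<in> C" "s x \<le> q x" "s y \<le> r y"
            using chain[OF \<open>q \<in> C\<close> \<open>r \<in> C\<close>] \<open>q \<in> C\<close> \<open>r \<in> C\<close> unfolding P_def by blast
          have "u (x + y) \<le> s (x + y)" by (rule le[OF s(1)])
          also have "\<dots> \<le> s x + s y" using qC(1)[OF s(1)] xy by (auto simp: sublinear_on_def)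
          finally show ?thesis using s by simp
        qed
        have "u (x + y) - r y \<le> u x" if r: "r \<in> C" for r
          by (rule ge) (use *[OF _ r] in \<open>simp add: algebra_simps\<close>)
        then have "u (x + y) - u x \<le> u y"
          by (intro ge) (simp add: algebra_simps)
        then show ?thesis by simp
      qed
      moreover have "u (c *\<^sub>R x) = c * u x" if x: "x \<in> S" and c: "c \<ge> 0" for x c
      proof -
        have eq: "q (c *\<^sub>R x) = c * q x" if "q \<in> C" for q
          using qC(1)[OF that] x c by (auto simp: sublinear_on_def)
        show ?thesis
        proof (cases "c = 0")
          case True
          obtain q where q: "q \<in> C" using False by blast
          have q0: "q 0 = 0" if "q \<in> C" for q using sublinear_on_0[OF qC(1)[OF that] S] .
          have "0 \<le> u 0" by (rule ge) (metis q0 order_refl)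
          then have "u 0 = 0" using le[OF q, of 0] q0[OF q] by linarith
          then show ?thesis using True by simp
        next
          case c0: False
          have "u (c *\<^sub>R x) / c \<le> u x"
          proof (rule ge)
            fix q assume q: "q \<in> C"
            show "u (c *\<^sub>R x) / c \<le> q x"
              using le[OF q, of "c *\<^sub>R x"] eq[OF q] c c0 by (simp add: field_simps)
          qed
          moreover have "c * u x \<le> u (c *\<^sub>R x)"
          proof (rule ge)
            fix q assume q: "q \<in> C"
            show "c * u x \<le> q (c *\<^sub>R x)"
              using le[OF q, of x] eq[OF q] c by (simp add: mult_left_mono)
          qed
          ultimately show ?thesis using c c0 by (simp add: field_simps)
        qed
      qed
      moreover have "u x \<le> p x" if "x \<in> S" for x
        using le qC(2) that False by (meson all_not_in_conv order_trans)
      moreover have "u x = 0" if "x \<notin> S" for x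
        using qC(3)[OF _ that] False le ge by (metis antisym equals0I order_refl)
      ultimately have "u \<in> A" by (simp add: A_def sublinear_on_def)
      then show ?thesis using le by (auto simp: P_def)
    qed
  qed
  then obtain m where m: "m \<in> A" and min: "\<And>q. q \<in> A \<Longrightarrow> P m q \<Longrightarrow> q = m" by blast
  have "q x = m x" if q: "sublinear_on S q" "\<And>x. x \<in> S \<Longrightarrow> q x \<le> m x" and x: "x \<in> S" for q x
  proof -
    have "(\<lambda>x. if x \<in> S then q x else 0) = m"
      by (rule min) (use q m in \<open>auto simp: A_def P_def restr intro: order_trans\<close>)
    then show ?thesis using x by (auto simp: fun_eq_iff split: if_splits)
  qed
  with m show ?thesis unfolding A_def by blast
qed

text \<open>Lowering a minimal \<open>m\<close> in the direction \<open>- y\<close> cannot change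
  it, so \<open>m (- y) \<le> - m y\<close>; a sublinear functional that is odd is linear.\<close>

lemma linear_map_on_below_sublinear:
  fixes p :: "'a::real_vector \<Rightarrow> real"
  assumes p: "sublinear_on S p" and S: "subspace S"
  shows "\<exists>f. linear_map_on S f \<and> (\<forall>x\<in>S. f x \<le> p x)"
proof -
  obtain m where m: "sublinear_on S m" "\<And>x. x \<in> S \<Longrightarrow> m x \<le> p x"
    and min: "\<And>q x. sublinear_on S q \<Longrightarrow> (\<And>x. x \<in> S \<Longrightarrow> q x \<le> m x) \<Longrightarrow> x \<in> S \<Longrightarrow> q x = m x"
    using minimal_sublinear_on[OF p S] by blast
  have neg: "m (- y) = - m y" if y: "y \<in> S" for y
  proof -
    obtain q where "sublinear_on S q" "\<forall>x\<in>S. q x \<le> m x" "q (- y) \<le> - m y"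
      using sublinear_on_lower[OF m(1) S y] by blast
    then have "m (- y) \<le> - m y" using min[of q "- y"] subspace_neg[OF S y] by auto
    then show ?thesis using sublinear_on_minus[OF m(1) S y] by simp
  qed
  have sub: "m (x + y) \<le> m x + m y" if "x \<in> S" "y \<in> S" for x y
    using m(1) that by (auto simp: sublinear_on_def)
  have "linear_map_on S m" unfolding linear_map_on_def
  proof (intro conjI ballI allI)
    fix x y assume xy: "x \<in> S" "y \<in> S"
    show "m (x + y) = m x + m y"
      using sub[OF xy] sub[of "x + y" "- y"] neg[OF xy(2)] subspace_add[OF S xy]
        subspace_neg[OF S xy(2)] by simp
  next
    fix x c assume x: "x \<in> S"
    have pos: "m (d *\<^sub>R x) = d * m x" if "d \<ge> 0" for d
      using m(1) that x by (auto simp: sublinear_on_def)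
    show "m (c *\<^sub>R x) = c *\<^sub>R m x"
      using pos[of c] pos[of "- c"] neg[OF subspace_scale[OF S x, of c]] by (cases "c \<ge> 0") auto
  qed
  with m(2) show ?thesis by blast
qed

text \<open>The norm is first lowered at \<open>- y\<close>; a linear functional below the result is
  forced to take the value \<open>nrm V y\<close> at \<open>y\<close>.\<close>

lemma norming_functional:
  assumes V: "normed_space V" and y: "y \<in> spc V"
  shows "\<exists>f. linear_map_on (spc V) f \<and> (\<forall>x\<in>spc V. \<bar>f x\<bar> \<le> nrm V x) \<and> f y = nrm V y"
proof -
  note S = subspace_spc[OF V]
  have "sublinear_on (spc V) (nrm V)"
    using nrm_triangle[OF V] nrm_scaleR[OF V] by (auto simp: sublinear_on_def)
  then obtain q where q: "sublinear_on (spc V) q" "\<And>x. x \<in> spc V \<Longrightarrow> q x \<le> nrm V x"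
    "q (- y) \<le> - nrm V y"
    using sublinear_on_lower[OF _ S y] by blast
  then obtain f where f: "linear_map_on (spc V) f" "\<And>x. x \<in> spc V \<Longrightarrow> f x \<le> q x"
    using linear_map_on_below_sublinear[OF _ S] by blast
  have neg: "f (- x) = - f x" if "x \<in> spc V" for x
    using linear_map_onD(2)[OF f(1) that, of "-1"] by simp
  have le: "f x \<le> nrm V x" if "x \<in> spc V" for x using f(2)[OF that] q(2)[OF that] by linarith
  have "\<bar>f x\<bar> \<le> nrm V x" if "x \<in> spc V" for x
    using le[OF that] le[OF minus_in_spc[OF V that]] neg[OF that] nrm_minus[OF V that] by linarith
  moreover have "f y = nrm V y"
    using le[OF y] f(2)[OF minus_in_spc[OF V y]] q(3) neg[OF y] by linarith
  ultimately show ?thesis using f(1) by blast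
qed

section \<open>Cauchy sequences and the completion\<close>

lemma ndist_eq: "x \<in> spc V \<Longrightarrow> y \<in> spc V \<Longrightarrow> ndist V x y = nrm V (x - y)"
  by (simp add: ndist_def)

lemma cauchy_seqs_iff:
  assumes "normed_space V"
  shows "s \<in> cauchy_seqs V \<longleftrightarrow> (\<forall>n. s n \<in> spc V) \<and>
    (\<forall>\<epsilon>>0. \<exists>N. \<forall>m\<ge>N. \<forall>n\<ge>N. nrm V (s m - s n) < \<epsilon>)"
proof -
  interpret Metric_space "spc V" "ndist V" by (rule Metric_space_ndist[OF assms])
  show ?thesis
    by (auto simp: cauchy_seqs_def MCauchy_def ndist_eq image_subset_iff cong: conj_cong) 
qed

lemma cauchy_seqs_in_spc: "normed_space V \<Longrightarrow> s \<in> cauchy_seqs V \<Longrightarrow> s n \<in> spc V"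
  by (simp add: cauchy_seqs_iff)

lemma limitin_ndist_iff:
  assumes "normed_space V" "\<And>n. s n \<in> spc V"
  shows "limitin (Metric_space.mtopology (spc V) (ndist V)) s x sequentially \<longleftrightarrow>
    x \<in> spc V \<and> (\<lambda>n. nrm V (s n - x)) \<longlonglongrightarrow> 0"
proof -
  interpret Metric_space "spc V" "ndist V" by (rule Metric_space_ndist[OF assms(1)])
  show ?thesis
    using assms(2) nrm_nonneg[OF assms(1) diff_in_spc[OF assms(1)]]
    by (auto simp: limitin_metric tendsto_iff ndist_eq)
qed

lemma banach_space_iff:
  "banach_space V \<longleftrightarrow> normed_space V \<and>
    (\<forall>s\<in>cauchy_seqs V. \<exists>x\<in>spc V. (\<lambda>n. nrm V (s n - x)) \<longlonglongrightarrow> 0)"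
proof (cases "normed_space V")
  case True
  interpret Metric_space "spc V" "ndist V" by (rule Metric_space_ndist[OF True])
  have "(\<exists>x. limitin mtopology s x sequentially) \<longleftrightarrow>
      (\<exists>x\<in>spc V. (\<lambda>n. nrm V (s n - x)) \<longlonglongrightarrow> 0)" if "MCauchy s" for s
  proof -
    have "s n \<in> spc V" for n using that by (auto simp: MCauchy_def)
    from limitin_ndist_iff[of V s, OF True this] show ?thesis by blast
  qed
  then show ?thesis using True
    by (simp add: banach_space_def mcomplete_def cauchy_seqs_def)
qed (simp add: banach_space_def)

lemma const_in_cauchy_seqs: "normed_space V \<Longrightarrow> x \<in> spc V \<Longrightarrow> (\<lambda>_. x) \<in> cauchy_seqs V"
  by (simp add: cauchy_seqs_iff nrm_zero)

text \<open>One criterion for sums, multiples, isometric images and the first components of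
  sequences in \<open>alpha_space X\<close>. \<open>K\<close> and \<open>L\<close> may have any
  sign, so the proof replaces them by a positive \<open>M\<close>.\<close>

lemma cauchy_seqs_dominated:
  assumes V: "normed_space V" and W: "normed_space W" and W': "normed_space W'"
    and s: "s \<in> cauchy_seqs V" and t: "t \<in> cauchy_seqs W"
    and r: "\<And>n. r n \<in> spc W'"
    and le: "\<And>m n. nrm W' (r m - r n) \<le> K * nrm V (s m - s n) + L * nrm W (t m - t n)"
  shows "r \<in> cauchy_seqs W'"
  unfolding cauchy_seqs_iff[OF W']
proof (intro conjI allI impI r)
  fix \<epsilon> :: real assume \<epsilon>: "\<epsilon> > 0"
  define M where "M = max 1 (max \<bar>K\<bar> \<bar>L\<bar>)"
  have M: "M > 0" "K \<le> M" "L \<le> M" by (auto simp: M_def)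
  from s obtain N1 where N1: "\<And>m n. m \<ge> N1 \<Longrightarrow> n \<ge> N1 \<Longrightarrow> nrm V (s m - s n) < \<epsilon> / (2 * M)"
    using M \<epsilon> unfolding cauchy_seqs_iff[OF V] by (meson divide_pos_pos mult_pos_pos zero_less_numeral)
  from t obtain N2 where N2: "\<And>m n. m \<ge> N2 \<Longrightarrow> n \<ge> N2 \<Longrightarrow> nrm W (t m - t n) < \<epsilon> / (2 * M)"
    using M \<epsilon> unfolding cauchy_seqs_iff[OF W] by (meson divide_pos_pos mult_pos_pos zero_less_numeral)
  show "\<exists>N. \<forall>m\<ge>N. \<forall>n\<ge>N. nrm W' (r m - r n) < \<epsilon>"
  proof (intro exI[of _ "max N1 N2"] allI impI)
    fix m n assume mn: "max N1 N2 \<le> m" "max N1 N2 \<le> n"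
    have nn: "0 \<le> nrm V (s m - s n)" "0 \<le> nrm W (t m - t n)"
      using nrm_nonneg[OF V diff_in_spc[OF V]] nrm_nonneg[OF W diff_in_spc[OF W]]
        cauchy_seqs_in_spc[OF V s] cauchy_seqs_in_spc[OF W t] by auto
    have "nrm W' (r m - r n) \<le> M * nrm V (s m - s n) + M * nrm W (t m - t n)"
      using le[of m n] mult_right_mono[OF M(2) nn(1)] mult_right_mono[OF M(3) nn(2)] by linarith
    also have "\<dots> < M * (\<epsilon> / (2 * M)) + M * (\<epsilon> / (2 * M))"
      using N1[of m n] N2[of m n] mn M by (intro add_strict_mono mult_strict_left_mono) auto
    also have "\<dots> = \<epsilon>" using M by (simp add: field_simps)
    finally show "nrm W' (r m - r n) < \<epsilon>" .
  qed
qed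

lemma add_in_cauchy_seqs:
  assumes V: "normed_space V" and s: "s \<in> cauchy_seqs V" and t: "t \<in> cauchy_seqs V"
  shows "(\<lambda>n. s n + t n) \<in> cauchy_seqs V"
proof (rule cauchy_seqs_dominated[OF V V V s t])
  note mem = cauchy_seqs_in_spc[OF V s] cauchy_seqs_in_spc[OF V t]
  show "s n + t n \<in> spc V" for n by (intro add_in_spc[OF V] mem)
  show "nrm V (s m + t m - (s n + t n)) \<le> 1 * nrm V (s m - s n) + 1 * nrm V (t m - t n)" for m n
    using nrm_triangle[OF V diff_in_spc[OF V mem(1)[of m] mem(1)[of n]] diff_in_spc[OF V mem(2)[of m] mem(2)[of n]]]
    by (simp add: algebra_simps)
qed

lemma scaleR_in_cauchy_seqs:
  assumes V: "normed_space V" and s: "s \<in> cauchy_seqs V"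
  shows "(\<lambda>n. c *\<^sub>R s n) \<in> cauchy_seqs V"
proof (rule cauchy_seqs_dominated[OF V V V s s])
  note mem = cauchy_seqs_in_spc[OF V s]
  show "c *\<^sub>R s n \<in> spc V" for n by (intro scaleR_in_spc[OF V] mem)
  show "nrm V (c *\<^sub>R s m - c *\<^sub>R s n) \<le> \<bar>c\<bar> * nrm V (s m - s n) + 0 * nrm V (s m - s n)" for m n
    using nrm_scaleR[OF V diff_in_spc[OF V mem[of m] mem[of n]], of c]
    by (simp add: algebra_simps)
qed

lemma convergent_nrm:
  assumes V: "normed_space V" and s: "s \<in> cauchy_seqs V"
  shows "convergent (\<lambda>n. nrm V (s n))"
proof -
  have "Cauchy (\<lambda>n. nrm V (s n))"
  proof (rule metric_CauchyI)
    fix \<epsilon> :: real assume "\<epsilon> > 0"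
    then obtain N where "\<And>m n. m \<ge> N \<Longrightarrow> n \<ge> N \<Longrightarrow> nrm V (s m - s n) < \<epsilon>"
      using s unfolding cauchy_seqs_iff[OF V] by blast
    then show "\<exists>M. \<forall>m\<ge>M. \<forall>n\<ge>M. dist (nrm V (s m)) (nrm V (s n)) < \<epsilon>"
      using nrm_triangle_diff[OF V cauchy_seqs_in_spc[OF V s] cauchy_seqs_in_spc[OF V s]]
      unfolding dist_real_def by (meson le_less_trans)
  qed
  then show ?thesis by (rule Cauchy_convergent)
qed

lemma cauchy_class_iff:
  assumes "normed_space V" "s \<in> cauchy_seqs V"
  shows "t \<in> cauchy_class V s \<longleftrightarrow> t \<in> cauchy_seqs V \<and> (\<lambda>n. nrm V (s n - t n)) \<longlonglongrightarrow> 0"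
  using assms cauchy_seqs_in_spc[OF assms(1)]
  by (auto simp: cauchy_class_def ndist_eq)

lemma self_in_cauchy_class: "normed_space V \<Longrightarrow> s \<in> cauchy_seqs V \<Longrightarrow> s \<in> cauchy_class V s"
  by (simp add: cauchy_class_iff nrm_zero)

lemma nrm_null_add:
  assumes V: "normed_space V" and st: "\<And>n. s n \<in> spc V" "\<And>n. t n \<in> spc V"
    and "(\<lambda>n. nrm V (s n)) \<longlonglongrightarrow> 0" "(\<lambda>n. nrm V (t n)) \<longlonglongrightarrow> 0"
  shows "(\<lambda>n. nrm V (s n + t n)) \<longlonglongrightarrow> 0"
proof (rule tendsto_sandwich[OF _ _ tendsto_const])
  show "(\<lambda>n. nrm V (s n) + nrm V (t n)) \<longlonglongrightarrow> 0"
    using tendsto_add[OF assms(4,5)] by simp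
qed (use nrm_triangle[OF V st] nrm_nonneg[OF V add_in_spc[OF V st]] in auto)

lemma cauchy_class_eqI:
  assumes V: "normed_space V" and s: "s \<in> cauchy_seqs V" and t: "t \<in> cauchy_seqs V"
    and lim: "(\<lambda>n. nrm V (s n - t n)) \<longlonglongrightarrow> 0"
  shows "cauchy_class V s = cauchy_class V t"
proof -
  have lim': "(\<lambda>n. nrm V (t n - s n)) \<longlonglongrightarrow> 0"
    using lim nrm_minus_commute[OF V cauchy_seqs_in_spc[OF V s] cauchy_seqs_in_spc[OF V t]] by simp
  have *: "(\<lambda>n. nrm V (b n - c n)) \<longlonglongrightarrow> 0"
    if "a \<in> cauchy_seqs V" "b \<in> cauchy_seqs V" "c \<in> cauchy_seqs V"
      "(\<lambda>n. nrm V (b n - a n)) \<longlonglongrightarrow> 0" "(\<lambda>n. nrm V (a n - c n)) \<longlonglongrightarrow> 0" for a b c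
    using nrm_null_add[OF V _ _ that(4,5)] that(1-3)
    by (simp add: cauchy_seqs_in_spc[OF V] diff_in_spc[OF V])
  show ?thesis
    using *[OF s t _ lim'] *[OF t s _ lim] s t by (auto simp: cauchy_class_iff[OF V])
qed

section \<open>Norm, operations and distance of the completion, computed on representatives\<close>

lemma completionE:
  assumes "U \<in> completion V"
  obtains s where "s \<in> cauchy_seqs V" "U = cauchy_class V s"
  using assms by (auto simp: completion_def)

text \<open>Representatives of a class differ by a null sequence, so their norms share one limit;
  this justifies the definite description in \<open>completion_norm\<close>.\<close>

lemma completion_norm_tendsto:
  assumes V: "normed_space V" and s: "s \<in> cauchy_seqs V"
  shows "(\<lambda>n. nrm V (s n)) \<longlonglongrightarrow> completion_norm V (cauchy_class V s)"
proof -
  obtain r where r: "(\<lambda>n. nrm V (s n)) \<longlonglongrightarrow> r"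
    using convergent_nrm[OF V s] by (auto simp: convergent_def)
  have "(\<lambda>n. nrm V (t n)) \<longlonglongrightarrow> r" if "t \<in> cauchy_class V s" for t
  proof -
    have t: "t \<in> cauchy_seqs V" "(\<lambda>n. nrm V (s n - t n)) \<longlonglongrightarrow> 0"
      using that by (auto simp: cauchy_class_iff[OF V s])
    have "(\<lambda>n. nrm V (s n) - nrm V (t n)) \<longlonglongrightarrow> 0"
      by (rule Lim_null_comparison[OF _ t(2)])
        (use nrm_triangle_diff[OF V cauchy_seqs_in_spc[OF V s] cauchy_seqs_in_spc[OF V t(1)]] in simp)
    from tendsto_diff[OF r this] show ?thesis by simp
  qed
  then have "completion_norm V (cauchy_class V s) = r"
    unfolding completion_norm_def
    using self_in_cauchy_class[OF V s] r LIMSEQ_unique by (intro the_equality) blast+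
  with r show ?thesis by simp
qed

text \<open>The union over all representatives in \<open>completion_add\<close> collapses, because
  every choice yields the same class.\<close>

lemma completion_add_class:
  assumes V: "normed_space V" and s: "s \<in> cauchy_seqs V" and t: "t \<in> cauchy_seqs V"
  shows "completion_add V (cauchy_class V s) (cauchy_class V t) = cauchy_class V (\<lambda>n. s n + t n)"
proof -
  have "cauchy_class V (\<lambda>n. s' n + t' n) = cauchy_class V (\<lambda>n. s n + t n)"
    if "s' \<in> cauchy_class V s" "t' \<in> cauchy_class V t" for s' t'
  proof -
    have s': "s' \<in> cauchy_seqs V" "(\<lambda>n. nrm V (s n - s' n)) \<longlonglongrightarrow> 0"
      and t': "t' \<in> cauchy_seqs V" "(\<lambda>n. nrm V (t n - t' n)) \<longlonglongrightarrow> 0"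
      using that by (auto simp: cauchy_class_iff[OF V s] cauchy_class_iff[OF V t])
    have "(\<lambda>n. nrm V ((s n - s' n) + (t n - t' n))) \<longlonglongrightarrow> 0"
      by (rule nrm_null_add[OF V _ _ s'(2) t'(2)])
        (simp_all add: diff_in_spc[OF V] cauchy_seqs_in_spc[OF V] s s' t t')
    then have "(\<lambda>n. nrm V ((s n + t n) - (s' n + t' n))) \<longlonglongrightarrow> 0"
      by (simp add: algebra_simps)
    then show ?thesis
      using cauchy_class_eqI[OF V add_in_cauchy_seqs[OF V s t] add_in_cauchy_seqs[OF V s'(1) t'(1)]]
      by simp
  qed
  then show ?thesis
    using self_in_cauchy_class[OF V s] self_in_cauchy_class[OF V t]
    unfolding completion_add_def by blast
qed

lemma completion_scale_class:
  assumes V: "normed_space V" and s: "s \<in> cauchy_seqs V"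
  shows "completion_scale V c (cauchy_class V s) = cauchy_class V (\<lambda>n. c *\<^sub>R s n)"
proof -
  have "cauchy_class V (\<lambda>n. c *\<^sub>R s' n) = cauchy_class V (\<lambda>n. c *\<^sub>R s n)"
    if "s' \<in> cauchy_class V s" for s'
  proof -
    have s': "s' \<in> cauchy_seqs V" "(\<lambda>n. nrm V (s n - s' n)) \<longlonglongrightarrow> 0"
      using that by (auto simp: cauchy_class_iff[OF V s])
    have "nrm V (c *\<^sub>R s n - c *\<^sub>R s' n) = \<bar>c\<bar> * nrm V (s n - s' n)" for n
      using nrm_scaleR[OF V diff_in_spc[OF V cauchy_seqs_in_spc[OF V s] cauchy_seqs_in_spc[OF V s'(1)]]]
      by (simp add: scaleR_diff_right)
    then have "(\<lambda>n. nrm V (c *\<^sub>R s n - c *\<^sub>R s' n)) \<longlonglongrightarrow> 0"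
      using tendsto_mult_right_zero[OF s'(2)] by simp
    then show ?thesis
      using cauchy_class_eqI[OF V scaleR_in_cauchy_seqs[OF V s] scaleR_in_cauchy_seqs[OF V s'(1)]]
      by simp
  qed
  then show ?thesis
    using self_in_cauchy_class[OF V s] unfolding completion_scale_def by blast
qed

lemma completion_dist_tendsto:
  assumes V: "normed_space V" and s: "s \<in> cauchy_seqs V" and t: "t \<in> cauchy_seqs V"
  shows "(\<lambda>n. nrm V (s n - t n)) \<longlonglongrightarrow> completion_dist V (cauchy_class V s) (cauchy_class V t)"
proof -
  note t' = scaleR_in_cauchy_seqs[OF V t, of "-1"]
  show ?thesis
    using completion_norm_tendsto[OF V add_in_cauchy_seqs[OF V s t']]
    by (simp add: completion_dist_def completion_scale_class[OF V t]
        completion_add_class[OF V s t', simplified])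
qed

lemma completion_dist_to_completion_tendsto:
  assumes V: "normed_space V" and s: "s \<in> cauchy_seqs V" and v: "v \<in> spc V"
  shows "(\<lambda>n. nrm V (s n - v)) \<longlonglongrightarrow> completion_dist V (cauchy_class V s) (to_completion V v)"
  unfolding to_completion_def
  by (rule completion_dist_tendsto[OF V s const_in_cauchy_seqs[OF V v]])

lemma completion_norm_to_completion:
  assumes V: "normed_space V" and v: "v \<in> spc V"
  shows "completion_norm V (to_completion V v) = nrm V v"
  using completion_norm_tendsto[OF V const_in_cauchy_seqs[OF V v]]
  by (simp add: to_completion_def tendsto_const_iff)

lemma completion_dist_to_completion:
  assumes V: "normed_space V" and v: "v \<in> spc V" and w: "w \<in> spc V"
  shows "completion_dist V (to_completion V v) (to_completion V w) = nrm V (v - w)"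
  using completion_dist_to_completion_tendsto[OF V const_in_cauchy_seqs[OF V v] w]
  by (simp add: to_completion_def tendsto_const_iff)

lemma to_completion_in_completion:
  "normed_space V \<Longrightarrow> v \<in> spc V \<Longrightarrow> to_completion V v \<in> completion V"
  by (simp add: to_completion_def completion_def const_in_cauchy_seqs)

text \<open>The extension of \<open>T\<close> by continuity. As in \<open>completion_add\<close>,
  the union over representatives avoids a choice; for isometric \<open>T\<close> all its members
  coincide.\<close>

definition completion_map ::
    "'b::real_vector nspace \<Rightarrow> ('a \<Rightarrow> 'b) \<Rightarrow> (nat \<Rightarrow> 'a) set \<Rightarrow> (nat \<Rightarrow> 'b) set"
  where "completion_map W T U = (\<Union>s\<in>U. cauchy_class W (\<lambda>n. T (s n)))"

lemma linear_isometry_diff: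
  assumes "linear_isometry V W T" "normed_space V" "x \<in> spc V" "y \<in> spc V"
  shows "nrm W (T x - T y) = nrm V (x - y)"
  using assms linear_map_on_diff[OF _ subspace_spc[OF assms(2)] assms(3,4), of T] diff_in_spc[OF assms(2-4)]
  by (metis linear_isometry_def)

lemma linear_isometry_cauchy_seqs:
  assumes V: "normed_space V" and W: "normed_space W" and T: "linear_isometry V W T"
    and s: "s \<in> cauchy_seqs V"
  shows "(\<lambda>n. T (s n)) \<in> cauchy_seqs W"
proof (rule cauchy_seqs_dominated[OF V V W s s])
  note mem = cauchy_seqs_in_spc[OF V s]
  show "T (s n) \<in> spc W" for n using T mem by (auto simp: linear_isometry_def)
  show "nrm W (T (s m) - T (s n)) \<le> 1 * nrm V (s m - s n) + 0 * nrm V (s m - s n)" for m n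
    using linear_isometry_diff[OF T V mem mem] by simp
qed

lemma completion_map_class:
  assumes V: "normed_space V" and W: "normed_space W" and T: "linear_isometry V W T"
    and s: "s \<in> cauchy_seqs V"
  shows "completion_map W T (cauchy_class V s) = cauchy_class W (\<lambda>n. T (s n))"
proof -
  have "cauchy_class W (\<lambda>n. T (t n)) = cauchy_class W (\<lambda>n. T (s n))" if "t \<in> cauchy_class V s" for t
  proof -
    have t: "t \<in> cauchy_seqs V" "(\<lambda>n. nrm V (s n - t n)) \<longlonglongrightarrow> 0"
      using that by (auto simp: cauchy_class_iff[OF V s])
    show ?thesis
      using cauchy_class_eqI[OF W linear_isometry_cauchy_seqs[OF V W T s] linear_isometry_cauchy_seqs[OF V W T t(1)]]
        linear_isometry_diff[OF T V cauchy_seqs_in_spc[OF V s] cauchy_seqs_in_spc[OF V t(1)]] t(2) by simp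
  qed
  then show ?thesis
    using self_in_cauchy_class[OF V s] unfolding completion_map_def by blast
qed

lemma completion_map_to_completion:
  assumes "normed_space V" "normed_space W" "linear_isometry V W T" "v \<in> spc V"
  shows "completion_map W T (to_completion V v) = to_completion W (T v)"
  using completion_map_class[OF assms(1-3) const_in_cauchy_seqs[OF assms(1,4)]]
  by (simp add: to_completion_def)

lemma completion_isometry_completion_map:
  assumes V: "normed_space V" and W: "normed_space W" and T: "linear_isometry V W T"
  shows "completion_isometry V W (completion_map W T)"
proof -
  note C = completion_map_class[OF V W T] and S = linear_isometry_cauchy_seqs[OF V W T]
  have add: "T (x + y) = T x + T y" and scale: "T (c *\<^sub>R x) = c *\<^sub>R T x"
    and nrm: "nrm W (T x) = nrm V x" if "x \<in> spc V" "y \<in> spc V" for x y c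
    using T that by (auto simp: linear_isometry_def linear_map_on_def)
  note mem = cauchy_seqs_in_spc[OF V]
  show ?thesis unfolding completion_isometry_def
  proof (intro conjI ballI allI)
    show "completion_map W T ` completion V \<subseteq> completion W"
      using C S by (auto simp: completion_def)
  next
    fix u v assume "u \<in> completion V" "v \<in> completion V"
    then obtain s t where st: "s \<in> cauchy_seqs V" "t \<in> cauchy_seqs V"
        "u = cauchy_class V s" "v = cauchy_class V t"
      by (auto elim!: completionE)
    show "completion_map W T (completion_add V u v) =
        completion_add W (completion_map W T u) (completion_map W T v)"
      using st by (simp add: completion_add_class[OF V] C add_in_cauchy_seqs[OF V]
          completion_add_class[OF W] S add mem)
  next
    fix u c assume "u \<in> completion V"
    then obtain s where s: "s \<in> cauchy_seqs V" "u = cauchy_class V s" by (auto elim!: completionE)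
    show "completion_map W T (completion_scale V c u) = completion_scale W c (completion_map W T u)"
      using s by (simp add: completion_scale_class[OF V] C scaleR_in_cauchy_seqs[OF V]
          completion_scale_class[OF W] S scale[OF mem mem])
  next
    fix u assume "u \<in> completion V"
    then obtain s where s: "s \<in> cauchy_seqs V" "u = cauchy_class V s" by (auto elim!: completionE)
    have "(\<lambda>n. nrm V (s n)) \<longlonglongrightarrow> completion_norm W (cauchy_class W (\<lambda>n. T (s n)))"
      using completion_norm_tendsto[OF W S[OF s(1)]] nrm[OF mem[OF s(1)] mem[OF s(1)]] by simp
    with completion_norm_tendsto[OF V s(1)]
    show "completion_norm W (completion_map W T u) = completion_norm V u"
      using LIMSEQ_unique C[OF s(1)] s(2) by metis
  qed
qed

section \<open>The projective tensor norm\<close>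

lemma bilinear_form_onD:
  assumes "bilinear_form_on S T B"
  shows "x \<in> S \<Longrightarrow> x' \<in> S \<Longrightarrow> y \<in> T \<Longrightarrow> B (x + x') y = B x y + B x' y"
    and "x \<in> S \<Longrightarrow> y \<in> T \<Longrightarrow> B (c *\<^sub>R x) y = c * B x y"
    and "x \<in> S \<Longrightarrow> y \<in> T \<Longrightarrow> y' \<in> T \<Longrightarrow> B x (y + y') = B x y + B x y'"
    and "x \<in> S \<Longrightarrow> y \<in> T \<Longrightarrow> B x (c *\<^sub>R y) = c * B x y"
  using assms by (auto simp: bilinear_form_on_def linear_map_on_def)

lemma sum_fun_apply: "(\<Sum>i\<in>A. f i) x = (\<Sum>i\<in>A. f i x)"
  for f :: "'i \<Rightarrow> 'a \<Rightarrow> 'b::comm_monoid_add"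
  by (induction A rule: infinite_finite_induct) simp_all

lemma elem_tensor_apply:
  "bilinear_form_on (spc X) (spc Y) B \<Longrightarrow> elem_tensor X Y x y B = B x y"
  by (simp add: elem_tensor_def)

lemma elem_tensor_add_left:
  "x \<in> spc X \<Longrightarrow> x' \<in> spc X \<Longrightarrow> y \<in> spc Y \<Longrightarrow>
    elem_tensor X Y (x + x') y = elem_tensor X Y x y + elem_tensor X Y x' y"
  by (auto simp: elem_tensor_def fun_eq_iff bilinear_form_onD)

lemma elem_tensor_scaleR_left:
  "x \<in> spc X \<Longrightarrow> y \<in> spc Y \<Longrightarrow> elem_tensor X Y (c *\<^sub>R x) y = c *\<^sub>R elem_tensor X Y x y"
  by (auto simp: elem_tensor_def fun_eq_iff bilinear_form_onD scaleR_fun_def)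

lemma elem_tensor_add_right:
  "x \<in> spc X \<Longrightarrow> y \<in> spc Y \<Longrightarrow> y' \<in> spc Y \<Longrightarrow>
    elem_tensor X Y x (y + y') = elem_tensor X Y x y + elem_tensor X Y x y'"
  by (auto simp: elem_tensor_def fun_eq_iff bilinear_form_onD)

lemma elem_tensor_scaleR_right:
  "x \<in> spc X \<Longrightarrow> y \<in> spc Y \<Longrightarrow> elem_tensor X Y x (c *\<^sub>R y) = c *\<^sub>R elem_tensor X Y x y"
  by (auto simp: elem_tensor_def fun_eq_iff bilinear_form_onD scaleR_fun_def)

lemma elem_tensor_in_algebraic_tensor:
  "x \<in> spc X \<Longrightarrow> y \<in> spc Y \<Longrightarrow> elem_tensor X Y x y \<in> algebraic_tensor X Y"
  unfolding algebraic_tensor_def by (rule span_base) blast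

lemma sum_elem_tensor_in_algebraic_tensor:
  "(\<And>i. i \<in> A \<Longrightarrow> x i \<in> spc X \<and> y i \<in> spc Y) \<Longrightarrow>
    (\<Sum>i\<in>A. elem_tensor X Y (x i) (y i)) \<in> algebraic_tensor X Y"
  using elem_tensor_in_algebraic_tensor unfolding algebraic_tensor_def by (intro span_sum) fast

definition tensor_rep ::
    "'a::real_vector nspace \<Rightarrow> 'b::real_vector nspace \<Rightarrow> nat \<Rightarrow> (nat \<Rightarrow> 'a) \<Rightarrow> (nat \<Rightarrow> 'b) \<Rightarrow> ('a, 'b) tensor \<Rightarrow> bool"
  where "tensor_rep X Y n x y u \<longleftrightarrow>
    (\<forall>i<n. x i \<in> spc X \<and> y i \<in> spc Y) \<and> u = (\<Sum>i<n. elem_tensor X Y (x i) (y i))"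

lemma sum_lessThan_add:
  "(\<Sum>i<n + m. f i) = (\<Sum>i<n. f i) + (\<Sum>i<m. f (n + i))" for f :: "nat \<Rightarrow> 'a::comm_monoid_add"
  by (induction m) (simp_all add: add.assoc)

lemma tensor_rep_add:
  assumes "tensor_rep X Y n x y u" "tensor_rep X Y m x' y' v"
  shows "\<exists>x'' y''. tensor_rep X Y (n + m) x'' y'' (u + v) \<and>
    (\<Sum>i<n + m. nrm X (x'' i) * nrm Y (y'' i)) =
    (\<Sum>i<n. nrm X (x i) * nrm Y (y i)) + (\<Sum>i<m. nrm X (x' i) * nrm Y (y' i))"
proof (intro exI conjI)
  define x'' where "x'' i = (if i < n then x i else x' (i - n))" for i
  define y'' where "y'' i = (if i < n then y i else y' (i - n))" for i
  show "tensor_rep X Y (n + m) x'' y'' (u + v)"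
    using assms unfolding tensor_rep_def x''_def y''_def by (auto simp: sum_lessThan_add)
  show "(\<Sum>i<n + m. nrm X (x'' i) * nrm Y (y'' i)) =
      (\<Sum>i<n. nrm X (x i) * nrm Y (y i)) + (\<Sum>i<m. nrm X (x' i) * nrm Y (y' i))"
    by (simp add: sum_lessThan_add x''_def y''_def)
qed

lemma tensor_rep_scaleR:
  assumes X: "normed_space X" and "tensor_rep X Y n x y u"
  shows "tensor_rep X Y n (\<lambda>i. c *\<^sub>R x i) y (c *\<^sub>R u)"
    and "(\<Sum>i<n. nrm X (c *\<^sub>R x i) * nrm Y (y i)) = \<bar>c\<bar> * (\<Sum>i<n. nrm X (x i) * nrm Y (y i))"
  using assms
  by (auto simp: tensor_rep_def scaleR_in_spc nrm_scaleR elem_tensor_scaleR_left scaleR_sum_right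
      sum_distrib_left mult.assoc)

text \<open>Scalars are absorbed into the first factors, so every element of the span is a plain sum
  of elementary tensors and the infimum in \<open>projective_norm\<close> is over a nonempty
  set.\<close>

lemma algebraic_tensor_rep:
  assumes X: "normed_space X" and u: "u \<in> algebraic_tensor X Y"
  shows "\<exists>n x y. tensor_rep X Y n x y u"
  using u unfolding algebraic_tensor_def
proof (induction rule: span_induct_alt)
  case base
  have "tensor_rep X Y 0 x y 0" for x y by (simp add: tensor_rep_def)
  then show ?case by blast
next
  case (step c e u)
  from step.hyps obtain x y where xy: "e = elem_tensor X Y x y" "x \<in> spc X" "y \<in> spc Y" by blast
  from step.IH obtain n x' y' where u: "tensor_rep X Y n x' y' u" by blast
  have "tensor_rep X Y 1 (\<lambda>_. x) (\<lambda>_. y) e" using xy by (simp add: tensor_rep_def)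
  from tensor_rep_add[OF tensor_rep_scaleR(1)[OF X this, of c] u] show ?case by blast
qed

lemma tensor_rep_in_algebraic_tensor:
  "tensor_rep X Y n x y u \<Longrightarrow> u \<in> algebraic_tensor X Y"
  using sum_elem_tensor_in_algebraic_tensor[of "{..<n}"] by (auto simp: tensor_rep_def)

lemma projective_norm_alt:
  "projective_norm X Y u =
    Inf {(\<Sum>i<n. nrm X (x i) * nrm Y (y i)) |n x y. tensor_rep X Y n x y u}"
  by (simp add: projective_norm_def tensor_rep_def conj_commute)

lemma tensor_rep_sum_nonneg:
  assumes "normed_space X" "normed_space Y" "tensor_rep X Y n x y u"
  shows "0 \<le> (\<Sum>i<n. nrm X (x i) * nrm Y (y i))"
  using assms by (intro sum_nonneg mult_nonneg_nonneg nrm_nonneg) (auto simp: tensor_rep_def)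

lemma projective_norm_le:
  assumes "normed_space X" "normed_space Y" "tensor_rep X Y n x y u"
  shows "projective_norm X Y u \<le> (\<Sum>i<n. nrm X (x i) * nrm Y (y i))"
  unfolding projective_norm_alt
proof (rule cInf_lower)
  show "bdd_below {(\<Sum>i<n. nrm X (x i) * nrm Y (y i)) |n x y. tensor_rep X Y n x y u}"
    using tensor_rep_sum_nonneg[OF assms(1,2)] by (intro bdd_belowI[of _ 0]) auto
qed (use assms(3) in blast)

lemma projective_norm_ge:
  assumes "normed_space X" "u \<in> algebraic_tensor X Y"
    and "\<And>n x y. tensor_rep X Y n x y u \<Longrightarrow> r \<le> (\<Sum>i<n. nrm X (x i) * nrm Y (y i))"
  shows "r \<le> projective_norm X Y u"
  unfolding projective_norm_alt
  by (rule cInf_greatest) (use algebraic_tensor_rep[OF assms(1,2)] assms(3) in blast)+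

lemma projective_norm_nonneg:
  assumes "normed_space X" "normed_space Y" "u \<in> algebraic_tensor X Y"
  shows "0 \<le> projective_norm X Y u"
  by (rule projective_norm_ge[OF assms(1,3) tensor_rep_sum_nonneg[OF assms(1,2)]])

lemma projective_norm_add:
  assumes X: "normed_space X" and Y: "normed_space Y"
    and u: "u \<in> algebraic_tensor X Y" and v: "v \<in> algebraic_tensor X Y"
  shows "projective_norm X Y (u + v) \<le> projective_norm X Y u + projective_norm X Y v"
proof -
  have *: "projective_norm X Y (u + v) \<le>
      (\<Sum>i<n. nrm X (x i) * nrm Y (y i)) + (\<Sum>i<m. nrm X (x' i) * nrm Y (y' i))"
    if "tensor_rep X Y n x y u" "tensor_rep X Y m x' y' v" for n m x y x' y'
    using tensor_rep_add[OF that] projective_norm_le[OF X Y] by metis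
  have "projective_norm X Y (u + v) - (\<Sum>i<n. nrm X (x i) * nrm Y (y i)) \<le> projective_norm X Y v"
    if "tensor_rep X Y n x y u" for n x y
    by (rule projective_norm_ge[OF X v]) (use *[OF that] in \<open>simp add: algebra_simps\<close>)
  then have "projective_norm X Y (u + v) - projective_norm X Y v \<le> projective_norm X Y u"
    by (intro projective_norm_ge[OF X u]) (simp add: algebra_simps)
  then show ?thesis by simp
qed

lemma algebraic_tensor_scaleR: "u \<in> algebraic_tensor X Y \<Longrightarrow> c *\<^sub>R u \<in> algebraic_tensor X Y"
  by (simp add: algebraic_tensor_def span_scale)

lemma projective_norm_scaleR:
  assumes X: "normed_space X" and Y: "normed_space Y" and u: "u \<in> algebraic_tensor X Y"
  shows "projective_norm X Y (c *\<^sub>R u) = \<bar>c\<bar> * projective_norm X Y u"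
proof -
  have le: "projective_norm X Y (d *\<^sub>R v) \<le> \<bar>d\<bar> * projective_norm X Y v"
    if v: "v \<in> algebraic_tensor X Y" and d: "d \<noteq> 0" for d v
  proof -
    have "projective_norm X Y (d *\<^sub>R v) / \<bar>d\<bar> \<le> projective_norm X Y v"
    proof (rule projective_norm_ge[OF X v])
      fix n x y assume r: "tensor_rep X Y n x y v"
      show "projective_norm X Y (d *\<^sub>R v) / \<bar>d\<bar> \<le> (\<Sum>i<n. nrm X (x i) * nrm Y (y i))"
        using projective_norm_le[OF X Y tensor_rep_scaleR(1)[OF X r, of d]] d
        unfolding tensor_rep_scaleR(2)[OF X r] by (simp add: pos_divide_le_eq mult.commute)
    qed
    then show ?thesis using d by (simp add: field_simps)
  qed
  show ?thesis
  proof (cases "c = 0")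
    case True
    have "projective_norm X Y 0 \<le> 0"
      using projective_norm_le[OF X Y, of 0 _ _ 0] by (simp add: tensor_rep_def)
    moreover have "0 \<le> projective_norm X Y 0"
      by (rule projective_norm_nonneg[OF X Y]) (simp add: algebraic_tensor_def span_zero)
    ultimately show ?thesis using True by simp
  next
    case False
    have "projective_norm X Y u \<le> \<bar>1 / c\<bar> * projective_norm X Y (c *\<^sub>R u)"
      using le[OF algebraic_tensor_scaleR[OF u], of "1 / c" c] False by simp
    then show ?thesis using le[OF u False] False by (simp add: field_simps)
  qed
qed

text \<open>The easy half of the duality with bounded bilinear forms: all representations of
  \<open>u\<close> give the same value \<open>u B\<close>. Definiteness of the norm and
  nonattainment both rest on it.\<close>

lemma abs_tensor_apply_le:
  assumes X: "normed_space X" and Y: "normed_space Y" and u: "u \<in> algebraic_tensor X Y"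
    and B: "bilinear_form_on (spc X) (spc Y) B"
    and le: "\<And>x y. x \<in> spc X \<Longrightarrow> y \<in> spc Y \<Longrightarrow> \<bar>B x y\<bar> \<le> nrm X x * nrm Y y"
  shows "\<bar>u B\<bar> \<le> projective_norm X Y u"
proof (rule projective_norm_ge[OF X u])
  fix n x y assume "tensor_rep X Y n x y u"
  then have "u B = (\<Sum>i<n. B (x i) (y i))" and xy: "\<And>i. i < n \<Longrightarrow> x i \<in> spc X \<and> y i \<in> spc Y"
    by (auto simp: tensor_rep_def sum_fun_apply elem_tensor_apply[OF B])
  then have "\<bar>u B\<bar> \<le> (\<Sum>i<n. \<bar>B (x i) (y i)\<bar>)" by simp
  also have "\<dots> \<le> (\<Sum>i<n. nrm X (x i) * nrm Y (y i))" by (rule sum_mono) (use xy le in auto)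
  finally show "\<bar>u B\<bar> \<le> (\<Sum>i<n. nrm X (x i) * nrm Y (y i))" .
qed

text \<open>Induction on the number of terms. A functional norming \<open>x n\<close> solves the
  hypothesis for \<open>y n\<close> as a combination of the other \<open>y i\<close>; substituting
  it gives a representation with one term less that satisfies the hypothesis again.\<close>

lemma tensor_rep_eq_0:
  assumes X: "normed_space X" and Y: "normed_space Y" and "tensor_rep X Y n x y u"
    and "\<And>f. linear_map_on (spc X) f \<Longrightarrow> (\<forall>x\<in>spc X. \<bar>f x\<bar> \<le> nrm X x) \<Longrightarrow>
      (\<Sum>i<n. f (x i) *\<^sub>R y i) = 0"
  shows "u = 0"
  using assms(3,4)
proof (induction n arbitrary: x)
  case 0
  then show ?case by (simp add: tensor_rep_def)
next
  case (Suc n)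
  have xy: "\<And>i. i \<le> n \<Longrightarrow> x i \<in> spc X" "\<And>i. i \<le> n \<Longrightarrow> y i \<in> spc Y"
    and u: "u = (\<Sum>i<n. elem_tensor X Y (x i) (y i)) + elem_tensor X Y (x n) (y n)"
    using Suc.prems(1) by (auto simp: tensor_rep_def less_Suc_eq_le)
  show ?case
  proof (cases "x n = 0")
    case True
    have "elem_tensor X Y (0 *\<^sub>R 0) (y n) = 0"
      using elem_tensor_scaleR_left[OF zero_in_spc[OF X] xy(2)[of n], of 0] by simp
    then have "tensor_rep X Y n x y u" using u xy True by (simp add: tensor_rep_def)
    moreover have "(\<Sum>i<n. f (x i) *\<^sub>R y i) = 0"
      if "linear_map_on (spc X) f" "\<forall>x\<in>spc X. \<bar>f x\<bar> \<le> nrm X x" for f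
      using Suc.prems(2)[OF that] True linear_map_on_0[OF that(1) subspace_spc[OF X]] by simp
    ultimately show ?thesis by (rule Suc.IH)
  next
    case False
    obtain f where f: "linear_map_on (spc X) f" "\<forall>x\<in>spc X. \<bar>f x\<bar> \<le> nrm X x" "f (x n) = nrm X (x n)"
      using norming_functional[OF X xy(1)[of n]] by blast
    have fn: "f (x n) \<noteq> 0" using f(3) False nrm_eq_0_iff[OF X xy(1)[of n]] by simp
    define a where "a i = f (x i) / f (x n)" for i
    have "f (x n) *\<^sub>R y n = - (\<Sum>i<n. f (x i) *\<^sub>R y i)"
      using Suc.prems(2)[OF f(1,2)] by (simp add: add_eq_0_iff)
    then have "(1 / f (x n)) *\<^sub>R (f (x n) *\<^sub>R y n) = (1 / f (x n)) *\<^sub>R (- (\<Sum>i<n. f (x i) *\<^sub>R y i))"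
      by simp
    then have yn: "y n = (\<Sum>i<n. - a i *\<^sub>R y i)"
      using fn by (simp add: a_def scaleR_sum_right sum_negf)
    define x' where "x' i = x i + (- a i) *\<^sub>R x n" for i
    have lin: "h (y n) = (\<Sum>i<n. - a i *\<^sub>R h (y i))"
      if "linear_map_on (spc Y) h" for h :: "_ \<Rightarrow> 'z::real_vector"
      using linear_map_on_sum[OF that subspace_spc[OF Y], of "{..<n}" "\<lambda>i. - a i *\<^sub>R y i"]
        linear_map_onD(2)[OF that] xy(2) scaleR_in_spc[OF Y] yn by (simp del: scaleR_minus_left)
    have "linear_map_on (spc Y) (elem_tensor X Y (x n))"
      using xy(1)[of n] by (simp add: linear_map_on_def elem_tensor_add_right elem_tensor_scaleR_right)
    from lin[OF this]
    have "u = (\<Sum>i<n. elem_tensor X Y (x i) (y i) + (- a i) *\<^sub>R elem_tensor X Y (x n) (y i))"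
      using u by (simp add: sum_subtractf sum_negf)
    also have "\<dots> = (\<Sum>i<n. elem_tensor X Y (x' i) (y i))"
      using xy scaleR_in_spc[OF X]
      by (intro sum.cong refl)
        (simp add: x'_def elem_tensor_add_left elem_tensor_scaleR_left del: scaleR_minus_left)
    finally have "tensor_rep X Y n x' y u"
      using xy by (auto simp: tensor_rep_def x'_def intro!: diff_in_spc[OF X] scaleR_in_spc[OF X])
    moreover have "(\<Sum>i<n. g (x' i) *\<^sub>R y i) = 0"
      if g: "linear_map_on (spc X) g" "\<forall>x\<in>spc X. \<bar>g x\<bar> \<le> nrm X x" for g
    proof -
      have "g (x' i) = g (x i) + - a i * g (x n)" if "i < n" for i
        using that xy linear_map_onD[OF g(1)] scaleR_in_spc[OF X]
        by (simp add: x'_def del: scaleR_minus_left)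
      \<comment> \<open>The corrections in \<open>x'\<close> add up to
        \<open>g (x n) *\<^sub>R y n\<close>, the term that the shorter sum lacks.\<close>
      then have "(\<Sum>i<n. g (x' i) *\<^sub>R y i) = (\<Sum>i<n. g (x i) *\<^sub>R y i + g (x n) *\<^sub>R (- a i *\<^sub>R y i))"
        by (intro sum.cong refl) (simp add: scaleR_diff_left mult.commute)
      also have "\<dots> = (\<Sum>i<n. g (x i) *\<^sub>R y i) + g (x n) *\<^sub>R (\<Sum>i<n. - a i *\<^sub>R y i)"
        by (simp only: sum.distrib scaleR_sum_right)
      also have "\<dots> = 0" using Suc.prems(2)[OF g] yn by simp
      finally show ?thesis .
    qed
    ultimately show ?thesis by (rule Suc.IH)
  qed
qed

text \<open>A tensor of norm 0 vanishes on all products of functionals of norm at most 1. Taking the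
  second one norming for \<open>v\<close> shows that contracting \<open>u\<close> with
  \<open>f\<close> gives 0, for every such \<open>f\<close>.\<close>

lemma projective_norm_eq_0:
  assumes X: "normed_space X" and Y: "normed_space Y" and u: "u \<in> algebraic_tensor X Y"
    and 0: "projective_norm X Y u = 0"
  shows "u = 0"
proof -
  obtain n x y where r: "tensor_rep X Y n x y u" using algebraic_tensor_rep[OF X u] by blast
  then have xy: "\<And>i. i < n \<Longrightarrow> x i \<in> spc X" "\<And>i. i < n \<Longrightarrow> y i \<in> spc Y"
    and u_eq: "u = (\<Sum>i<n. elem_tensor X Y (x i) (y i))"
    by (auto simp: tensor_rep_def)
  show ?thesis
  proof (rule tensor_rep_eq_0[OF X Y r])
    fix f assume f: "linear_map_on (spc X) f" "\<forall>x\<in>spc X. \<bar>f x\<bar> \<le> nrm X x"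
    define v where "v = (\<Sum>i<n. f (x i) *\<^sub>R y i)"
    have v: "v \<in> spc Y" unfolding v_def using xy by (intro sum_in_spc[OF Y] scaleR_in_spc[OF Y]) auto
    obtain g where g: "linear_map_on (spc Y) g" "\<forall>y\<in>spc Y. \<bar>g y\<bar> \<le> nrm Y y" "g v = nrm Y v"
      using norming_functional[OF Y v] by blast
    have B: "bilinear_form_on (spc X) (spc Y) (\<lambda>x y. f x * g y)"
      using f(1) g(1) by (auto simp: bilinear_form_on_def linear_map_on_def algebra_simps)
    have "\<bar>u (\<lambda>x y. f x * g y)\<bar> \<le> projective_norm X Y u"
      by (rule abs_tensor_apply_le[OF X Y u B])
        (use f(2) g(2) nrm_nonneg[OF X] nrm_nonneg[OF Y] in \<open>auto simp: abs_mult intro!: mult_mono\<close>)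
    then have "(\<Sum>i<n. f (x i) * g (y i)) = 0"
      using 0 by (simp add: u_eq sum_fun_apply elem_tensor_apply[OF B])
    moreover have "g v = (\<Sum>i<n. f (x i) * g (y i))"
      unfolding v_def using linear_map_on_sum[OF g(1) subspace_spc[OF Y], of "{..<n}" "\<lambda>i. f (x i) *\<^sub>R y i"]
        linear_map_onD(2)[OF g(1)] xy scaleR_in_spc[OF Y] by simp
    ultimately show "(\<Sum>i<n. f (x i) *\<^sub>R y i) = 0"
      using g(3) nrm_eq_0_iff[OF Y v] unfolding v_def by simp
  qed
qed

lemma spc_tensor_nspace [simp]: "spc (tensor_nspace X Y) = algebraic_tensor X Y"
  and nrm_tensor_nspace [simp]: "nrm (tensor_nspace X Y) = projective_norm X Y"
  by (simp_all add: tensor_nspace_def)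

lemma normed_space_tensor_nspace:
  assumes X: "normed_space X" and Y: "normed_space Y"
  shows "normed_space (tensor_nspace X Y)"
proof -
  have "projective_norm X Y 0 = 0"
    using projective_norm_scaleR[OF X Y, of 0 0] by (simp add: algebraic_tensor_def span_zero)
  then show ?thesis
    using projective_norm_nonneg[OF X Y] projective_norm_eq_0[OF X Y]
      projective_norm_add[OF X Y] projective_norm_scaleR[OF X Y]
    by (auto simp: normed_space_def algebraic_tensor_def)
qed

lemma projective_norm_sum_elem_tensor_le:
  assumes X: "normed_space X" and Y: "normed_space Y"
    and "\<And>i::nat. i < n \<Longrightarrow> x i \<in> spc X \<and> y i \<in> spc Y"
  shows "projective_norm X Y (\<Sum>i<n. elem_tensor X Y (x i) (y i)) \<le> (\<Sum>i<n. nrm X (x i) * nrm Y (y i))"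
  by (rule projective_norm_le[OF X Y]) (use assms(3) in \<open>simp add: tensor_rep_def\<close>)

text \<open>\<open>f \<otimes> id\<close> on the algebraic tensor product, as the transpose of the pullback of bilinear forms.\<close>

definition tensor_map ::
    "'c::real_vector nspace \<Rightarrow> 'b::real_vector nspace \<Rightarrow> ('a \<Rightarrow> 'c) \<Rightarrow> ('a, 'b) tensor \<Rightarrow> ('c, 'b) tensor"
  where "tensor_map Z Y f t =
    (\<lambda>B. if bilinear_form_on (spc Z) (spc Y) B then t (\<lambda>x. B (f x)) else 0)"

lemma tensor_map_add: "tensor_map Z Y f (s + t) = tensor_map Z Y f s + tensor_map Z Y f t"
  and tensor_map_scaleR: "tensor_map Z Y f (c *\<^sub>R t) = c *\<^sub>R tensor_map Z Y f t"
  and tensor_map_diff: "tensor_map Z Y f (s - t) = tensor_map Z Y f s - tensor_map Z Y f t"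
  and tensor_map_sum: "tensor_map Z Y f (\<Sum>i\<in>A. r i) = (\<Sum>i\<in>A. tensor_map Z Y f (r i))"
  by (auto simp: tensor_map_def fun_eq_iff scaleR_fun_def sum_fun_apply)

lemma tensor_map_elem_tensor:
  assumes f: "linear_map_on (spc X) f" "f ` spc X \<subseteq> spc Z" and "x \<in> spc X" "y \<in> spc Y"
  shows "tensor_map Z Y f (elem_tensor X Y x y) = elem_tensor Z Y (f x) y"
proof
  fix B
  show "tensor_map Z Y f (elem_tensor X Y x y) B = elem_tensor Z Y (f x) y B"
  proof (cases "bilinear_form_on (spc Z) (spc Y) B")
    case True
    \<comment> \<open>The pullback is a bilinear form, so the default value 0 of
      \<open>elem_tensor X Y\<close> does not interfere.\<close>
    then have "bilinear_form_on (spc X) (spc Y) (\<lambda>x. B (f x))"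
      using f by (simp add: bilinear_form_on_def linear_map_on_def image_subset_iff)
    then show ?thesis using True by (simp add: tensor_map_def elem_tensor_def)
  qed (simp add: tensor_map_def elem_tensor_def)
qed

lemma tensor_rep_tensor_map:
  assumes f: "linear_map_on (spc X) f" "f ` spc X \<subseteq> spc Z" and r: "tensor_rep X Y n x y u"
  shows "tensor_rep Z Y n (\<lambda>i. f (x i)) y (tensor_map Z Y f u)"
  using r f by (auto simp: tensor_rep_def tensor_map_sum tensor_map_elem_tensor[OF f])

lemma tensor_map_in_algebraic_tensor:
  assumes X: "normed_space X" and f: "linear_map_on (spc X) f" "f ` spc X \<subseteq> spc Z"
    and u: "u \<in> algebraic_tensor X Y"
  shows "tensor_map Z Y f u \<in> algebraic_tensor Z Y"
  using algebraic_tensor_rep[OF X u] tensor_rep_tensor_map[OF f] tensor_rep_in_algebraic_tensor by blast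

lemma projective_norm_tensor_map_le:
  assumes X: "normed_space X" and Y: "normed_space Y" and Z: "normed_space Z"
    and f: "linear_map_on (spc X) f" "f ` spc X \<subseteq> spc Z"
    and le: "\<And>x. x \<in> spc X \<Longrightarrow> nrm Z (f x) \<le> nrm X x"
    and u: "u \<in> algebraic_tensor X Y"
  shows "projective_norm Z Y (tensor_map Z Y f u) \<le> projective_norm X Y u"
proof (rule projective_norm_ge[OF X u])
  fix n x y assume r: "tensor_rep X Y n x y u"
  have "projective_norm Z Y (tensor_map Z Y f u) \<le> (\<Sum>i<n. nrm Z (f (x i)) * nrm Y (y i))"
    by (rule projective_norm_le[OF Z Y tensor_rep_tensor_map[OF f r]])
  also have "\<dots> \<le> (\<Sum>i<n. nrm X (x i) * nrm Y (y i))"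
    using r le nrm_nonneg[OF Y] by (intro sum_mono mult_right_mono) (auto simp: tensor_rep_def)
  finally show "projective_norm Z Y (tensor_map Z Y f u) \<le> (\<Sum>i<n. nrm X (x i) * nrm Y (y i))" .
qed

lemma tensor_map_left_inverse:
  assumes X: "normed_space X"
    and f: "linear_map_on (spc X) f" "f ` spc X \<subseteq> spc Z"
    and g: "linear_map_on (spc Z) g" "g ` spc Z \<subseteq> spc X"
    and gf: "\<And>x. x \<in> spc X \<Longrightarrow> g (f x) = x"
    and u: "u \<in> algebraic_tensor X Y"
  shows "tensor_map X Y g (tensor_map Z Y f u) = u"
proof -
  obtain n x y where "tensor_rep X Y n x y u" using algebraic_tensor_rep[OF X u] by blast
  then show ?thesis
    using f(2) by (auto simp: image_subset_iff tensor_rep_def tensor_map_sum tensor_map_elem_tensor[OF f]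
        tensor_map_elem_tensor[OF g] gf intro!: sum.cong)
qed

text \<open>The projective norm does not respect subspaces in general, since the larger space offers
  more representations. The norm-one left inverse \<open>g\<close> brings these back at no greater
  cost.\<close>

lemma linear_isometry_tensor_map:
  assumes X: "normed_space X" and Y: "normed_space Y" and Z: "normed_space Z"
    and f: "linear_isometry X Z f"
    and g: "linear_map_on (spc Z) g" "g ` spc Z \<subseteq> spc X" "\<And>z. z \<in> spc Z \<Longrightarrow> nrm X (g z) \<le> nrm Z z"
    and gf: "\<And>x. x \<in> spc X \<Longrightarrow> g (f x) = x"
  shows "linear_isometry (tensor_nspace X Y) (tensor_nspace Z Y) (tensor_map Z Y f)"
proof -
  have f': "linear_map_on (spc X) f" "f ` spc X \<subseteq> spc Z" "\<And>x. x \<in> spc X \<Longrightarrow> nrm Z (f x) = nrm X x"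
    using f by (auto simp: linear_isometry_def)
  have "projective_norm Z Y (tensor_map Z Y f u) = projective_norm X Y u" if u: "u \<in> algebraic_tensor X Y" for u
  proof (rule antisym)
    show "projective_norm Z Y (tensor_map Z Y f u) \<le> projective_norm X Y u"
      by (rule projective_norm_tensor_map_le[OF X Y Z f'(1,2) _ u]) (simp add: f'(3))
    show "projective_norm X Y u \<le> projective_norm Z Y (tensor_map Z Y f u)"
      using projective_norm_tensor_map_le[OF Z Y X g tensor_map_in_algebraic_tensor[OF X f'(1,2) u]]
      by (simp add: tensor_map_left_inverse[OF X f'(1,2) g(1,2) gf u])
  qed
  then show ?thesis
    using tensor_map_in_algebraic_tensor[OF X f'(1,2)]
    by (auto simp: linear_isometry_def linear_map_on_def tensor_map_add tensor_map_scaleR)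
qed

section \<open>Norm attainment\<close>

text \<open>The partial sums have norm at most \<open>S\<close> and approach \<open>u\<close>. This
  turns a representation of cost at most the norm of \<open>u\<close> into an optimal one.\<close>

lemma projective_norm_le_suminf:
  assumes X: "normed_space X" and Y: "normed_space Y"
    and u: "u \<in> proj_tensor X Y" and xy: "\<And>i. x i \<in> spc X" "\<And>i. y i \<in> spc Y"
    and sums: "tensor_sums X Y x y u" and S: "(\<lambda>i. nrm X (x i) * nrm Y (y i)) sums S"
  shows "proj_tensor_norm X Y u \<le> S"
proof -
  let ?V = "tensor_nspace X Y"
  note V = normed_space_tensor_nspace[OF X Y]
  obtain s where s: "s \<in> cauchy_seqs ?V" "u = cauchy_class ?V s"
    using u by (auto simp: proj_tensor_def elim: completionE)
  define p where "p n = (\<Sum>i<n. elem_tensor X Y (x i) (y i))" for n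
  have p: "p n \<in> spc ?V" for n
    using xy by (auto simp: p_def intro: sum_elem_tensor_in_algebraic_tensor)
  have nn: "0 \<le> nrm X (x i) * nrm Y (y i)" for i using nrm_nonneg[OF X] nrm_nonneg[OF Y] xy by simp
  have pS: "nrm ?V (p n) \<le> S" for n
  proof -
    have "nrm ?V (p n) \<le> (\<Sum>i<n. nrm X (x i) * nrm Y (y i))"
      using projective_norm_sum_elem_tensor_le[OF X Y] xy by (simp add: p_def)
    also have "\<dots> \<le> S" using sum_le_suminf[OF sums_summable[OF S], of "{..<n}"] nn sums_unique[OF S] by simp
    finally show ?thesis .
  qed
  have "proj_tensor_norm X Y u \<le> S + completion_dist ?V u (to_completion ?V (p n))" for n
  proof (rule LIMSEQ_le)
    show "(\<lambda>k. nrm ?V (s k)) \<longlonglongrightarrow> proj_tensor_norm X Y u"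
      using completion_norm_tendsto[OF V s(1)] s(2) by (simp add: proj_tensor_norm_def)
    show "(\<lambda>k. S + nrm ?V (s k - p n)) \<longlonglongrightarrow> S + completion_dist ?V u (to_completion ?V (p n))"
      unfolding s(2) by (intro tendsto_add tendsto_const completion_dist_to_completion_tendsto[OF V s(1) p])
    have "nrm ?V (s k) \<le> S + nrm ?V (s k - p n)" for k
      using nrm_triangle_diff[OF V cauchy_seqs_in_spc[OF V s(1), of k] p[of n]] pS[of n] by linarith
    then show "\<exists>N. \<forall>k\<ge>N. nrm ?V (s k) \<le> S + nrm ?V (s k - p n)" by blast
  qed
  moreover have "(\<lambda>n. S + completion_dist ?V u (to_completion ?V (p n))) \<longlonglongrightarrow> S + 0"
    using sums unfolding tensor_sums_def p_def by (intro tendsto_add tendsto_const)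
  ultimately show ?thesis by (intro LIMSEQ_le_const[of _ "S"]) auto
qed

text \<open>A norm-one retraction pushes an optimal representation of \<open>(f \<otimes> id) u\<close> to one of \<open>u\<close>.\<close>

lemma NA_proj_retract:
  assumes X: "normed_space X" and Y: "normed_space Y" and Z: "normed_space Z"
    and f: "linear_isometry X Z f"
    and g: "linear_map_on (spc Z) g" "g ` spc Z \<subseteq> spc X" "\<And>z. z \<in> spc Z \<Longrightarrow> nrm X (g z) \<le> nrm Z z"
    and gf: "\<And>x. x \<in> spc X \<Longrightarrow> g (f x) = x"
    and u: "u \<in> proj_tensor X Y"
    and NA: "completion_map (tensor_nspace Z Y) (tensor_map Z Y f) u \<in> NA_proj Z Y"
  shows "u \<in> NA_proj X Y"
proof -
  let ?V = "tensor_nspace X Y" and ?W = "tensor_nspace Z Y" and ?T = "tensor_map Z Y f"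
  note V = normed_space_tensor_nspace[OF X Y] and W = normed_space_tensor_nspace[OF Z Y]
  have T: "linear_isometry ?V ?W ?T" by (rule linear_isometry_tensor_map[OF X Y Z f g gf])
  have f': "linear_map_on (spc X) f" "f ` spc X \<subseteq> spc Z" using f by (auto simp: linear_isometry_def)
  have u': "u \<in> completion ?V" using u by (simp add: proj_tensor_def)
  obtain s where s: "s \<in> cauchy_seqs ?V" "u = cauchy_class ?V s"
    using u' by (auto elim: completionE)
  have cl: "completion_map ?W ?T u = cauchy_class ?W (\<lambda>k. ?T (s k))"
    using completion_map_class[OF V W T s(1)] s(2) by simp
  have norm_eq: "proj_tensor_norm Z Y (completion_map ?W ?T u) = proj_tensor_norm X Y u"
    using completion_isometry_completion_map[OF V W T] u'
    by (simp add: completion_isometry_def proj_tensor_norm_def)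
  obtain z y where zy: "\<And>i. z i \<in> spc Z" "\<And>i. y i \<in> spc Y"
    and sums: "tensor_sums Z Y z y (completion_map ?W ?T u)"
    and S: "(\<lambda>i. nrm Z (z i) * nrm Y (y i)) sums proj_tensor_norm X Y u"
    using NA norm_eq by (auto simp: NA_proj_def)
  have gz: "g (z i) \<in> spc X" for i using g(2) zy by auto
  define p where "p n = (\<Sum>i<n. elem_tensor Z Y (z i) (y i))" for n
  define q where "q n = (\<Sum>i<n. elem_tensor X Y (g (z i)) (y i))" for n
  have p: "p n \<in> algebraic_tensor Z Y" for n
    unfolding p_def using zy by (intro sum_elem_tensor_in_algebraic_tensor) auto
  have q: "q n \<in> algebraic_tensor X Y" for n
    unfolding q_def using zy gz by (intro sum_elem_tensor_in_algebraic_tensor) auto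
  have pq: "tensor_map X Y g (p n) = q n" for n
    using zy by (simp add: p_def q_def tensor_map_sum tensor_map_elem_tensor[OF g(1,2)])
  have mem: "s k \<in> algebraic_tensor X Y" for k using cauchy_seqs_in_spc[OF V s(1)] by simp
  \<comment> \<open>The map induced by \<open>g\<close> is only contractive, while
    \<open>completion_map\<close> is set up for isometries. So the estimate is made on the algebraic
    representatives \<open>s k\<close> and passed to the limit.\<close>
  have le: "completion_dist ?V u (to_completion ?V (q n)) \<le>
      completion_dist ?W (completion_map ?W ?T u) (to_completion ?W (p n))" for n
  proof (rule LIMSEQ_le)
    show "(\<lambda>k. nrm ?V (s k - q n)) \<longlonglongrightarrow> completion_dist ?V u (to_completion ?V (q n))"
      unfolding s(2) using q by (intro completion_dist_to_completion_tendsto[OF V s(1)]) simp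
    show "(\<lambda>k. nrm ?W (?T (s k) - p n)) \<longlonglongrightarrow>
        completion_dist ?W (completion_map ?W ?T u) (to_completion ?W (p n))"
      unfolding cl
      by (rule completion_dist_to_completion_tendsto[OF W linear_isometry_cauchy_seqs[OF V W T s(1)]])
        (simp add: p)
    have "nrm ?V (s k - q n) \<le> nrm ?W (?T (s k) - p n)" for k
    proof -
      have "tensor_map X Y g (?T (s k) - p n) = s k - q n"
        by (simp add: tensor_map_diff pq tensor_map_left_inverse[OF X f' g(1,2) gf mem])
      moreover have "?T (s k) - p n \<in> algebraic_tensor Z Y"
        using diff_in_spc[OF W] p tensor_map_in_algebraic_tensor[OF X f' mem] by simp
      ultimately show ?thesis
        using projective_norm_tensor_map_le[OF Z Y X g, of "?T (s k) - p n"] by simp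
    qed
    then show "\<exists>N. \<forall>k\<ge>N. nrm ?V (s k - q n) \<le> nrm ?W (?T (s k) - p n)" by blast
  qed
  have "0 \<le> completion_dist ?V u (to_completion ?V (q n))" for n
    unfolding s(2)
    by (rule LIMSEQ_le_const[OF completion_dist_to_completion_tendsto[OF V s(1)]])
      (use q mem projective_norm_nonneg[OF X Y diff_in_spc[OF V, simplified]] in auto)
  note nonneg = this
  have sums': "tensor_sums X Y (\<lambda>i. g (z i)) y u"
    unfolding tensor_sums_def q_def[symmetric]
  proof (rule tendsto_sandwich[OF _ _ tendsto_const])
    show "(\<lambda>n. completion_dist ?W (completion_map ?W ?T u) (to_completion ?W (p n))) \<longlonglongrightarrow> 0"
      using sums unfolding tensor_sums_def p_def .
  qed (use le nonneg in simp_all)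
  have le': "0 \<le> nrm X (g (z i)) * nrm Y (y i)"
      "nrm X (g (z i)) * nrm Y (y i) \<le> nrm Z (z i) * nrm Y (y i)" for i
    using g(3)[OF zy(1)] nrm_nonneg[OF X gz] nrm_nonneg[OF Y zy(2)] by (auto intro: mult_right_mono)
  then have summable: "summable (\<lambda>i. nrm X (g (z i)) * nrm Y (y i))"
    by (intro summable_comparison_test'[OF sums_summable[OF S], of 0]) simp
  \<comment> \<open>The pushed representation costs at least the norm of \<open>u\<close>, and at
    most what the original one costs, which is the same number.\<close>
  have "proj_tensor_norm X Y u \<le> (\<Sum>i. nrm X (g (z i)) * nrm Y (y i))"
    by (rule projective_norm_le_suminf[OF X Y u gz zy(2) sums' summable_sums[OF summable]])
  moreover have "(\<Sum>i. nrm X (g (z i)) * nrm Y (y i)) \<le> proj_tensor_norm X Y u"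
    using suminf_le[OF le'(2) summable sums_summable[OF S]] sums_unique[OF S] by simp
  ultimately have "(\<lambda>i. nrm X (g (z i)) * nrm Y (y i)) sums proj_tensor_norm X Y u"
    using summable_sums[OF summable] by simp
  then show ?thesis
    unfolding NA_proj_def using u gz zy(2) sums'
    by (intro CollectI conjI exI[of _ "\<lambda>i. g (z i)"] exI[of _ y]) auto
qed

text \<open>Excludes the zero space later on: its projection has norm 0, whereas
  \<open>norm_one_projection\<close> demands norm 1.\<close>

lemma proj_tensor_zero_space:
  assumes X: "normed_space X" and Y: "normed_space Y" and 0: "spc X = {0}" and u: "u \<in> proj_tensor X Y"
  shows "u \<in> NA_proj X Y"
proof -
  let ?V = "tensor_nspace X Y"
  note V = normed_space_tensor_nspace[OF X Y]
  have e0: "elem_tensor X Y 0 y = 0" if "y \<in> spc Y" for y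
    using elem_tensor_scaleR_left[of 0 X y Y 0] 0 that by simp
  then have alg: "t = 0" if "t \<in> algebraic_tensor X Y" for t
    using algebraic_tensor_rep[OF X that] 0 by (auto simp: tensor_rep_def)
  obtain s where s: "s \<in> cauchy_seqs ?V" "u = cauchy_class ?V s"
    using u by (auto simp: proj_tensor_def elim: completionE)
  have "s = (\<lambda>_. 0)" using alg cauchy_seqs_in_spc[OF V s(1)] by auto
  then have u0: "u = to_completion ?V 0" using s(2) by (simp add: to_completion_def)
  have "tensor_sums X Y (\<lambda>_. 0) (\<lambda>_. 0) u"
    using e0[OF zero_in_spc[OF Y]] completion_dist_to_completion[OF V zero_in_spc[OF V] zero_in_spc[OF V]]
      nrm_zero[OF V]
    by (simp add: tensor_sums_def u0)
  moreover have "proj_tensor_norm X Y u = 0"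
    using completion_norm_to_completion[OF V zero_in_spc[OF V]] nrm_zero[OF V]
    by (simp add: u0 proj_tensor_norm_def)
  ultimately show ?thesis
    using u zero_in_spc[OF X] zero_in_spc[OF Y] nrm_zero[OF X] unfolding NA_proj_def
    by (auto intro!: exI[of _ "\<lambda>_. 0"])
qed

section \<open>A space with property alpha around a given space\<close>

definition unit_sphere :: "'a::real_vector nspace \<Rightarrow> 'a set"
  where "unit_sphere X = {x \<in> spc X. nrm X x = 1}"

definition l1_fun :: "('i \<Rightarrow> real) \<Rightarrow> bool"
  where "l1_fun a \<longleftrightarrow> (\<lambda>i. \<bar>a i\<bar>) summable_on UNIV"

definition l1_norm :: "('i \<Rightarrow> real) \<Rightarrow> real"
  where "l1_norm a = (\<Sum>\<^sub>\<infinity>i. \<bar>a i\<bar>)"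

text \<open>\<open>d y\<close> is the sum of the coefficients of \<open>(y, e y)\<close> and
  \<open>(y, - e y)\<close> in a combination of generators; the second component fixes their
  difference. Finite \<open>F\<close> keeps infinite series in \<open>X\<close> out of the
  definition of the norm.\<close>

definition sphere_expansion :: "'a::real_vector nspace \<Rightarrow> 'a \<Rightarrow> ('a \<Rightarrow> real) \<Rightarrow> 'a set \<Rightarrow> bool"
  where "sphere_expansion X x d F \<longleftrightarrow>
    finite F \<and> F \<subseteq> unit_sphere X \<and> (\<forall>y. y \<notin> F \<longrightarrow> d y = 0) \<and> x = (\<Sum>y\<in>F. d y *\<^sub>R y)"

text \<open>
  With \<open>e y\<close> the unit vectors, the unit ball of this space is the closed absolutely convex hull
  of the points \<open>(y, \<plusminus> e y)\<close>, \<open>y\<close> in the unit sphere of \<open>X\<close>: the combination of \<open>(y, e y)\<close> and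
  \<open>(y, - e y)\<close> equal to \<open>(d y, a y)\<close> has coefficients of total modulus \<open>max \<bar>d\<bar> \<bar>a\<bar>\<close>.
\<close>

definition alpha_space :: "'a::real_vector nspace \<Rightarrow> ('a \<times> ('a \<Rightarrow> real)) nspace"
  where "alpha_space X =
    \<lparr>spc = {(x, a). x \<in> spc X \<and> l1_fun a \<and> (\<forall>y. y \<notin> unit_sphere X \<longrightarrow> a y = 0)},
     nrm = (\<lambda>(x, a). Inf {l1_norm (\<lambda>y. max \<bar>a y\<bar> \<bar>d y\<bar>) |d F. sphere_expansion X x d F})\<rparr>"

section \<open>Absolutely summable functions\<close>

lemma l1_fun_mono:
  assumes "l1_fun b" "\<And>i. \<bar>a i\<bar> \<le> \<bar>b i\<bar>"
  shows "l1_fun a" "l1_norm a \<le> l1_norm b"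
proof -
  show a: "l1_fun a" unfolding l1_fun_def
    by (rule summable_on_comparison_test[OF assms(1)[unfolded l1_fun_def]]) (use assms(2) in auto)
  show "l1_norm a \<le> l1_norm b" unfolding l1_norm_def
    by (rule infsum_mono) (use a assms in \<open>auto simp: l1_fun_def\<close>)
qed

lemma l1_fun_finite:
  assumes "finite F" "\<And>i. i \<notin> F \<Longrightarrow> a i = 0"
  shows "l1_fun a" "l1_norm a = (\<Sum>i\<in>F. \<bar>a i\<bar>)"
proof -
  have "(\<lambda>i. \<bar>a i\<bar>) summable_on F" using assms(1) by simp
  then show "l1_fun a" unfolding l1_fun_def
    by (subst summable_on_cong_neutral[where T = F and g = "\<lambda>i. \<bar>a i\<bar>"]) (use assms(2) in auto)
  have "l1_norm a = (\<Sum>\<^sub>\<infinity>i\<in>F. \<bar>a i\<bar>)" unfolding l1_norm_def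
    by (rule infsum_cong_neutral) (use assms(2) in auto)
  then show "l1_norm a = (\<Sum>i\<in>F. \<bar>a i\<bar>)" using assms(1) by simp
qed

lemma l1_fun_abs_add:
  assumes "l1_fun a" "l1_fun b"
  shows "l1_fun (\<lambda>i. \<bar>a i\<bar> + \<bar>b i\<bar>)" "l1_norm (\<lambda>i. \<bar>a i\<bar> + \<bar>b i\<bar>) = l1_norm a + l1_norm b"
proof -
  have "(\<lambda>i. \<bar>\<bar>a i\<bar> + \<bar>b i\<bar>\<bar>) = (\<lambda>i. \<bar>a i\<bar> + \<bar>b i\<bar>)" by auto
  then show "l1_fun (\<lambda>i. \<bar>a i\<bar> + \<bar>b i\<bar>)" "l1_norm (\<lambda>i. \<bar>a i\<bar> + \<bar>b i\<bar>) = l1_norm a + l1_norm b"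
    using assms infsum_add[of "\<lambda>i. \<bar>a i\<bar>" UNIV "\<lambda>i. \<bar>b i\<bar>"]
      summable_on_add[of "\<lambda>i. \<bar>a i\<bar>" UNIV "\<lambda>i. \<bar>b i\<bar>"]
    by (simp_all add: l1_fun_def l1_norm_def)
qed

lemma l1_fun_add:
  assumes "l1_fun a" "l1_fun b"
  shows "l1_fun (\<lambda>i. a i + b i)" "l1_norm (\<lambda>i. a i + b i) \<le> l1_norm a + l1_norm b"
  using l1_fun_mono[OF l1_fun_abs_add(1)[OF assms], of "\<lambda>i. a i + b i"] l1_fun_abs_add(2)[OF assms]
  by auto

lemma l1_fun_scale:
  assumes "l1_fun a"
  shows "l1_fun (\<lambda>i. c * a i)" "l1_norm (\<lambda>i. c * a i) = \<bar>c\<bar> * l1_norm a"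
  using assms infsum_cmult_right'[of "\<bar>c\<bar>" "\<lambda>i. \<bar>a i\<bar>" UNIV]
    summable_on_cmult_right[of "\<lambda>i. \<bar>a i\<bar>" UNIV "\<bar>c\<bar>"]
  by (simp_all add: l1_fun_def l1_norm_def abs_mult)

lemma l1_fun_minus: "l1_fun a \<Longrightarrow> l1_fun (\<lambda>i. - a i)"
  using l1_fun_scale(1)[of a "-1"] by simp

lemma l1_fun_max:
  assumes "l1_fun a" "l1_fun b"
  shows "l1_fun (\<lambda>i. max \<bar>a i\<bar> \<bar>b i\<bar>)" "l1_norm (\<lambda>i. max \<bar>a i\<bar> \<bar>b i\<bar>) \<le> l1_norm a + l1_norm b"
  using l1_fun_mono[OF l1_fun_abs_add(1)[OF assms], of "\<lambda>i. max \<bar>a i\<bar> \<bar>b i\<bar>"] l1_fun_abs_add(2)[OF assms]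
  by auto

lemma sum_abs_le_l1_norm: "l1_fun a \<Longrightarrow> finite F \<Longrightarrow> (\<Sum>i\<in>F. \<bar>a i\<bar>) \<le> l1_norm a"
  unfolding l1_fun_def l1_norm_def by (rule finite_sum_le_infsum) auto

lemma abs_le_l1_norm: "l1_fun a \<Longrightarrow> \<bar>a i\<bar> \<le> l1_norm a"
  using sum_abs_le_l1_norm[of a "{i}"] by simp

lemma l1_norm_nonneg: "0 \<le> l1_norm a"
  unfolding l1_norm_def by (rule infsum_nonneg) simp

lemma l1_fun_bounded_sums:
  assumes "\<And>F. finite F \<Longrightarrow> (\<Sum>i\<in>F. \<bar>a i\<bar>) \<le> K"
  shows "l1_fun a" "l1_norm a \<le> K"
proof -
  show a: "l1_fun a" unfolding l1_fun_def
    by (rule nonneg_bdd_above_summable_on) (use assms in \<open>auto intro!: bdd_aboveI2[of _ _ K]\<close>)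
  show "l1_norm a \<le> K" unfolding l1_norm_def
    by (rule infsum_le_finite_sums) (use a assms in \<open>auto simp: l1_fun_def\<close>)
qed

text \<open>The bound is uniform over all finite \<open>G\<close> above \<open>F\<close>, because
  the set will be enlarged by the support of an expansion.\<close>

lemma l1_fun_tail:
  assumes a: "l1_fun a" and \<epsilon>: "\<epsilon> > 0"
  shows "\<exists>F. finite F \<and> (\<forall>G. finite G \<and> F \<subseteq> G \<longrightarrow> l1_norm (\<lambda>i. if i \<in> G then 0 else a i) \<le> \<epsilon>)"
proof -
  obtain F where F: "finite F" "dist (\<Sum>i\<in>F. \<bar>a i\<bar>) (l1_norm a) \<le> \<epsilon>"
    using infsum_finite_approximation[OF a[unfolded l1_fun_def] \<epsilon>] by (auto simp: l1_norm_def)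
  have "l1_norm (\<lambda>i. if i \<in> G then 0 else a i) \<le> \<epsilon>" if G: "finite G" "F \<subseteq> G" for G
  proof (rule l1_fun_bounded_sums(2))
    fix H :: "'a set" assume H: "finite H"
    have "(\<Sum>i\<in>H. \<bar>if i \<in> G then 0 else a i\<bar>) = (\<Sum>i\<in>H - G. \<bar>a i\<bar>)"
      by (rule sum.mono_neutral_cong_right[OF H]) auto
    moreover have "(\<Sum>i\<in>F. \<bar>a i\<bar>) + (\<Sum>i\<in>H - G. \<bar>a i\<bar>) \<le> l1_norm a"
    proof -
      have "F \<inter> (H - G) = {}" using G by blast
      then show ?thesis
        using sum_abs_le_l1_norm[OF a, of "F \<union> (H - G)"]
          sum.union_disjoint[of F "H - G" "\<lambda>i. \<bar>a i\<bar>"] F(1) H by simp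
    qed
    ultimately show "(\<Sum>i\<in>H. \<bar>if i \<in> G then 0 else a i\<bar>) \<le> \<epsilon>"
      using F(2) by (auto simp: dist_real_def)
  qed
  with F(1) show ?thesis by blast
qed

section \<open>Finite expansions over the unit sphere\<close>

lemma sphere_expansion_mono:
  assumes "sphere_expansion X x d F" "finite G" "F \<subseteq> G" "G \<subseteq> unit_sphere X"
  shows "sphere_expansion X x d G"
proof -
  have "(\<Sum>y\<in>F. d y *\<^sub>R y) = (\<Sum>y\<in>G. d y *\<^sub>R y)"
    by (rule sum.mono_neutral_left) (use assms in \<open>auto simp: sphere_expansion_def\<close>)
  then show ?thesis using assms by (auto simp: sphere_expansion_def)
qed

lemma sphere_expansion_add:
  assumes "sphere_expansion X x d F" "sphere_expansion X x' d' F'"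
  shows "sphere_expansion X (x + x') (\<lambda>y. d y + d' y) (F \<union> F')"
proof -
  have "sphere_expansion X x d (F \<union> F')" "sphere_expansion X x' d' (F \<union> F')"
    by (rule sphere_expansion_mono[OF assms(1)] sphere_expansion_mono[OF assms(2)];
        use assms in \<open>auto simp: sphere_expansion_def\<close>)+
  then show ?thesis by (auto simp: sphere_expansion_def scaleR_add_left sum.distrib)
qed

lemma sphere_expansion_scaleR:
  "sphere_expansion X x d F \<Longrightarrow> sphere_expansion X (c *\<^sub>R x) (\<lambda>y. c * d y) F"
  by (simp add: sphere_expansion_def scaleR_sum_right)

lemma sphere_expansion_l1:
  assumes "sphere_expansion X x d F"
  shows "l1_fun d" "l1_norm d = (\<Sum>y\<in>F. \<bar>d y\<bar>)"
  using assms l1_fun_finite[of F d] by (auto simp: sphere_expansion_def)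

lemma sphere_expansion_single:
  "y \<in> unit_sphere X \<Longrightarrow> sphere_expansion X (c *\<^sub>R y) (\<lambda>w. if w = y then c else 0) {y}"
  by (simp add: sphere_expansion_def)

text \<open>One term along the normalised vector. No expansion is cheaper, by
  \<open>nrm_le_l1_norm_expansion\<close>.\<close>

lemma sphere_expansion_exists:
  assumes X: "normed_space X" and x: "x \<in> spc X"
  shows "\<exists>d F. sphere_expansion X x d F \<and> l1_norm d = nrm X x"
proof (cases "x = 0")
  case True
  have "sphere_expansion X x (\<lambda>_. 0) {}" using True by (simp add: sphere_expansion_def)
  then show ?thesis using sphere_expansion_l1(2) True nrm_zero[OF X] by fastforce
next
  case False
  define y where "y = (1 / nrm X x) *\<^sub>R x"
  have nx: "nrm X x > 0" using False nrm_nonneg[OF X x] nrm_eq_0_iff[OF X x] by linarith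
  have "y \<in> unit_sphere X"
    using nx x by (simp add: y_def unit_sphere_def scaleR_in_spc[OF X] nrm_scaleR[OF X])
  from sphere_expansion_single[OF this, of "nrm X x"]
  have e: "sphere_expansion X x (\<lambda>w. if w = y then nrm X x else 0) {y}"
    using nx by (simp add: y_def)
  show ?thesis using e sphere_expansion_l1(2)[OF e] nx by (intro exI conjI) auto
qed

lemma nrm_le_l1_norm_expansion:
  assumes X: "normed_space X" and e: "sphere_expansion X x d F"
  shows "nrm X x \<le> l1_norm d"
proof -
  have F: "finite F" "\<And>y. y \<in> F \<Longrightarrow> y \<in> spc X \<and> nrm X y = 1" "x = (\<Sum>y\<in>F. d y *\<^sub>R y)"
    using e by (auto simp: sphere_expansion_def unit_sphere_def)
  then have "nrm X x \<le> (\<Sum>y\<in>F. nrm X (d y *\<^sub>R y))"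
    using nrm_sum_le[OF X F(1), of "\<lambda>y. d y *\<^sub>R y"] scaleR_in_spc[OF X] by simp
  also have "\<dots> = (\<Sum>y\<in>F. \<bar>d y\<bar>)" using F nrm_scaleR[OF X] by (intro sum.cong) auto
  finally show ?thesis using sphere_expansion_l1(2)[OF e] by simp
qed

section \<open>The norm around X: axioms and completeness\<close>

lemma in_alpha_space_iff:
  "(x, a) \<in> spc (alpha_space X) \<longleftrightarrow> x \<in> spc X \<and> l1_fun a \<and> (\<forall>y. y \<notin> unit_sphere X \<longrightarrow> a y = 0)"
  by (simp add: alpha_space_def)

lemma nrm_alpha_space_le:
  "sphere_expansion X x d F \<Longrightarrow> nrm (alpha_space X) (x, a) \<le> l1_norm (\<lambda>y. max \<bar>a y\<bar> \<bar>d y\<bar>)"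
  unfolding alpha_space_def by (auto intro!: cInf_lower bdd_belowI[of _ 0] l1_norm_nonneg)

lemma nrm_alpha_space_ge:
  assumes "normed_space X" "x \<in> spc X"
    and "\<And>d F. sphere_expansion X x d F \<Longrightarrow> r \<le> l1_norm (\<lambda>y. max \<bar>a y\<bar> \<bar>d y\<bar>)"
  shows "r \<le> nrm (alpha_space X) (x, a)"
  unfolding alpha_space_def
  using sphere_expansion_exists[OF assms(1,2)] assms(3) by (auto intro!: cInf_greatest)

text \<open>The maximum dominates each entry and is at most their sum. So the norm is equivalent to
  that of the l1-sum of \<open>X\<close> and l1, which yields definiteness and completeness; the
  first bound also makes \<open>fst\<close> contractive.\<close>

lemma nrm_alpha_space_bounds:
  assumes X: "normed_space X" and x: "(x, a) \<in> spc (alpha_space X)"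
  shows "nrm X x \<le> nrm (alpha_space X) (x, a)"
    and "l1_norm a \<le> nrm (alpha_space X) (x, a)"
    and "nrm (alpha_space X) (x, a) \<le> nrm X x + l1_norm a"
proof -
  have xa: "x \<in> spc X" "l1_fun a" using x by (auto simp: in_alpha_space_iff)
  show "nrm X x \<le> nrm (alpha_space X) (x, a)"
  proof (rule nrm_alpha_space_ge[OF X xa(1)])
    fix d F assume e: "sphere_expansion X x d F"
    show "nrm X x \<le> l1_norm (\<lambda>y. max \<bar>a y\<bar> \<bar>d y\<bar>)"
      using nrm_le_l1_norm_expansion[OF X e]
        l1_fun_mono(2)[OF l1_fun_max(1)[OF xa(2) sphere_expansion_l1(1)[OF e]], of d] by fastforce
  qed
  show "l1_norm a \<le> nrm (alpha_space X) (x, a)"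
  proof (rule nrm_alpha_space_ge[OF X xa(1)])
    fix d F assume e: "sphere_expansion X x d F"
    show "l1_norm a \<le> l1_norm (\<lambda>y. max \<bar>a y\<bar> \<bar>d y\<bar>)"
      using l1_fun_mono(2)[OF l1_fun_max(1)[OF xa(2) sphere_expansion_l1(1)[OF e]], of a] by fastforce
  qed
  obtain d F where e: "sphere_expansion X x d F" "l1_norm d = nrm X x"
    using sphere_expansion_exists[OF X xa(1)] by blast
  show "nrm (alpha_space X) (x, a) \<le> nrm X x + l1_norm a"
    using nrm_alpha_space_le[OF e(1), of a] l1_fun_max(2)[OF xa(2) sphere_expansion_l1(1)[OF e(1)]] e(2)
    by linarith
qed

lemma l1_fun_0: "l1_fun (\<lambda>_. 0)" "l1_fun 0" "l1_norm (\<lambda>_. 0) = 0" "l1_norm 0 = 0"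
  using l1_fun_finite[of "{}" "\<lambda>_. 0"] l1_fun_finite[of "{}" 0] by auto

lemma normed_space_alpha_space:
  assumes X: "normed_space X"
  shows "normed_space (alpha_space X)"
  unfolding normed_space_def
proof (intro conjI ballI allI)
  let ?Z = "alpha_space X"
  show "subspace (spc ?Z)"
    by (rule subspaceI)
      (auto simp: in_alpha_space_iff zero_prod_def l1_fun_0 l1_fun_add l1_fun_scale scaleR_fun_def
        plus_fun_def zero_in_spc[OF X] add_in_spc[OF X] scaleR_in_spc[OF X])
  fix z assume "z \<in> spc ?Z"
  moreover obtain x a where z_eq: "z = (x, a)" by fastforce
  ultimately have z: "(x, a) \<in> spc ?Z" by simp
  then have x: "x \<in> spc X" and a: "l1_fun a" by (auto simp: in_alpha_space_iff)
  note b = nrm_alpha_space_bounds[OF X z]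
  show "0 \<le> nrm ?Z z" using b(2) l1_norm_nonneg[of a] z_eq by simp
  show "nrm ?Z z = 0 \<longleftrightarrow> z = 0"
  proof
    assume "nrm ?Z z = 0"
    then have "nrm X x = 0" "\<And>y. a y = 0"
      using b nrm_nonneg[OF X x] abs_le_l1_norm[OF a] z_eq by fastforce+
    then show "z = 0" using nrm_eq_0_iff[OF X x] z_eq by (auto simp: zero_prod_def)
  next
    assume "z = 0"
    then have "x = 0" "a = 0" using z_eq by (auto simp: zero_prod_def)
    then show "nrm ?Z z = 0" using b nrm_zero[OF X] l1_fun_0 z_eq by simp
  qed
  \<comment> \<open>Used for \<open>c\<close> and then for \<open>1 / c\<close>, which gives the two
    inequalities.\<close>
  have scale_le: "nrm ?Z (c *\<^sub>R w) \<le> \<bar>c\<bar> * nrm ?Z w" if w: "w \<in> spc ?Z" and c: "c \<noteq> 0" for c w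
  proof -
    obtain u v where uv: "w = (u, v)" by fastforce
    then have u: "u \<in> spc X" and v: "l1_fun v" using w by (auto simp: in_alpha_space_iff)
    have "nrm ?Z (c *\<^sub>R w) / \<bar>c\<bar> \<le> nrm ?Z (u, v)"
    proof (rule nrm_alpha_space_ge[OF X u])
      fix d F assume e: "sphere_expansion X u d F"
      have "nrm ?Z (c *\<^sub>R w) \<le> l1_norm (\<lambda>y. max \<bar>c * v y\<bar> \<bar>c * d y\<bar>)"
        using nrm_alpha_space_le[OF sphere_expansion_scaleR[OF e]] uv by (simp add: scaleR_fun_def)
      also have "(\<lambda>y. max \<bar>c * v y\<bar> \<bar>c * d y\<bar>) = (\<lambda>y. \<bar>c\<bar> * max \<bar>v y\<bar> \<bar>d y\<bar>)"
        by (simp add: abs_mult max_mult_distrib_left)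
      also have "l1_norm \<dots> = \<bar>c\<bar> * l1_norm (\<lambda>y. max \<bar>v y\<bar> \<bar>d y\<bar>)"
        using l1_fun_scale(2)[OF l1_fun_max(1)[OF v sphere_expansion_l1(1)[OF e]], of "\<bar>c\<bar>"] by simp
      finally show "nrm ?Z (c *\<^sub>R w) / \<bar>c\<bar> \<le> l1_norm (\<lambda>y. max \<bar>v y\<bar> \<bar>d y\<bar>)"
        using c by (simp add: pos_divide_le_eq mult.commute)
    qed
    then show ?thesis using c uv by (simp add: pos_divide_le_eq mult.commute)
  qed
  show "nrm ?Z (c *\<^sub>R z) = \<bar>c\<bar> * nrm ?Z z" for c
  proof (cases "c = 0")
    case True
    then show ?thesis using nrm_alpha_space_bounds[OF X, of 0 0] zero_in_spc[OF X] nrm_zero[OF X]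
      by (simp add: in_alpha_space_iff zero_prod_def l1_fun_0)
  next
    case False
    have "c *\<^sub>R z \<in> spc ?Z"
      using z z_eq by (auto simp: in_alpha_space_iff scaleR_in_spc[OF X] scaleR_fun_def l1_fun_scale)
    then have "nrm ?Z z \<le> \<bar>1 / c\<bar> * nrm ?Z (c *\<^sub>R z)"
      using scale_le[of "c *\<^sub>R z" "1 / c"] False by simp
    then show ?thesis using scale_le[of z c] False z z_eq by (simp add: field_simps)
  qed
  fix w assume "w \<in> spc ?Z"
  moreover obtain u v where w_eq: "w = (u, v)" by fastforce
  ultimately have w: "(u, v) \<in> spc ?Z" by simp
  then have u: "u \<in> spc X" and v: "l1_fun v" by (auto simp: in_alpha_space_iff)
  have *: "nrm ?Z (z + w) \<le> l1_norm (\<lambda>y. max \<bar>a y\<bar> \<bar>d y\<bar>) + l1_norm (\<lambda>y. max \<bar>v y\<bar> \<bar>d' y\<bar>)"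
    if e: "sphere_expansion X x d F" and e': "sphere_expansion X u d' F'" for d d' F F'
  proof -
    note S = l1_fun_max(1)[OF a sphere_expansion_l1(1)[OF e]] l1_fun_max(1)[OF v sphere_expansion_l1(1)[OF e']]
    have "nrm ?Z (z + w) \<le> l1_norm (\<lambda>y. max \<bar>a y + v y\<bar> \<bar>d y + d' y\<bar>)"
      using nrm_alpha_space_le[OF sphere_expansion_add[OF e e'], of "a + v"] z_eq w_eq by simp
    also have "\<dots> \<le> l1_norm (\<lambda>y. max \<bar>a y\<bar> \<bar>d y\<bar> + max \<bar>v y\<bar> \<bar>d' y\<bar>)"
      by (rule l1_fun_mono(2)[OF l1_fun_add(1)[OF S]]) auto
    also have "\<dots> \<le> l1_norm (\<lambda>y. max \<bar>a y\<bar> \<bar>d y\<bar>) + l1_norm (\<lambda>y. max \<bar>v y\<bar> \<bar>d' y\<bar>)"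
      by (rule l1_fun_add(2)[OF S])
    finally show ?thesis .
  qed
  \<comment> \<open>The two infima are taken one after the other, with the first expansion held
    fixed.\<close>
  have "nrm ?Z (z + w) - l1_norm (\<lambda>y. max \<bar>a y\<bar> \<bar>d y\<bar>) \<le> nrm ?Z w"
    if "sphere_expansion X x d F" for d F
    unfolding w_eq by (rule nrm_alpha_space_ge[OF X u]) (use *[OF that] w_eq in \<open>fastforce simp: algebra_simps\<close>)
  then have "nrm ?Z (z + w) - nrm ?Z w \<le> nrm ?Z z"
    unfolding z_eq by (intro nrm_alpha_space_ge[OF X x]) (fastforce simp: algebra_simps z_eq)
  then show "nrm ?Z (z + w) \<le> nrm ?Z z + nrm ?Z w" by simp
qed

text \<open>The Cauchy estimate holds for finite sums, where the pointwise limit can be taken, with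
  a bound independent of the finite set. Pointwise convergence is part of the conclusion so that the
  limit inherits vanishing off the sphere.\<close>

lemma l1_complete:
  fixes a :: "nat \<Rightarrow> 'i \<Rightarrow> real"
  assumes a: "\<And>n. l1_fun (a n)"
    and Cauchy: "\<And>\<epsilon>. \<epsilon> > 0 \<Longrightarrow> \<exists>N. \<forall>m\<ge>N. \<forall>n\<ge>N. l1_norm (\<lambda>i. a m i - a n i) < \<epsilon>"
  shows "\<exists>b. l1_fun b \<and> (\<forall>i. (\<lambda>n. a n i) \<longlonglongrightarrow> b i) \<and> (\<lambda>n. l1_norm (\<lambda>i. a n i - b i)) \<longlonglongrightarrow> 0"
proof -
  have diff: "l1_fun (\<lambda>i. a m i - a n i)" for m n
    using l1_fun_add(1)[OF a l1_fun_minus[OF a]] by simp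
  have "Cauchy (\<lambda>n. a n i)" for i
  proof (rule metric_CauchyI)
    fix \<epsilon> :: real assume "\<epsilon> > 0"
    from Cauchy[OF this] show "\<exists>M. \<forall>m\<ge>M. \<forall>n\<ge>M. dist (a m i) (a n i) < \<epsilon>"
      using abs_le_l1_norm[where i = i, OF diff] unfolding dist_real_def by (meson le_less_trans)
  qed
  then have "\<exists>b. (\<lambda>n. a n i) \<longlonglongrightarrow> b" for i
    using Cauchy_convergent convergent_def by blast
  then obtain b where b: "\<And>i. (\<lambda>n. a n i) \<longlonglongrightarrow> b i" by metis
  have tail: "\<exists>N. \<forall>n\<ge>N. l1_fun (\<lambda>i. a n i - b i) \<and> l1_norm (\<lambda>i. a n i - b i) \<le> \<epsilon>" if \<epsilon>: "\<epsilon> > 0" for \<epsilon>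
  proof -
    obtain N where N: "\<And>m n. m \<ge> N \<Longrightarrow> n \<ge> N \<Longrightarrow> l1_norm (\<lambda>i. a m i - a n i) < \<epsilon>"
      using Cauchy[OF \<epsilon>] by blast
    have "(\<Sum>i\<in>F. \<bar>a n i - b i\<bar>) \<le> \<epsilon>" if "n \<ge> N" "finite F" for n F
    proof (rule LIMSEQ_le_const2)
      show "(\<lambda>m. \<Sum>i\<in>F. \<bar>a n i - a m i\<bar>) \<longlonglongrightarrow> (\<Sum>i\<in>F. \<bar>a n i - b i\<bar>)"
        by (intro tendsto_intros b)
      show "\<exists>M. \<forall>m\<ge>M. (\<Sum>i\<in>F. \<bar>a n i - a m i\<bar>) \<le> \<epsilon>"
        using sum_abs_le_l1_norm[OF diff[of n] that(2)] N[OF that(1)] by (meson le_less_trans less_imp_le)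
    qed
    then have "l1_fun (\<lambda>i. a n i - b i)" "l1_norm (\<lambda>i. a n i - b i) \<le> \<epsilon>" if "n \<ge> N" for n
      using l1_fun_bounded_sums[of "\<lambda>i. a n i - b i" \<epsilon>] that by auto
    then show ?thesis by blast
  qed
  obtain N where "l1_fun (\<lambda>i. a N i - b i)" using tail[of 1] by auto
  then have "l1_fun b" using l1_fun_add(1)[OF a[of N] l1_fun_minus] by fastforce
  moreover have "(\<lambda>n. l1_norm (\<lambda>i. a n i - b i)) \<longlonglongrightarrow> 0"
  proof (rule LIMSEQ_I)
    fix r :: real assume "r > 0"
    then obtain N where "\<forall>n\<ge>N. l1_norm (\<lambda>i. a n i - b i) \<le> r / 2" using tail[of "r / 2"] by auto
    moreover have "norm (l1_norm (\<lambda>i. a n i - b i) - 0) = l1_norm (\<lambda>i. a n i - b i)" for n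
      by (simp add: l1_norm_nonneg)
    ultimately show "\<exists>N. \<forall>n\<ge>N. norm (l1_norm (\<lambda>i. a n i - b i) - 0) < r"
      using \<open>r > 0\<close> by (intro exI[of _ N]) fastforce
  qed
  ultimately show ?thesis using b by blast
qed

lemma banach_space_alpha_space:
  assumes "banach_space X"
  shows "banach_space (alpha_space X)"
proof -
  let ?Z = "alpha_space X"
  have X: "normed_space X" using assms by (simp add: banach_space_iff)
  note Z = normed_space_alpha_space[OF X]
  have "\<exists>z\<in>spc ?Z. (\<lambda>n. nrm ?Z (s n - z)) \<longlonglongrightarrow> 0" if s: "s \<in> cauchy_seqs ?Z" for s
  proof -
    define x where "x n = fst (s n)" for n
    define a where "a n = snd (s n)" for n
    have s_eq: "s n = (x n, a n)" for n by (simp add: x_def a_def)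
    have mem: "(x n, a n) \<in> spc ?Z" for n using cauchy_seqs_in_spc[OF Z s] s_eq by simp
    then have x: "x n \<in> spc X" and a: "l1_fun (a n)" "\<And>y. y \<notin> unit_sphere X \<Longrightarrow> a n y = 0" for n
      by (auto simp: in_alpha_space_iff)
    have d: "nrm X (x m - x n) \<le> nrm ?Z (s m - s n)"
      "l1_norm (\<lambda>i. a m i - a n i) \<le> nrm ?Z (s m - s n)" for m n
      using nrm_alpha_space_bounds[OF X, of "x m - x n" "a m - a n"] diff_in_spc[OF Z mem mem]
      by (simp_all add: s_eq fun_diff_def)
    have "x \<in> cauchy_seqs X"
      by (rule cauchy_seqs_dominated[OF Z Z X s s, of _ 1 0]) (use x d in auto)
    then obtain x0 where x0: "x0 \<in> spc X" "(\<lambda>n. nrm X (x n - x0)) \<longlonglongrightarrow> 0"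
      using assms by (auto simp: banach_space_iff)
    obtain b where b: "l1_fun b" "\<And>i. (\<lambda>n. a n i) \<longlonglongrightarrow> b i" "(\<lambda>n. l1_norm (\<lambda>i. a n i - b i)) \<longlonglongrightarrow> 0"
      using l1_complete[of a] a(1) s d(2) unfolding cauchy_seqs_iff[OF Z] by (meson le_less_trans)
    have "b y = 0" if "y \<notin> unit_sphere X" for y
      using b(2)[of y] a(2)[OF that] by (simp add: tendsto_const_iff)
    then have z: "(x0, b) \<in> spc ?Z" using x0 b by (simp add: in_alpha_space_iff)
    have "(\<lambda>n. nrm ?Z (s n - (x0, b))) \<longlonglongrightarrow> 0"
    proof (rule tendsto_sandwich[OF _ _ tendsto_const])
      show "(\<lambda>n. nrm X (x n - x0) + l1_norm (\<lambda>i. a n i - b i)) \<longlonglongrightarrow> 0"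
        using tendsto_add[OF x0(2) b(3)] by simp
      have "nrm ?Z (s n - (x0, b)) \<le> nrm X (x n - x0) + l1_norm (\<lambda>i. a n i - b i)" for n
        using nrm_alpha_space_bounds(3)[OF X, of "x n - x0" "a n - b"] diff_in_spc[OF Z mem z, of n]
        by (simp add: s_eq fun_diff_def)
      then show "\<forall>\<^sub>F n in sequentially.
          nrm ?Z (s n - (x0, b)) \<le> nrm X (x n - x0) + l1_norm (\<lambda>i. a n i - b i)" by simp
      show "\<forall>\<^sub>F n in sequentially. 0 \<le> nrm ?Z (s n - (x0, b))"
        using nrm_nonneg[OF Z diff_in_spc[OF Z mem z]] s_eq by simp
    qed
    with z show ?thesis by blast
  qed
  with Z show ?thesis by (simp add: banach_space_iff)
qed

section \<open>Absolutely convex sets and the unit ball\<close>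

lemma absolutely_convex_combine2:
  assumes t: "absolutely_convex t" and gh: "g \<in> t" "h \<in> t"
  shows "\<exists>k\<in>t. b *\<^sub>R g + c *\<^sub>R h = (\<bar>b\<bar> + \<bar>c\<bar>) *\<^sub>R k"
proof (cases "\<bar>b\<bar> + \<bar>c\<bar> = 0")
  case True
  then have "b = 0" "c = 0" by auto
  then show ?thesis using gh by auto
next
  case False
  let ?m = "\<bar>b\<bar> + \<bar>c\<bar>"
  have "\<bar>b / ?m\<bar> + \<bar>c / ?m\<bar> \<le> 1" using False by (simp add: abs_divide flip: add_divide_distrib)
  then have "(b / ?m) *\<^sub>R g + (c / ?m) *\<^sub>R h \<in> t" using t gh by (simp add: absolutely_convex_def)
  moreover have "b *\<^sub>R g + c *\<^sub>R h = ?m *\<^sub>R ((b / ?m) *\<^sub>R g + (c / ?m) *\<^sub>R h)"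
    using False by (simp add: scaleR_add_right)
  ultimately show ?thesis by blast
qed

text \<open>The total weight stays outside as a factor, so weight 0 needs no exception and a total
  slightly above 1 can be scaled down afterwards.\<close>

lemma absolutely_convex_combine:
  assumes t: "absolutely_convex t" and "finite F" and "\<And>i. i \<in> F \<Longrightarrow> g i \<in> t" "\<And>i. i \<in> F \<Longrightarrow> 0 \<le> c i"
  shows "\<exists>k\<in>t. (\<Sum>i\<in>F. c i *\<^sub>R g i) = (\<Sum>i\<in>F. c i) *\<^sub>R k"
  using assms(2-4)
proof (induction F)
  case empty
  obtain k where "k \<in> t" using t by (auto simp: absolutely_convex_def)
  then show ?case by auto
next
  case (insert j F)
  then obtain k where k: "k \<in> t" "(\<Sum>i\<in>F. c i *\<^sub>R g i) = (\<Sum>i\<in>F. c i) *\<^sub>R k" by auto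
  have "0 \<le> c j" "0 \<le> (\<Sum>i\<in>F. c i)" "g j \<in> t" using insert.prems by (auto intro: sum_nonneg)
  then show ?case
    using absolutely_convex_combine2[OF t _ k(1), of "g j" "c j" "\<Sum>i\<in>F. c i"] insert.hyps k(2) by simp
qed

lemma absolutely_convex_scaleR:
  assumes "absolutely_convex t" "k \<in> t" "\<bar>c\<bar> \<le> 1"
  shows "c *\<^sub>R k \<in> t"
proof -
  have "\<bar>c\<bar> + \<bar>0\<bar> \<le> 1" using assms(3) by simp
  then have "c *\<^sub>R k + 0 *\<^sub>R k \<in> t" using assms(1,2) unfolding absolutely_convex_def by blast
  then show ?thesis by simp
qed

lemma absolutely_convex_unit_ball:
  assumes V: "normed_space V"
  shows "absolutely_convex (unit_ball V)"
  unfolding absolutely_convex_def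
proof (intro conjI ballI allI impI)
  show "unit_ball V \<noteq> {}" using zero_in_spc[OF V] nrm_zero[OF V] by (auto simp: unit_ball_def)
  fix x y and a b :: real assume "x \<in> unit_ball V" "y \<in> unit_ball V" and ab: "\<bar>a\<bar> + \<bar>b\<bar> \<le> 1"
  then have xy: "x \<in> spc V" "nrm V x \<le> 1" "y \<in> spc V" "nrm V y \<le> 1" by (auto simp: unit_ball_def)
  have "nrm V (a *\<^sub>R x + b *\<^sub>R y) \<le> \<bar>a\<bar> * nrm V x + \<bar>b\<bar> * nrm V y"
    using nrm_triangle[OF V scaleR_in_spc[OF V xy(1)] scaleR_in_spc[OF V xy(3)]]
      nrm_scaleR[OF V xy(1)] nrm_scaleR[OF V xy(3)] by metis
  also have "\<dots> \<le> \<bar>a\<bar> * 1 + \<bar>b\<bar> * 1" using xy by (intro add_mono mult_left_mono) auto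
  finally show "a *\<^sub>R x + b *\<^sub>R y \<in> unit_ball V"
    using ab xy by (simp add: unit_ball_def add_in_spc[OF V] scaleR_in_spc[OF V])
qed

text \<open>The hull is formed in the ambient type; \<open>A \<subseteq> unit_ball V\<close> keeps
  it inside \<open>spc V\<close>, where \<open>ndist\<close> is the norm of the difference.\<close>

lemma closed_abs_convex_hull_iff:
  assumes V: "normed_space V" and A: "A \<subseteq> unit_ball V"
  shows "z \<in> closed_abs_convex_hull V A \<longleftrightarrow>
    z \<in> spc V \<and> (\<forall>r>0. \<exists>p\<in>absolutely_convex hull A. nrm V (z - p) < r)"
proof -
  interpret Metric_space "spc V" "ndist V" by (rule Metric_space_ndist[OF V])
  have "absolutely_convex hull A \<subseteq> unit_ball V"
    by (rule hull_minimal[where S = absolutely_convex, OF A absolutely_convex_unit_ball[OF V]])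
  then have "p \<in> spc V" if "p \<in> absolutely_convex hull A" for p using that by (auto simp: unit_ball_def)
  then show ?thesis
    unfolding closed_abs_convex_hull_def metric_closure_of
    by (auto simp: ndist_eq) (metis ndist_eq)
qed

lemma closed_abs_convex_hull_subset_unit_ball:
  assumes V: "normed_space V" and A: "A \<subseteq> unit_ball V"
  shows "closed_abs_convex_hull V A \<subseteq> unit_ball V"
proof
  fix z assume "z \<in> closed_abs_convex_hull V A"
  then have z: "z \<in> spc V" "\<And>r. r > 0 \<Longrightarrow> \<exists>p\<in>absolutely_convex hull A. nrm V (z - p) < r"
    by (auto simp: closed_abs_convex_hull_iff[OF V A])
  have hull: "absolutely_convex hull A \<subseteq> unit_ball V"
    by (rule hull_minimal[where S = absolutely_convex, OF A absolutely_convex_unit_ball[OF V]])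
  have "nrm V z \<le> 1 + r" if "r > 0" for r
  proof -
    obtain p where p: "p \<in> unit_ball V" "nrm V (z - p) < r" using z(2)[OF \<open>r > 0\<close>] hull by blast
    then show ?thesis
      using nrm_triangle_diff[OF V z(1), of p] by (auto simp: unit_ball_def)
  qed
  then show "z \<in> unit_ball V" using z(1) by (auto simp: unit_ball_def intro: field_le_epsilon)
qed

definition alpha_gen :: "real \<Rightarrow> 'a \<Rightarrow> 'a \<times> ('a \<Rightarrow> real)"
  where "alpha_gen \<sigma> y = (y, \<lambda>w. if w = y then \<sigma> else 0)"

lemma alpha_gen_in_unit_ball:
  assumes y: "y \<in> unit_sphere X" and \<sigma>: "\<bar>\<sigma>\<bar> = 1"
  shows "alpha_gen \<sigma> y \<in> unit_ball (alpha_space X)"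
proof -
  have "nrm (alpha_space X) (alpha_gen \<sigma> y) \<le>
      l1_norm (\<lambda>w. max \<bar>if w = y then \<sigma> else 0\<bar> \<bar>if w = y then 1 else 0\<bar>)"
    using nrm_alpha_space_le[OF sphere_expansion_single[OF y, of 1]] by (simp add: alpha_gen_def)
  also have "\<dots> = 1"
    using l1_fun_finite(2)[of "{y}" "\<lambda>w. max \<bar>if w = y then \<sigma> else 0\<bar> \<bar>if w = y then 1 else 0\<bar>"] \<sigma> by simp
  finally show ?thesis
    using y l1_fun_finite(1)[of "{y}" "\<lambda>w. if w = y then \<sigma> else 0"]
    by (auto simp: unit_ball_def alpha_gen_def in_alpha_space_iff unit_sphere_def)
qed

text \<open>The right side holds the moduli of the solutions of b + c = d and b - c = a, the
  coefficients of \<open>(y, e y)\<close> and \<open>(y, - e y)\<close>.\<close>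

lemma max_abs_eq_half_sums: "max \<bar>a\<bar> \<bar>d\<bar> = \<bar>(d + a) / 2\<bar> + \<bar>(d - a) / 2\<bar>" for a d :: real
  by (auto simp: max_def abs_if field_simps)

text \<open>For the harder inclusion, truncate \<open>a\<close> to a finite set that carries a cheap
  expansion of \<open>x\<close> and nearly all of \<open>a\<close>. The truncated vector is a finite
  combination of generators of total weight below \<open>1 + \<epsilon>\<close>, so dividing by
  \<open>1 + \<epsilon>\<close> moves it into the hull.\<close>

lemma unit_ball_alpha_space:
  assumes X: "normed_space X"
  shows "unit_ball (alpha_space X) =
    closed_abs_convex_hull (alpha_space X) {alpha_gen \<sigma> y |\<sigma> y. \<bar>\<sigma>\<bar> = 1 \<and> y \<in> unit_sphere X}"
    (is "_ = closed_abs_convex_hull ?Z ?G")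
proof
  note Z = normed_space_alpha_space[OF X]
  have G: "?G \<subseteq> unit_ball ?Z" using alpha_gen_in_unit_ball by auto
  show "closed_abs_convex_hull ?Z ?G \<subseteq> unit_ball ?Z"
    by (rule closed_abs_convex_hull_subset_unit_ball[OF Z G])
  show "unit_ball ?Z \<subseteq> closed_abs_convex_hull ?Z ?G"
  proof
    fix z assume "z \<in> unit_ball ?Z"
    moreover obtain x a where z_eq: "z = (x, a)" by fastforce
    ultimately have z: "(x, a) \<in> spc ?Z" "nrm ?Z (x, a) \<le> 1" by (auto simp: unit_ball_def)
    then have x: "x \<in> spc X" and a: "l1_fun a" "\<And>y. y \<notin> unit_sphere X \<Longrightarrow> a y = 0"
      by (auto simp: in_alpha_space_iff)
    have "\<exists>p\<in>absolutely_convex hull ?G. nrm ?Z (z - p) < r" if r: "r > 0" for r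
    proof -
      \<comment> \<open>Truncation and scaling each cost at most \<open>\<epsilon>\<close>; the
        remaining third makes the inequality strict.\<close>
      define \<epsilon> where "\<epsilon> = r / 3"
      have \<epsilon>: "\<epsilon> > 0" using r by (simp add: \<epsilon>_def)
      have "\<exists>d F. sphere_expansion X x d F \<and> l1_norm (\<lambda>y. max \<bar>a y\<bar> \<bar>d y\<bar>) < 1 + \<epsilon>"
      proof (rule ccontr)
        assume "\<not> ?thesis"
        then have "1 + \<epsilon> \<le> nrm ?Z (x, a)" by (intro nrm_alpha_space_ge[OF X x]) (meson not_less)
        then show False using z(2) \<epsilon> by simp
      qed
      then obtain d F where e: "sphere_expansion X x d F" and cost: "l1_norm (\<lambda>y. max \<bar>a y\<bar> \<bar>d y\<bar>) < 1 + \<epsilon>"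
        by blast
      obtain F0 where F0: "finite F0"
        "\<And>H. finite H \<Longrightarrow> F0 \<subseteq> H \<Longrightarrow> l1_norm (\<lambda>y. if y \<in> H then 0 else a y) \<le> \<epsilon>"
        using l1_fun_tail[OF a(1) \<epsilon>] by auto
      \<comment> \<open>Every point of \<open>H\<close> must carry generators, hence the
        intersection with the sphere; off the sphere \<open>a\<close> vanishes, so the tail estimate
        for \<open>F0\<close> survives.\<close>
      define H where "H = F \<union> (F0 \<inter> unit_sphere X)"
      have F: "finite F" "F \<subseteq> unit_sphere X" using e by (auto simp: sphere_expansion_def)
      have H: "finite H" "H \<subseteq> unit_sphere X" using F F0 by (auto simp: H_def)
      have eH: "sphere_expansion X x d H" by (rule sphere_expansion_mono[OF e H(1) _ H(2)]) (simp add: H_def)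
      define aH where "aH y = (if y \<in> H then a y else 0)" for y
      have "(\<lambda>y. if y \<in> H then 0 else a y) = (\<lambda>y. if y \<in> H \<union> F0 then 0 else a y)"
        using a(2) by (auto simp: H_def)
      then have tail: "l1_norm (\<lambda>y. if y \<in> H then 0 else a y) \<le> \<epsilon>" using F0(2)[of "H \<union> F0"] F0(1) H(1) by simp
      define M where "M = (\<Sum>y\<in>H. max \<bar>a y\<bar> \<bar>d y\<bar>)"
      have M: "0 \<le> M" "M < 1 + \<epsilon>"
        using sum_abs_le_l1_norm[OF l1_fun_max(1)[OF a(1) sphere_expansion_l1(1)[OF e]] H(1)] cost
        by (auto simp: M_def intro: sum_nonneg)
      define p where "p = (1 / (1 + \<epsilon>)) *\<^sub>R (x, aH)"
      \<comment> \<open>The hull is the intersection of all such \<open>t\<close>.\<close>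
      have "p \<in> t" if t: "absolutely_convex t" "?G \<subseteq> t" for t
      proof -
        have gen: "alpha_gen \<sigma> y \<in> t" if "\<bar>\<sigma>\<bar> = 1" "y \<in> H" for \<sigma> y
          using t(2) H(2) that by blast
        have "\<exists>k\<in>t. ((d y + a y) / 2) *\<^sub>R alpha_gen 1 y + ((d y - a y) / 2) *\<^sub>R alpha_gen (-1) y =
            max \<bar>a y\<bar> \<bar>d y\<bar> *\<^sub>R k" if "y \<in> H" for y
          unfolding max_abs_eq_half_sums
          by (rule absolutely_convex_combine2[OF t(1)]) (use gen that in auto)
        then obtain k where k: "\<And>y. y \<in> H \<Longrightarrow> k y \<in> t"
          "\<And>y. y \<in> H \<Longrightarrow> ((d y + a y) / 2) *\<^sub>R alpha_gen 1 y + ((d y - a y) / 2) *\<^sub>R alpha_gen (-1) y =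
            max \<bar>a y\<bar> \<bar>d y\<bar> *\<^sub>R k y" by metis
        have "(x, aH) = (\<Sum>y\<in>H. ((d y + a y) / 2) *\<^sub>R alpha_gen 1 y + ((d y - a y) / 2) *\<^sub>R alpha_gen (-1) y)"
        proof (rule prod_eqI)
          have "(d y + a y) / 2 + (d y - a y) / 2 = d y" for y by (simp add: field_simps)
          then show "fst (x, aH) = fst (\<Sum>y\<in>H. ((d y + a y) / 2) *\<^sub>R alpha_gen 1 y + ((d y - a y) / 2) *\<^sub>R alpha_gen (-1) y)"
            using eH by (simp add: fst_sum alpha_gen_def sphere_expansion_def flip: scaleR_add_left)
          have "(\<Sum>y\<in>H. (d y + a y) / 2 * (if w = y then 1 else 0) + (d y - a y) / 2 * (if w = y then -1 else 0)) =
              (\<Sum>y\<in>H. if w = y then a y else 0)" for w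
            by (intro sum.cong refl) (auto simp: field_simps)
          then show "snd (x, aH) = snd (\<Sum>y\<in>H. ((d y + a y) / 2) *\<^sub>R alpha_gen 1 y + ((d y - a y) / 2) *\<^sub>R alpha_gen (-1) y)"
            using H(1) by (simp add: snd_sum alpha_gen_def sum_fun_apply scaleR_fun_def aH_def fun_eq_iff)
        qed
        also have "\<dots> = (\<Sum>y\<in>H. max \<bar>a y\<bar> \<bar>d y\<bar> *\<^sub>R k y)" by (rule sum.cong[OF refl k(2)])
        finally have "(x, aH) = (\<Sum>y\<in>H. max \<bar>a y\<bar> \<bar>d y\<bar> *\<^sub>R k y)" .
        moreover have "\<exists>k'\<in>t. (\<Sum>y\<in>H. max \<bar>a y\<bar> \<bar>d y\<bar> *\<^sub>R k y) = M *\<^sub>R k'"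
          unfolding M_def by (rule absolutely_convex_combine[OF t(1) H(1) k(1)]) auto
        ultimately obtain k' where k': "k' \<in> t" "(x, aH) = M *\<^sub>R k'" by metis
        have "p = (M / (1 + \<epsilon>)) *\<^sub>R k'" using k'(2) by (simp add: p_def)
        moreover have "\<bar>M / (1 + \<epsilon>)\<bar> \<le> 1" using M \<epsilon> by simp
        ultimately show ?thesis using absolutely_convex_scaleR[OF t(1) k'(1)] by simp
      qed
      then have p: "p \<in> absolutely_convex hull ?G" by (auto simp: hull_def)
      have zH: "(x, aH) \<in> spc ?Z"
        using x a l1_fun_mono(1)[OF a(1), of aH] H(2) by (auto simp: in_alpha_space_iff aH_def)
      have "nrm ?Z (x, aH) \<le> l1_norm (\<lambda>y. max \<bar>aH y\<bar> \<bar>d y\<bar>)" by (rule nrm_alpha_space_le[OF e])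
      also have "\<dots> \<le> l1_norm (\<lambda>y. max \<bar>a y\<bar> \<bar>d y\<bar>)"
        by (rule l1_fun_mono(2)[OF l1_fun_max(1)[OF a(1) sphere_expansion_l1(1)[OF e]]]) (auto simp: aH_def)
      finally have nH: "nrm ?Z (x, aH) \<le> 1 + \<epsilon>" using cost by simp
      have "(x, aH) - p = (1 - 1 / (1 + \<epsilon>)) *\<^sub>R (x, aH)" by (simp add: p_def scaleR_diff_left)
      then have "nrm ?Z ((x, aH) - p) = \<bar>1 - 1 / (1 + \<epsilon>)\<bar> * nrm ?Z (x, aH)"
        using nrm_scaleR[OF Z zH] by simp
      also have "\<dots> = (\<epsilon> / (1 + \<epsilon>)) * nrm ?Z (x, aH)" using \<epsilon> by (simp add: field_simps)
      also have "\<dots> \<le> (\<epsilon> / (1 + \<epsilon>)) * (1 + \<epsilon>)" using nH \<epsilon> by (intro mult_left_mono) auto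
      also have "\<dots> = \<epsilon>" using \<epsilon> by simp
      finally have 1: "nrm ?Z ((x, aH) - p) \<le> \<epsilon>" .
      have "z - (x, aH) = (0, \<lambda>y. if y \<in> H then 0 else a y)"
        by (auto simp: z_eq aH_def fun_eq_iff)
      then have 2: "nrm ?Z (z - (x, aH)) \<le> \<epsilon>"
        using nrm_alpha_space_bounds(3)[OF X, of 0 "\<lambda>y. if y \<in> H then 0 else a y"] tail
          diff_in_spc[OF Z z(1) zH] nrm_zero[OF X] z_eq by simp
      have "p \<in> spc ?Z" unfolding p_def by (rule scaleR_in_spc[OF Z zH])
      moreover have "z - p = (z - (x, aH)) + ((x, aH) - p)" by simp
      ultimately have "nrm ?Z (z - p) \<le> nrm ?Z (z - (x, aH)) + nrm ?Z ((x, aH) - p)"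
        using nrm_triangle[OF Z diff_in_spc[OF Z z(1) zH] diff_in_spc[OF Z zH], of p] z_eq by metis
      also have "\<dots> < r" using 1 2 r by (simp add: \<epsilon>_def)
      finally show ?thesis using p by blast
    qed
    then show "z \<in> closed_abs_convex_hull ?Z ?G"
      using z(1) z_eq by (simp add: closed_abs_convex_hull_iff[OF Z G])
  qed
qed

section \<open>Property alpha with constant 1/2\<close>

lemma operator_norm_eqI:
  assumes "\<And>x. x \<in> unit_ball V \<Longrightarrow> nrm W (f x) \<le> r" "x \<in> unit_ball V" "nrm W (f x) = r"
  shows "operator_norm V W f = r"
  unfolding operator_norm_def by (rule cSup_eq_maximum) (use assms in auto)

lemma property_alpha_alpha_space:
  assumes X: "normed_space X"
  shows "property_alpha (alpha_space X)"
proof -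
  let ?Z = "alpha_space X"
  note Z = normed_space_alpha_space[OF X]
  define G where "G = {alpha_gen \<sigma> y |\<sigma> y. \<bar>\<sigma>\<bar> = 1 \<and> y \<in> unit_sphere X}"
  have "\<exists>f. linear_map_on (spc X) f \<and> (\<forall>x\<in>spc X. \<bar>f x\<bar> \<le> nrm X x) \<and> f y = 1" if "y \<in> unit_sphere X" for y
    using norming_functional[OF X, of y] that by (auto simp: unit_sphere_def)
  then obtain \<phi> where \<phi>: "\<And>y. y \<in> unit_sphere X \<Longrightarrow> linear_map_on (spc X) (\<phi> y)"
    "\<And>y x. y \<in> unit_sphere X \<Longrightarrow> x \<in> spc X \<Longrightarrow> \<bar>\<phi> y x\<bar> \<le> nrm X x"
    "\<And>y. y \<in> unit_sphere X \<Longrightarrow> \<phi> y y = 1"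
    by metis
  \<comment> \<open>The family is indexed by the generators themselves, with \<open>id\<close> as
    the vectors. For \<open>i = alpha_gen \<sigma> y\<close> the base point is \<open>fst i\<close>,
    and \<open>snd i (fst i)\<close> recovers the sign.\<close>
  define zs :: "'a \<times> ('a \<Rightarrow> real) \<Rightarrow> 'a \<times> ('a \<Rightarrow> real) \<Rightarrow> real"
    where "zs i z = (\<phi> (fst i) (fst z) + snd i (fst i) * snd z (fst i)) / 2" for i z
  have le: "\<bar>zs i z\<bar> \<le> nrm ?Z z" if "i \<in> G" "z \<in> spc ?Z" for i z
  proof -
    obtain \<sigma> y where i: "i = alpha_gen \<sigma> y" "\<bar>\<sigma>\<bar> = 1" "y \<in> unit_sphere X" using \<open>i \<in> G\<close> unfolding G_def by blast
    obtain x a where z: "z = (x, a)" by fastforce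
    then have xa: "x \<in> spc X" "l1_fun a" using that by (auto simp: in_alpha_space_iff)
    have "\<bar>zs i z\<bar> = \<bar>\<phi> y x + \<sigma> * a y\<bar> / 2" by (simp add: zs_def i z alpha_gen_def)
    also have "\<dots> \<le> (\<bar>\<phi> y x\<bar> + \<bar>a y\<bar>) / 2"
      using abs_triangle_ineq[of "\<phi> y x" "\<sigma> * a y"] i(2) by (simp add: abs_mult)
    also have "\<dots> \<le> nrm ?Z z"
      using \<phi>(2)[OF i(3) xa(1)] abs_le_l1_norm[OF xa(2), of y] nrm_alpha_space_bounds(1,2)[OF X, of x a] that z
      by auto
    finally show ?thesis .
  qed
  have lin: "linear_map_on (spc ?Z) (zs i)" if "i \<in> G" for i
  proof -
    have "fst i \<in> unit_sphere X" using that by (auto simp: G_def alpha_gen_def)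
    from \<phi>(1)[OF this] show ?thesis
      by (auto simp: linear_map_on_def zs_def in_alpha_space_iff scaleR_fun_def field_simps)
  qed
  have one: "zs i i = 1" if "i \<in> G" for i
  proof -
    obtain \<sigma> y where i: "i = alpha_gen \<sigma> y" "\<bar>\<sigma>\<bar> = 1" "y \<in> unit_sphere X"
      using \<open>i \<in> G\<close> unfolding G_def by blast
    have "\<sigma> * \<sigma> = 1" using i(2) by (metis abs_mult_self_eq mult_1)
    then show ?thesis using \<phi>(3)[OF i(3)] by (simp add: zs_def i alpha_gen_def)
  qed
  have mem: "i \<in> unit_ball ?Z" if "i \<in> G" for i using that alpha_gen_in_unit_ball by (auto simp: G_def)
  have half: "\<bar>zs i j\<bar> \<le> 1 / 2" if "i \<in> G" "j \<in> G" "i \<noteq> j" for i j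
  proof -
    obtain \<sigma> y where i: "i = alpha_gen \<sigma> y" "\<bar>\<sigma>\<bar> = 1" "y \<in> unit_sphere X"
      using \<open>i \<in> G\<close> unfolding G_def by blast
    obtain \<tau> w where j: "j = alpha_gen \<tau> w" "\<bar>\<tau>\<bar> = 1" "w \<in> unit_sphere X"
      using \<open>j \<in> G\<close> unfolding G_def by blast
    show ?thesis
    \<comment> \<open>At a common base point the signs are opposite and the value is (1 - 1) / 2. At
      different base points the l1 parts miss each other and only half of the norming functional
      remains.\<close>
    proof (cases "w = y")
      case True
      then have "\<sigma> \<noteq> \<tau>" using that(3) i j by auto
      then have "\<sigma> * \<tau> = -1" using i(2) j(2) by (auto simp: abs_if split: if_splits)
      then show ?thesis using True \<phi>(3)[OF i(3)] by (simp add: zs_def i j alpha_gen_def)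
    next
      case False
      then have "zs i j = \<phi> y w / 2" by (simp add: zs_def i j alpha_gen_def)
      then show ?thesis using \<phi>(2)[OF i(3), of w] j(3) by (auto simp: unit_sphere_def)
    qed
  qed
  \<comment> \<open>The functional \<open>zs i\<close> is bounded by the norm and has value 1 at
    \<open>i\<close>, which gives the lower estimate.\<close>
  have nrm1: "nrm ?Z i = 1" if "i \<in> G" for i
    using le[OF that, of i] one[OF that] mem[OF that] by (auto simp: unit_ball_def)
  have dual: "zs i \<in> dual_space ?Z" "dual_norm ?Z (zs i) = 1" if "i \<in> G" for i
  proof -
    show "zs i \<in> dual_space ?Z"
      using lin[OF that] le[OF that] by (auto simp: bounded_operator_def real_line_def intro!: exI[of _ 1])
    show "dual_norm ?Z (zs i) = 1"
    proof (rule operator_norm_eqI)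
      show "nrm real_line (zs i z) \<le> 1" if "z \<in> unit_ball ?Z" for z
        using le[OF \<open>i \<in> G\<close>, of z] that by (auto simp: real_line_def unit_ball_def)
    qed (use mem[OF that] one[OF that] in \<open>auto simp: real_line_def\<close>)
  qed
  show ?thesis unfolding property_alpha_def
  proof (intro exI conjI)
    show "\<forall>i\<in>G. id i \<in> spc ?Z \<and> zs i \<in> dual_space ?Z \<and> nrm ?Z (id i) = 1 \<and> dual_norm ?Z (zs i) = 1 \<and> zs i (id i) = 1"
      using mem nrm1 dual one by (auto simp: unit_ball_def)
    show "\<forall>i\<in>G. \<forall>j\<in>G. i \<noteq> j \<longrightarrow> \<bar>zs i (id j)\<bar> \<le> 1 / 2" using half by simp
    show "unit_ball ?Z = closed_abs_convex_hull ?Z (id ` G)"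
      using unit_ball_alpha_space[OF X] by (simp add: G_def)
  qed auto
qed

section \<open>The 1-complemented copy of X\<close>

lemma alpha_space_inclusion:
  assumes X: "normed_space X" and x: "x \<in> spc X"
  shows "(x, 0) \<in> spc (alpha_space X)" "nrm (alpha_space X) (x, 0) = nrm X x"
proof -
  show z: "(x, 0) \<in> spc (alpha_space X)" using x by (simp add: in_alpha_space_iff l1_fun_0)
  show "nrm (alpha_space X) (x, 0) = nrm X x"
    using nrm_alpha_space_bounds[OF X z] by (simp add: l1_fun_0)
qed

lemma linear_isometry_alpha_space:
  "normed_space X \<Longrightarrow> linear_isometry X (alpha_space X) (\<lambda>x. (x, 0))"
  by (auto simp: linear_isometry_def linear_map_on_def alpha_space_inclusion)

lemma nrm_fst_le_alpha_space:
  "normed_space X \<Longrightarrow> z \<in> spc (alpha_space X) \<Longrightarrow> fst z \<in> spc X \<and> nrm X (fst z) \<le> nrm (alpha_space X) z"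
  using nrm_alpha_space_bounds(1)[of X "fst z" "snd z"] in_alpha_space_iff[of "fst z" "snd z" X] by simp

text \<open>The projection kills the l1 component. It is contractive by the bounds on the norm, and
  a unit vector of \<open>X\<close>, available because \<open>X\<close> is not zero, shows that its
  norm is exactly 1.\<close>

lemma one_complemented_via_alpha_space:
  assumes X: "normed_space X" and nontrivial: "spc X \<noteq> {0}"
  shows "one_complemented_via (\<lambda>x. (x, 0)) X (alpha_space X)"
proof -
  let ?Z = "alpha_space X" and ?P = "\<lambda>z::'a \<times> ('a \<Rightarrow> real). (fst z, 0 :: 'a \<Rightarrow> real)"
  note Z = normed_space_alpha_space[OF X] and fst = nrm_fst_le_alpha_space[OF X]
  obtain x where x: "x \<in> spc X" "x \<noteq> 0" using nontrivial zero_in_spc[OF X] by blast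
  define y where "y = (1 / nrm X x) *\<^sub>R x"
  have y: "y \<in> spc X" "nrm X y = 1"
    using x nrm_eq_0_iff[OF X x(1)] nrm_nonneg[OF X x(1)]
    by (simp_all add: y_def scaleR_in_spc[OF X] nrm_scaleR[OF X])
  have le: "nrm ?Z (?P z) \<le> nrm ?Z z" if "z \<in> spc ?Z" for z
    using fst[OF that] alpha_space_inclusion(2)[OF X, of "fst z"] by simp
  have "norm_one_projection ?Z ?P" unfolding norm_one_projection_def
  proof (intro conjI)
    show "bounded_operator ?Z ?Z ?P"
      unfolding bounded_operator_def
    proof (intro conjI exI[of _ 1])
      show "linear_map_on (spc ?Z) ?P" by (simp add: linear_map_on_def)
    qed (use le fst alpha_space_inclusion(1)[OF X] in auto)
    show "operator_norm ?Z ?Z ?P = 1"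
    proof (rule operator_norm_eqI[of _ _ _ _ "(y, 0)"])
      show "nrm ?Z (?P z) \<le> 1" if "z \<in> unit_ball ?Z" for z
        using le[of z] that by (auto simp: unit_ball_def)
    qed (use alpha_space_inclusion[OF X y(1)] y(2) in \<open>auto simp: unit_ball_def\<close>)
  qed simp
  moreover have "?P ` spc ?Z = (\<lambda>x. (x, 0)) ` spc X"
  proof
    show "?P ` spc ?Z \<subseteq> (\<lambda>x. (x, 0)) ` spc X" using fst by auto
    show "(\<lambda>x. (x, 0)) ` spc X \<subseteq> ?P ` spc ?Z" using alpha_space_inclusion(1)[OF X] by force
  qed
  ultimately show ?thesis
    using linear_isometry_alpha_space[OF X] unfolding one_complemented_via_def by blast
qed

lemma alpha_space_preserves_nonattainment:
  fixes X :: "'a::real_vector nspace" and Y :: "'b::real_vector nspace"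
  assumes "banach_space X" "banach_space Y" and u: "u \<in> proj_tensor X Y" "u \<notin> NA_proj X Y"
  shows "\<exists>(Z :: ('a \<times> ('a \<Rightarrow> real)) nspace) \<iota> J.
    banach_space Z \<and> property_alpha Z \<and> one_complemented_via \<iota> X Z \<and>
    canonical_tensor_embedding \<iota> X Z Y J \<and> J u \<notin> NA_proj Z Y"
proof -
  have X: "normed_space X" and Y: "normed_space Y" using assms by (auto simp: banach_space_iff)
  let ?Z = "alpha_space X" and ?i = "\<lambda>x::'a. (x, 0 :: 'a \<Rightarrow> real)"
  let ?J = "completion_map (tensor_nspace ?Z Y) (tensor_map ?Z Y ?i)"
  note Z = normed_space_alpha_space[OF X] and i = linear_isometry_alpha_space[OF X]
  note V = normed_space_tensor_nspace[OF X Y] and W = normed_space_tensor_nspace[OF Z Y]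
  have g: "linear_map_on (spc ?Z) fst" "fst ` spc ?Z \<subseteq> spc X"
    "\<And>z. z \<in> spc ?Z \<Longrightarrow> nrm X (fst z) \<le> nrm ?Z z"
    using nrm_fst_le_alpha_space[OF X] by (auto simp: linear_map_on_def)
  have T: "linear_isometry (tensor_nspace X Y) (tensor_nspace ?Z Y) (tensor_map ?Z Y ?i)"
    by (rule linear_isometry_tensor_map[OF X Y Z i g]) auto
  have "spc X \<noteq> {0}" using proj_tensor_zero_space[OF X Y _ u(1)] u(2) by blast
  then have "one_complemented_via ?i X ?Z" by (rule one_complemented_via_alpha_space[OF X])
  moreover have "canonical_tensor_embedding ?i X ?Z Y ?J"
    unfolding canonical_tensor_embedding_def
  proof (intro conjI ballI)
    show "completion_isometry (tensor_nspace X Y) (tensor_nspace ?Z Y) ?J"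
      by (rule completion_isometry_completion_map[OF V W T])
    fix x y assume xy: "x \<in> spc X" "y \<in> spc Y"
    have "tensor_map ?Z Y ?i (elem_tensor X Y x y) = elem_tensor ?Z Y (?i x) y"
      by (rule tensor_map_elem_tensor) (use i xy in \<open>auto simp: linear_isometry_def\<close>)
    then show "?J (to_completion (tensor_nspace X Y) (elem_tensor X Y x y)) =
        to_completion (tensor_nspace ?Z Y) (elem_tensor ?Z Y (?i x) y)"
      using completion_map_to_completion[OF V W T] elem_tensor_in_algebraic_tensor[OF xy] by simp
  qed
  moreover have "?J u \<notin> NA_proj ?Z Y"
  proof
    assume "?J u \<in> NA_proj ?Z Y"
    then have "u \<in> NA_proj X Y" by (intro NA_proj_retract[OF X Y Z i g _ u(1)]) auto
    with u(2) show False ..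
  qed
  ultimately show ?thesis
    using banach_space_alpha_space[OF assms(1)] property_alpha_alpha_space[OF X] by blast
qed

section \<open>A tensor that does not attain its projective norm\<close>

text \<open>In an optimal representation the differences between norm products and values of
  \<open>B\<close> are nonnegative and have sum at most 0. So \<open>B\<close> is exact on every
  term, \<open>strict\<close> makes every value 0, and \<open>u B > 0\<close> is
  contradicted.\<close>

lemma to_completion_not_NA_proj:
  assumes X: "normed_space X" and Y: "normed_space Y" and u: "u \<in> algebraic_tensor X Y"
    and B: "bilinear_form_on (spc X) (spc Y) B"
    and le: "\<And>x y. x \<in> spc X \<Longrightarrow> y \<in> spc Y \<Longrightarrow> \<bar>B x y\<bar> \<le> nrm X x * nrm Y y"
    and strict: "\<And>x y. x \<in> spc X \<Longrightarrow> y \<in> spc Y \<Longrightarrow> B x y = nrm X x * nrm Y y \<Longrightarrow> B x y = 0"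
    and norming: "projective_norm X Y u \<le> u B" "u B > 0"
  shows "to_completion (tensor_nspace X Y) u \<notin> NA_proj X Y"
proof
  let ?V = "tensor_nspace X Y"
  note V = normed_space_tensor_nspace[OF X Y]
  assume "to_completion ?V u \<in> NA_proj X Y"
  moreover have "proj_tensor_norm X Y (to_completion ?V u) = projective_norm X Y u"
    using completion_norm_to_completion[OF V] u by (simp add: proj_tensor_norm_def)
  ultimately obtain x y where xy: "\<And>i. x i \<in> spc X" "\<And>i. y i \<in> spc Y"
    and sums: "tensor_sums X Y x y (to_completion ?V u)"
    and S: "(\<lambda>i. nrm X (x i) * nrm Y (y i)) sums projective_norm X Y u"
    by (auto simp: NA_proj_def)
  define p where "p n = (\<Sum>i<n. elem_tensor X Y (x i) (y i))" for n
  have p: "p n \<in> algebraic_tensor X Y" for n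
    using xy by (auto simp: p_def intro: sum_elem_tensor_in_algebraic_tensor)
  have "completion_dist ?V (to_completion ?V u) (to_completion ?V (p n)) = projective_norm X Y (u - p n)" for n
    using completion_dist_to_completion[OF V] u p by simp
  then have lim: "(\<lambda>n. projective_norm X Y (u - p n)) \<longlonglongrightarrow> 0"
    using sums by (simp add: tensor_sums_def flip: p_def)
  have diff: "u - p n \<in> algebraic_tensor X Y" for n using diff_in_spc[OF V, of u "p n"] u p by simp
  \<comment> \<open>Evaluation at \<open>B\<close> is 1-Lipschitz for the projective norm, so
    \<open>B\<close> may be applied to the series term by term.\<close>
  have "\<bar>u B - (\<Sum>i<n. B (x i) (y i))\<bar> \<le> projective_norm X Y (u - p n)" for n
    using abs_tensor_apply_le[OF X Y diff[of n] B le]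
    by (simp add: p_def sum_fun_apply elem_tensor_apply[OF B])
  then have "(\<lambda>n. u B - (\<Sum>i<n. B (x i) (y i))) \<longlonglongrightarrow> 0"
    by (intro Lim_null_comparison[OF _ lim]) simp
  from tendsto_diff[OF tendsto_const[of "u B"] this] have B_sums: "(\<lambda>i. B (x i) (y i)) sums u B"
    by (simp add: sums_def)
  have D: "(\<lambda>i. nrm X (x i) * nrm Y (y i) - B (x i) (y i)) sums (projective_norm X Y u - u B)"
    by (rule sums_diff[OF S B_sums])
  have nn: "0 \<le> nrm X (x i) * nrm Y (y i) - B (x i) (y i)" for i using le[OF xy(1,2), of i] by (simp add: abs_le_iff)
  have "nrm X (x i) * nrm Y (y i) - B (x i) (y i) \<le> projective_norm X Y u - u B" for i
    using sum_le_suminf[OF sums_summable[OF D], of "{i}"] nn sums_unique[OF D] by simp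
  then have "B (x i) (y i) = nrm X (x i) * nrm Y (y i)" for i using nn[of i] norming(1) by (smt (verit))
  then have "B (x i) (y i) = 0" for i using strict[OF xy] by blast
  then have "(\<lambda>i. B (x i) (y i)) sums 0" by simp
  with B_sums show False using sums_unique2 norming(2) by fastforce
qed

text \<open>
  Functions on \<open>\<nat>\<close>, seen as functions on \<open>\<real>\<close>. The values at 0 and 1 are a vector of the plane
  \<open>{p \<in> \<real>\<^sup>3. \<Sum>p = 0}\<close>, with \<open>plane_coord\<close> giving its three coordinates, and the remaining values
  form a null sequence.
\<close>

definition plane_coord :: "nat \<Rightarrow> (real \<Rightarrow> real) \<Rightarrow> real"
  where "plane_coord i f = (if i = 0 then f 0 else if i = 1 then f 1 else - f 0 - f 1)"

text \<open>Positivity gives the strict inequality, decrease to 0 gives vectors with small gap, and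
  the first value 1/3 is the largest for which coordinates \<open>- r / 2\<close> stay harmless in
  \<open>nrm_step_fun_le\<close>.\<close>

definition tilt :: "nat \<Rightarrow> real" where "tilt n = 1 / (real n + 3)"

definition tilted_coord :: "nat \<Rightarrow> nat \<Rightarrow> (real \<Rightarrow> real) \<Rightarrow> real"
  where "tilted_coord i n f = (1 + tilt n) * plane_coord i f - tilt n * f (real (n + 2))"

text \<open>
  Since \<open>f (real (n + 2))\<close> tends to 0, the tilted coordinates make the norm of \<open>f\<close> strictly larger
  than the norm of its plane part (if that is nonzero), yet there are vectors with arbitrarily
  small gap.
\<close>

definition tilted_space :: "(real \<Rightarrow> real) nspace"
  where "tilted_space =
    \<lparr>spc = {f. (\<forall>x. x \<notin> \<nat> \<longrightarrow> f x = 0) \<and> (\<lambda>n. f (real n)) \<longlonglongrightarrow> 0},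
     nrm = (\<lambda>f. SUP k. max \<bar>f (real (snd k))\<bar> \<bar>tilted_coord (fst k) (snd k) f\<bar>)\<rparr>"

text \<open>The norm dual to the largest modulus of the three coordinates
  \<open>plane_coord\<close>: the entries are the moduli of \<open>g\<close> at the vertices (1, 0),
  (0, 1) and (1, -1) of that hexagon, one from each antipodal pair.\<close>

definition hexagonal_plane :: "(real \<Rightarrow> real) nspace"
  where "hexagonal_plane =
    \<lparr>spc = {g. \<forall>x. x \<noteq> 0 \<and> x \<noteq> 1 \<longrightarrow> g x = 0},
     nrm = (\<lambda>g. max (max \<bar>g 0\<bar> \<bar>g 1\<bar>) \<bar>g 0 - g 1\<bar>)\<rparr>"

definition plane_pairing :: "(real \<Rightarrow> real) \<Rightarrow> (real \<Rightarrow> real) \<Rightarrow> real"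
  where "plane_pairing f g = f 0 * g 0 + f 1 * g 1"

section \<open>The tilted space and the hexagonal plane as Banach spaces\<close>

lemma scaleR_fun_apply: "(c *\<^sub>R f) x = c *\<^sub>R f x"
  by (simp add: scaleR_fun_def)

lemma tilt_bounds: "0 < tilt n" "tilt n \<le> 1 / 3"
  by (auto simp: tilt_def field_simps)

lemma tilt_antimono: "m \<le> n \<Longrightarrow> tilt n \<le> tilt m"
  by (auto simp: tilt_def field_simps)

lemma tilted_coord_linear:
  "tilted_coord i n (f + g) = tilted_coord i n f + tilted_coord i n g"
  "tilted_coord i n (f - g) = tilted_coord i n f - tilted_coord i n g"
  "tilted_coord i n (c *\<^sub>R f) = c * tilted_coord i n f"
  by (auto simp: tilted_coord_def plane_coord_def scaleR_fun_def algebra_simps)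

lemma tilted_space_bdd:
  assumes "f \<in> spc tilted_space"
  shows "bdd_above (range (\<lambda>k. max \<bar>f (real (snd k))\<bar> \<bar>tilted_coord (fst k) (snd k) f\<bar>))"
proof -
  have "Bseq (\<lambda>n. f (real n))" using assms by (auto simp: tilted_space_def intro: convergent_imp_Bseq convergentI)
  then obtain K where K: "\<And>n. \<bar>f (real n)\<bar> \<le> K" by (auto simp: Bseq_def)
  have "0 \<le> K" using K[of 0] by linarith
  have p: "\<bar>plane_coord i f\<bar> \<le> 2 * K" for i using K[of 0] K[of 1] by (auto simp: plane_coord_def)
  have "\<bar>tilted_coord i n f\<bar> \<le> 5 * K" for i n
  proof -
    have "\<bar>tilted_coord i n f\<bar> \<le> (1 + tilt n) * \<bar>plane_coord i f\<bar> + tilt n * \<bar>f (real (n + 2))\<bar>"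
      unfolding tilted_coord_def using tilt_bounds[of n]
      by (intro order_trans[OF abs_triangle_ineq4]) (simp add: abs_mult)
    also have "\<dots> \<le> 2 * (2 * K) + 1 * K"
      using tilt_bounds[of n] p[of i] K[of "n + 2"] by (intro add_mono mult_mono) auto
    finally show ?thesis by simp
  qed
  then show ?thesis using K \<open>0 \<le> K\<close> by (intro bdd_aboveI2[of _ _ "5 * K"]) (smt (verit))
qed

lemma le_nrm_tilted_space:
  assumes "f \<in> spc tilted_space"
  shows "\<bar>f (real n)\<bar> \<le> nrm tilted_space f" "\<bar>tilted_coord i n f\<bar> \<le> nrm tilted_space f"
  using cSUP_upper[OF UNIV_I tilted_space_bdd[OF assms], of "(i, n)"] by (simp_all add: tilted_space_def)

lemma nrm_tilted_space_le:
  assumes "\<And>n. \<bar>f (real n)\<bar> \<le> r" "\<And>i n. \<bar>tilted_coord i n f\<bar> \<le> r"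
  shows "nrm tilted_space f \<le> r"
  unfolding tilted_space_def using assms by (auto intro!: cSUP_least)

lemma tilted_space_zeroI:
  assumes "f \<in> spc tilted_space" "\<And>n. f (real n) = 0"
  shows "f = 0"
proof
  show "f x = 0 x" for x using assms by (cases "x \<in> \<nat>") (auto simp: tilted_space_def elim: Nats_cases)
qed

lemma normed_space_tilted_space: "normed_space tilted_space"
  unfolding normed_space_def
proof (intro conjI ballI allI)
  show "subspace (spc tilted_space)"
  proof (rule subspaceI)
    fix f g :: "real \<Rightarrow> real" and c assume "f \<in> spc tilted_space" "g \<in> spc tilted_space"
    then show "f + g \<in> spc tilted_space" "c *\<^sub>R f \<in> spc tilted_space"
      using tendsto_add[of "\<lambda>n. f (real n)" 0 sequentially "\<lambda>n. g (real n)" 0]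
        tendsto_mult_right_zero[of "\<lambda>n. f (real n)" sequentially c]
      by (auto simp: tilted_space_def scaleR_fun_def)
  qed (simp add: tilted_space_def)
  note lin = tilted_coord_linear
  fix f assume f: "f \<in> spc tilted_space"
  note le = le_nrm_tilted_space[OF f]
  show "0 \<le> nrm tilted_space f" using le(1)[of 0] by linarith
  show "nrm tilted_space f = 0 \<longleftrightarrow> f = 0"
  proof
    assume "nrm tilted_space f = 0"
    then show "f = 0" using le(1) by (intro tilted_space_zeroI[OF f]) simp
  next
    assume "f = 0"
    then have "nrm tilted_space f \<le> 0"
      by (intro nrm_tilted_space_le) (auto simp: tilted_coord_def plane_coord_def)
    then show "nrm tilted_space f = 0" using le(1)[of 0] by linarith
  qed
  have scale: "nrm tilted_space (c *\<^sub>R g) \<le> \<bar>c\<bar> * nrm tilted_space g" if "g \<in> spc tilted_space" for c g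
    using le_nrm_tilted_space[OF that]
    by (intro nrm_tilted_space_le) (auto simp: lin scaleR_fun_apply abs_mult intro: mult_left_mono)
  show "nrm tilted_space (c *\<^sub>R f) = \<bar>c\<bar> * nrm tilted_space f" for c
  proof (cases "c = 0")
    case True
    have "nrm tilted_space 0 \<le> 0"
      by (intro nrm_tilted_space_le) (auto simp: tilted_coord_def plane_coord_def)
    moreover have "0 \<le> nrm tilted_space 0"
      using le_nrm_tilted_space(1)[of 0 0] by (simp add: tilted_space_def)
    ultimately show ?thesis using True by simp
  next
    case False
    have "c *\<^sub>R f \<in> spc tilted_space" using f tendsto_mult_right_zero[of "\<lambda>n. f (real n)" sequentially c]
      by (auto simp: tilted_space_def scaleR_fun_def)
    from scale[OF this, of "1 / c"] have "nrm tilted_space f \<le> \<bar>1 / c\<bar> * nrm tilted_space (c *\<^sub>R f)"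
      using False by simp
    then show ?thesis using scale[OF f, of c] False by (simp add: field_simps)
  qed
  fix g assume g: "g \<in> spc tilted_space"
  have "\<bar>f (real n)\<bar> + \<bar>g (real n)\<bar> \<le> nrm tilted_space f + nrm tilted_space g"
    "\<bar>tilted_coord i n f\<bar> + \<bar>tilted_coord i n g\<bar> \<le> nrm tilted_space f + nrm tilted_space g" for i n
    by (intro add_mono le le_nrm_tilted_space[OF g])+
  then show "nrm tilted_space (f + g) \<le> nrm tilted_space f + nrm tilted_space g"
    by (intro nrm_tilted_space_le) (auto simp: lin intro: order_trans[OF abs_triangle_ineq])
qed

lemma cauchy_seqs_pointwise:
  assumes V: "normed_space V" and s: "s \<in> cauchy_seqs V"
    and le: "\<And>f. f \<in> spc V \<Longrightarrow> \<bar>f x\<bar> \<le> nrm V f"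
  shows "\<exists>l. (\<lambda>m. s m x) \<longlonglongrightarrow> (l :: real)"
proof -
  have "Cauchy (\<lambda>m. s m x)"
  proof (rule metric_CauchyI)
    fix \<epsilon> :: real assume "\<epsilon> > 0"
    then obtain N where "\<And>m n. m \<ge> N \<Longrightarrow> n \<ge> N \<Longrightarrow> nrm V (s m - s n) < \<epsilon>"
      using s unfolding cauchy_seqs_iff[OF V] by blast
    moreover have "dist (s m x) (s n x) \<le> nrm V (s m - s n)" for m n
      using le[OF diff_in_spc[OF V cauchy_seqs_in_spc[OF V s] cauchy_seqs_in_spc[OF V s]], of m n]
      by (simp add: dist_real_def)
    ultimately show "\<exists>M. \<forall>m\<ge>M. \<forall>n\<ge>M. dist (s m x) (s n x) < \<epsilon>"
      by (meson le_less_trans)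
  qed
  then show ?thesis using Cauchy_convergent convergent_def by blast
qed

lemma banach_space_tilted_space: "banach_space tilted_space"
  unfolding banach_space_iff
proof (intro conjI ballI normed_space_tilted_space)
  let ?X = tilted_space
  note X = normed_space_tilted_space
  fix s assume s: "s \<in> cauchy_seqs ?X"
  note mem = cauchy_seqs_in_spc[OF X s]
  have "\<exists>l. (\<lambda>m. s m (real n)) \<longlonglongrightarrow> l" for n
    by (rule cauchy_seqs_pointwise[OF X s le_nrm_tilted_space(1)])
  then obtain l where l: "\<And>n. (\<lambda>m. s m (real n)) \<longlonglongrightarrow> l n" by metis
  \<comment> \<open>Extends the limits, which are known at natural numbers only, to a function on
    the reals that vanishes elsewhere.\<close>
  define f where "f x = (if x \<in> \<nat> then l (nat \<lfloor>x\<rfloor>) else 0)" for x :: real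
  have f: "(\<lambda>m. s m (real n)) \<longlonglongrightarrow> f (real n)" for n using l by (simp add: f_def)
  \<comment> \<open>A tilted coordinate involves only three values of its argument, so pointwise
    convergence is enough.\<close>
  have coord: "(\<lambda>m. tilted_coord i n (s m)) \<longlonglongrightarrow> tilted_coord i n f" for i n
    using f[of 0] f[of 1] f[of "n + 2"]
    by (cases "i = 0"; cases "i = 1") (auto simp: tilted_coord_def plane_coord_def intro!: tendsto_intros)
  have tail: "\<exists>N. \<forall>m\<ge>N. (\<forall>n. \<bar>s m (real n) - f (real n)\<bar> \<le> \<epsilon>) \<and>
      (\<forall>i n. \<bar>tilted_coord i n (s m) - tilted_coord i n f\<bar> \<le> \<epsilon>)" if \<epsilon>: "\<epsilon> > 0" for \<epsilon>
  proof -
    obtain N where N: "\<And>m n. m \<ge> N \<Longrightarrow> n \<ge> N \<Longrightarrow> nrm ?X (s m - s n) < \<epsilon>"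
      using s \<epsilon> unfolding cauchy_seqs_iff[OF X] by blast
    have "\<bar>s m (real n) - f (real n)\<bar> \<le> \<epsilon> \<and> \<bar>tilted_coord i n (s m) - tilted_coord i n f\<bar> \<le> \<epsilon>"
      if m: "m \<ge> N" for m n i
    proof
      have le: "\<bar>s m (real n) - s k (real n)\<bar> \<le> \<epsilon>" "\<bar>tilted_coord i n (s m) - tilted_coord i n (s k)\<bar> \<le> \<epsilon>"
        if "k \<ge> N" for k
      proof -
        have "s m - s k \<in> spc ?X" by (rule diff_in_spc[OF X mem mem])
        from le_nrm_tilted_space(1)[OF this, of n] le_nrm_tilted_space(2)[OF this, of i n] N[OF m that]
        show "\<bar>s m (real n) - s k (real n)\<bar> \<le> \<epsilon>" "\<bar>tilted_coord i n (s m) - tilted_coord i n (s k)\<bar> \<le> \<epsilon>"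
          by (simp_all add: tilted_coord_linear)
      qed
      show "\<bar>s m (real n) - f (real n)\<bar> \<le> \<epsilon>"
        by (rule LIMSEQ_le_const2[OF tendsto_rabs[OF tendsto_diff[OF tendsto_const f]]]) (use le in blast)
      show "\<bar>tilted_coord i n (s m) - tilted_coord i n f\<bar> \<le> \<epsilon>"
        by (rule LIMSEQ_le_const2[OF tendsto_rabs[OF tendsto_diff[OF tendsto_const coord]]]) (use le in blast)
    qed
    then show ?thesis by blast
  qed
  \<comment> \<open>A uniform limit of null sequences is a null sequence; \<open>tail\<close>
    provides the uniformity.\<close>
  have "(\<lambda>n. f (real n)) \<longlonglongrightarrow> 0"
  proof (rule LIMSEQ_I)
    fix r :: real assume r: "r > 0"
    obtain N where N: "\<And>n. \<bar>s N (real n) - f (real n)\<bar> \<le> r / 2" using tail[of "r / 2"] r by auto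
    have "(\<lambda>n. s N (real n)) \<longlonglongrightarrow> 0" using mem[of N] by (simp add: tilted_space_def)
    then obtain M where M: "\<And>n. n \<ge> M \<Longrightarrow> \<bar>s N (real n)\<bar> < r / 2"
      using LIMSEQ_D[of _ 0 "r / 2"] r by fastforce
    have "\<bar>f (real n)\<bar> < r" if "n \<ge> M" for n using N[of n] M[OF that] by linarith
    then show "\<exists>no. \<forall>n\<ge>no. norm (f (real n) - 0) < r" by auto
  qed
  then have fX: "f \<in> spc ?X" by (simp add: tilted_space_def f_def)
  have "(\<lambda>m. nrm ?X (s m - f)) \<longlonglongrightarrow> 0"
  proof (rule LIMSEQ_I)
    fix r :: real assume r: "r > 0"
    obtain N where N: "\<And>m n. m \<ge> N \<Longrightarrow> \<bar>s m (real n) - f (real n)\<bar> \<le> r / 2"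
      "\<And>m n i. m \<ge> N \<Longrightarrow> \<bar>tilted_coord i n (s m) - tilted_coord i n f\<bar> \<le> r / 2"
      using tail[of "r / 2"] half_gt_zero[OF r] by blast
    have "nrm ?X (s m - f) \<le> r / 2" if "m \<ge> N" for m
      by (rule nrm_tilted_space_le) (use N that in \<open>auto simp: tilted_coord_linear\<close>)
    then show "\<exists>no. \<forall>m\<ge>no. norm (nrm ?X (s m - f) - 0) < r"
      using nrm_nonneg[OF X diff_in_spc[OF X mem fX]] r by (intro exI[of _ N]) fastforce
  qed
  with fX show "\<exists>x\<in>spc ?X. (\<lambda>n. nrm ?X (s n - x)) \<longlonglongrightarrow> 0" by blast
qed

lemma banach_space_hexagonal_plane: "banach_space hexagonal_plane"
proof -
  let ?Y = hexagonal_plane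
  have zero: "g = 0" if "g \<in> spc ?Y" "g 0 = 0" "g 1 = 0" for g
  proof
    show "g x = 0 x" for x using that by (cases "x = 0 \<or> x = 1") (auto simp: hexagonal_plane_def)
  qed
  have Y: "normed_space ?Y"
    unfolding normed_space_def
  proof (intro conjI ballI allI)
    show "subspace (spc ?Y)" by (rule subspaceI) (auto simp: hexagonal_plane_def scaleR_fun_def)
    fix g assume g: "g \<in> spc ?Y"
    show "0 \<le> nrm ?Y g" by (simp add: hexagonal_plane_def)
    show "nrm ?Y g = 0 \<longleftrightarrow> g = 0"
    proof
      assume "nrm ?Y g = 0"
      then have "g 0 = 0" "g 1 = 0" by (auto simp: hexagonal_plane_def max_def split: if_splits)
      then show "g = 0" by (rule zero[OF g])
    qed (simp add: hexagonal_plane_def)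
    show "nrm ?Y (c *\<^sub>R g) = \<bar>c\<bar> * nrm ?Y g" for c
      by (simp add: hexagonal_plane_def scaleR_fun_def max_mult_distrib_left abs_mult flip: right_diff_distrib)
    have le: "\<bar>k 0\<bar> \<le> nrm ?Y k" "\<bar>k 1\<bar> \<le> nrm ?Y k" "\<bar>k 0 - k 1\<bar> \<le> nrm ?Y k" for k
      by (auto simp: hexagonal_plane_def le_max_iff_disj)
    fix h
    have "\<bar>g 0 + h 0\<bar> \<le> nrm ?Y g + nrm ?Y h" "\<bar>g 1 + h 1\<bar> \<le> nrm ?Y g + nrm ?Y h"
      "\<bar>(g 0 + h 0) - (g 1 + h 1)\<bar> \<le> nrm ?Y g + nrm ?Y h"
      using le[of g] le[of h] by linarith+
    then show "nrm ?Y (g + h) \<le> nrm ?Y g + nrm ?Y h"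
      by (subst hexagonal_plane_def) simp
  qed
  have "\<exists>y\<in>spc ?Y. (\<lambda>n. nrm ?Y (s n - y)) \<longlonglongrightarrow> 0" if s: "s \<in> cauchy_seqs ?Y" for s
  proof -
    have "\<exists>l. (\<lambda>m. s m x) \<longlonglongrightarrow> l" if "x = 0 \<or> x = 1" for x
      by (rule cauchy_seqs_pointwise[OF Y s]) (use that in \<open>auto simp: hexagonal_plane_def\<close>)
    then obtain a b where ab: "(\<lambda>m. s m 0) \<longlonglongrightarrow> a" "(\<lambda>m. s m 1) \<longlonglongrightarrow> b" by blast
    define g where "g x = (if x = 0 then a else if x = 1 then b else 0)" for x :: real
    have lim: "(\<lambda>m. s m 0 - g 0) \<longlonglongrightarrow> 0" "(\<lambda>m. s m 1 - g 1) \<longlonglongrightarrow> 0"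
      using ab by (auto simp: g_def LIM_zero_iff)
    have "(\<lambda>m. max (max \<bar>s m 0 - g 0\<bar> \<bar>s m 1 - g 1\<bar>) \<bar>(s m 0 - g 0) - (s m 1 - g 1)\<bar>) \<longlonglongrightarrow>
        max (max \<bar>0\<bar> \<bar>0\<bar>) \<bar>0 - 0\<bar>"
      by (intro tendsto_intros lim)
    then have "(\<lambda>n. nrm ?Y (s n - g)) \<longlonglongrightarrow> 0" by (simp add: hexagonal_plane_def)
    moreover have "g \<in> spc ?Y" by (simp add: hexagonal_plane_def g_def)
    ultimately show ?thesis by blast
  qed
  with Y show ?thesis by (simp add: banach_space_iff)
qed

text \<open>Among |a|, |b| and |a - b| the largest is the sum of the other two. Rewriting the
  pairing in terms of those two leaves coefficients taken from p, q and p + q up to sign, all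
  bounded by \<open>P\<close>.\<close>

lemma hexagonal_duality:
  fixes p q a b P :: real
  assumes "\<bar>p\<bar> \<le> P" "\<bar>q\<bar> \<le> P" "\<bar>- p - q\<bar> \<le> P"
  shows "\<bar>p * a + q * b\<bar> \<le> P * max (max \<bar>a\<bar> \<bar>b\<bar>) \<bar>a - b\<bar>"
proof -
  have bound: "\<bar>r * c + t * d\<bar> \<le> P * m"
    if "\<bar>r\<bar> \<le> P" "\<bar>t\<bar> \<le> P" "\<bar>c\<bar> + \<bar>d\<bar> \<le> m" for r t c d m
  proof -
    have "\<bar>r * c + t * d\<bar> \<le> \<bar>r\<bar> * \<bar>c\<bar> + \<bar>t\<bar> * \<bar>d\<bar>"
      by (metis abs_mult abs_triangle_ineq)
    also have "\<dots> \<le> P * \<bar>c\<bar> + P * \<bar>d\<bar>" using that by (intro add_mono mult_right_mono) auto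
    also have "\<dots> \<le> P * m" using that by (simp add: mult_left_mono flip: distrib_left)
    finally show ?thesis .
  qed
  have pq: "\<bar>p + q\<bar> \<le> P" using assms(3) by linarith
  have eqs: "p * a + q * b = p * (a - b) + (p + q) * b" "p * a + q * b = q * (b - a) + (p + q) * a"
    by (simp_all add: algebra_simps)
  consider "\<bar>a - b\<bar> + \<bar>b\<bar> = \<bar>a\<bar>" | "\<bar>b - a\<bar> + \<bar>a\<bar> = \<bar>b\<bar>" | "\<bar>a\<bar> + \<bar>b\<bar> = \<bar>a - b\<bar>" by linarith
  then show ?thesis
  proof cases
    case 1
    show ?thesis unfolding eqs(1) by (rule bound) (use assms pq 1 in auto)
  next
    case 2
    show ?thesis unfolding eqs(2) by (rule bound) (use assms pq 2 in auto)
  next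
    case 3
    show ?thesis by (rule bound) (use assms 3 in auto)
  qed
qed

text \<open>At a coordinate of maximal modulus \<open>P\<close> and an \<open>n\<close> with
  \<open>\<bar>f (real (n + 2))\<bar> < P\<close>, the tilted coordinate is at least
  \<open>P + tilt n * (P - \<bar>f (real (n + 2))\<bar>)\<close>. A single bound \<open>P\<close>
  for all coordinates is what \<open>hexagonal_duality\<close> takes.\<close>

lemma plane_coord_less_nrm:
  assumes f: "f \<in> spc tilted_space" and "f 0 \<noteq> 0 \<or> f 1 \<noteq> 0"
  shows "\<exists>P < nrm tilted_space f. \<forall>i. \<bar>plane_coord i f\<bar> \<le> P"
proof -
  define P where "P = max (max \<bar>f 0\<bar> \<bar>f 1\<bar>) \<bar>- f 0 - f 1\<bar>"
  have P: "\<bar>plane_coord i f\<bar> \<le> P" for i by (auto simp: plane_coord_def P_def le_max_iff_disj)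
  have "P > 0" using assms(2) by (auto simp: P_def less_max_iff_disj)
  have "\<exists>i. \<bar>plane_coord i f\<bar> = P"
  proof -
    \<comment> \<open>Index 2 stands for all indices beyond 1, which share the third
      coordinate.\<close>
    have "\<bar>plane_coord 0 f\<bar> = P \<or> \<bar>plane_coord 1 f\<bar> = P \<or> \<bar>plane_coord 2 f\<bar> = P"
      by (simp add: plane_coord_def P_def max_def)
    then show ?thesis by blast
  qed
  then obtain i where i: "\<bar>plane_coord i f\<bar> = P" by blast
  have "(\<lambda>n. f (real n)) \<longlonglongrightarrow> 0" using f by (simp add: tilted_space_def)
  then obtain n where n: "\<bar>f (real (n + 2))\<bar> < P"
    using LIMSEQ_D[of _ 0 P] \<open>P > 0\<close> by (metis diff_zero le_add1 real_norm_def)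
  have "\<bar>(1 + tilt n) * plane_coord i f\<bar> = (1 + tilt n) * P" "\<bar>tilt n * f (real (n + 2))\<bar> = tilt n * \<bar>f (real (n + 2))\<bar>"
    using tilt_bounds(1)[of n] i by (simp_all only: abs_mult)
  then have "P + tilt n * (P - \<bar>f (real (n + 2))\<bar>) =
      \<bar>(1 + tilt n) * plane_coord i f\<bar> - \<bar>tilt n * f (real (n + 2))\<bar>"
    by (simp add: algebra_simps)
  also have "\<dots> \<le> nrm tilted_space f"
    using le_nrm_tilted_space(2)[OF f, of i n] unfolding tilted_coord_def by linarith
  finally have "P < nrm tilted_space f" using n tilt_bounds(1)[of n] mult_pos_pos[of "tilt n" "P - \<bar>f (real (n + 2))\<bar>"]
    by linarith
  with P show ?thesis by blast
qed

lemma plane_pairing_le: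
  assumes f: "f \<in> spc tilted_space" and g: "g \<in> spc hexagonal_plane"
  shows "\<bar>plane_pairing f g\<bar> \<le> nrm tilted_space f * nrm hexagonal_plane g"
    and "plane_pairing f g = nrm tilted_space f * nrm hexagonal_plane g \<Longrightarrow> plane_pairing f g = 0"
proof -
  have Y: "normed_space hexagonal_plane" using banach_space_hexagonal_plane by (simp add: banach_space_iff)
  \<comment> \<open>Strictness at nonzero values comes first; both claims follow from it.\<close>
  have *: "\<bar>plane_pairing f g\<bar> < nrm tilted_space f * nrm hexagonal_plane g" if ne: "plane_pairing f g \<noteq> 0"
  proof -
    have "f 0 \<noteq> 0 \<or> f 1 \<noteq> 0" "g \<noteq> 0" using ne by (auto simp: plane_pairing_def)
    then obtain P where P: "P < nrm tilted_space f" "\<And>i. \<bar>plane_coord i f\<bar> \<le> P"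
      using plane_coord_less_nrm[OF f] by blast
    have "\<bar>f 0\<bar> \<le> P" "\<bar>f 1\<bar> \<le> P" "\<bar>- f 0 - f 1\<bar> \<le> P"
      using P(2)[of 0] P(2)[of 1] P(2)[of 2] by (simp_all add: plane_coord_def)
    from hexagonal_duality[OF this, of "g 0" "g 1"]
    have "\<bar>plane_pairing f g\<bar> \<le> P * nrm hexagonal_plane g"
      by (simp only: plane_pairing_def hexagonal_plane_def nspace.select_convs)
    also have "\<dots> < nrm tilted_space f * nrm hexagonal_plane g"
      using P(1) \<open>g \<noteq> 0\<close> nrm_nonneg[OF Y g] nrm_eq_0_iff[OF Y g] by (intro mult_strict_right_mono) auto
    finally show ?thesis .
  qed
  then show "plane_pairing f g = nrm tilted_space f * nrm hexagonal_plane g \<Longrightarrow> plane_pairing f g = 0" by fastforce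
  show "\<bar>plane_pairing f g\<bar> \<le> nrm tilted_space f * nrm hexagonal_plane g"
    using * nrm_nonneg[OF normed_space_tilted_space f] nrm_nonneg[OF Y g]
    by (cases "plane_pairing f g = 0") (auto intro: less_imp_le)
qed

text \<open>Plane part \<open>(a, b)\<close> followed by \<open>n\<close> ones. The cut at
  \<open>n + 2\<close> makes the null sequence entry seen by \<open>tilted_coord i k\<close> equal
  to 1 exactly for \<open>k < n\<close>.\<close>

definition step_fun :: "nat \<Rightarrow> real \<Rightarrow> real \<Rightarrow> real \<Rightarrow> real"
  where "step_fun n a b x =
    (if x = 0 then a else if x = 1 then b else if x \<in> \<nat> \<and> x < real (n + 2) then 1 else 0)"

lemma step_fun_in_tilted_space: "step_fun n a b \<in> spc tilted_space"
proof -
  have "\<forall>\<^sub>F k in sequentially. step_fun n a b (real k) = 0"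
    using eventually_ge_at_top[of "n + 2"] by eventually_elim (auto simp: step_fun_def)
  then have "(\<lambda>k. step_fun n a b (real k)) \<longlonglongrightarrow> 0" by (rule tendsto_eventually)
  then show ?thesis by (auto simp: tilted_space_def step_fun_def)
qed

text \<open>For \<open>k < n\<close> the subtracted \<open>tilt k\<close> absorbs the factor
  \<open>1 + tilt k\<close> at coordinate \<open>r\<close>, and at \<open>- r / 2\<close> the
  modulus is at most \<open>(1 + tilt k) / 2 + tilt k \<le> 1\<close>, as
  \<open>tilt k \<le> 1 / 3\<close>. For \<open>k \<ge> n\<close> nothing is subtracted, but
  \<open>1 + tilt k \<le> 1 + tilt n = 1 / r\<close>.\<close>

lemma nrm_step_fun_le:
  assumes r: "r = 1 / (1 + tilt n)"
    and ab: "a \<in> {r, - r / 2}" "b \<in> {r, - r / 2}" "- a - b \<in> {r, - r / 2}"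
  shows "nrm tilted_space (step_fun n a b) \<le> 1"
proof (rule nrm_tilted_space_le)
  have r01: "0 < r" "r \<le> 1" using tilt_bounds[of n] by (auto simp: r)
  fix k
  show "\<bar>step_fun n a b (real k)\<bar> \<le> 1" using r01 ab by (auto simp: step_fun_def)
  fix i
  have pc: "plane_coord i (step_fun n a b) \<in> {r, - r / 2}" using ab by (simp add: plane_coord_def step_fun_def)
  define q where "q = (1 + tilt k) * r"
  have q0: "0 < q" using tilt_bounds[of k] r01 by (simp add: q_def)
  have tc: "tilted_coord i k (step_fun n a b) =
      (1 + tilt k) * plane_coord i (step_fun n a b) - (if k < n then tilt k else 0)"
    by (simp add: tilted_coord_def step_fun_def)
  have cases: "(1 + tilt k) * plane_coord i (step_fun n a b) \<in> {q, - q / 2}" using pc by (auto simp: q_def)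
  have "\<bar>z - (if k < n then tilt k else 0)\<bar> \<le> 1" if z: "z \<in> {q, - q / 2}" for z
  proof (cases "k < n")
    case True
    have "q \<le> (1 + tilt k) * 1" unfolding q_def using r01 tilt_bounds[of k] by (intro mult_left_mono) auto
    then show ?thesis using z True tilt_bounds[of k] q0 by auto
  next
    case False
    have "q \<le> (1 + tilt n) * r"
      unfolding q_def using False tilt_antimono[of n k] r01 by (intro mult_right_mono) auto
    also have "\<dots> = 1" using tilt_bounds[of n] by (simp add: r)
    finally show ?thesis using z False q0 by auto
  qed
  with cases show "\<bar>tilted_coord i k (step_fun n a b)\<bar> \<le> 1" unfolding tc by blast
qed

section \<open>The tensor without optimal representation\<close>

definition unit_fun :: "real \<Rightarrow> real \<Rightarrow> real"
  where "unit_fun x y = (if y = x then 1 else 0)"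

definition half_identity :: "(real \<Rightarrow> real, real \<Rightarrow> real) tensor"
  where "half_identity =
    (1 / 2) *\<^sub>R elem_tensor tilted_space hexagonal_plane (unit_fun 0) (unit_fun 0) +
    (1 / 2) *\<^sub>R elem_tensor tilted_space hexagonal_plane (unit_fun 1) (unit_fun 1)"

lemma unit_fun_in_tilted_space: "unit_fun 0 \<in> spc tilted_space" "unit_fun 1 \<in> spc tilted_space"
proof -
  \<comment> \<open>For \<open>n = 0\<close> the segment of ones is empty.\<close>
  have 0: "unit_fun 0 = step_fun 0 1 0" and 1: "unit_fun 1 = step_fun 0 0 1"
    by (auto simp: unit_fun_def step_fun_def fun_eq_iff elim!: Nats_cases)
  show "unit_fun 0 \<in> spc tilted_space" "unit_fun 1 \<in> spc tilted_space"
    unfolding 0 1 by (rule step_fun_in_tilted_space)+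
qed

lemma unit_fun_in_hexagonal_plane: "unit_fun 0 \<in> spc hexagonal_plane" "unit_fun 1 \<in> spc hexagonal_plane"
  by (auto simp: hexagonal_plane_def unit_fun_def)

text \<open>
  The three vectors below share the null sequence part, and the corresponding elements of the
  plane add up to zero; hence the null sequence part disappears from the tensor.
\<close>

lemma half_identity_eq:
  assumes "r \<noteq> 0"
  defines "e \<equiv> elem_tensor tilted_space hexagonal_plane" and "c \<equiv> 1 / (3 * r)"
  shows "half_identity =
    c *\<^sub>R e (step_fun n r (- r / 2)) (unit_fun 0) +
    c *\<^sub>R e (step_fun n (- r / 2) r) (unit_fun 1) +
    c *\<^sub>R e (step_fun n (- r / 2) (- r / 2)) ((-1) *\<^sub>R (unit_fun 0 + unit_fun 1))"
proof -
  define w where "w = step_fun n (- r / 2) (- r / 2)"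
  \<comment> \<open>All three vectors are \<open>w\<close> up to \<open>3 * r / 2\<close> in one
    plane coordinate, since \<open>- r / 2 + 3 * r / 2 = r\<close>.\<close>
  have w0: "step_fun n r (- r / 2) = w + (3 * r / 2) *\<^sub>R unit_fun 0"
    and w1: "step_fun n (- r / 2) r = w + (3 * r / 2) *\<^sub>R unit_fun 1"
    by (auto simp: w_def step_fun_def unit_fun_def fun_eq_iff scaleR_fun_def)
  note mem = unit_fun_in_tilted_space unit_fun_in_hexagonal_plane
    step_fun_in_tilted_space[of n "- r / 2" "- r / 2", folded w_def]
  note X = normed_space_tilted_space
  have Y: "normed_space hexagonal_plane" using banach_space_hexagonal_plane by (simp add: banach_space_iff)
  have neg: "e w ((-1) *\<^sub>R (unit_fun 0 + unit_fun 1)) = (-1) *\<^sub>R (e w (unit_fun 0) + e w (unit_fun 1))"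
    unfolding e_def using elem_tensor_scaleR_right[OF mem(5) add_in_spc[OF Y mem(3,4)]]
      elem_tensor_add_right[OF mem(5,3,4)] by metis
  have shift: "c *\<^sub>R e (w + (3 * r / 2) *\<^sub>R v) y = c *\<^sub>R e w y + (1 / 2) *\<^sub>R e v y"
    if "v \<in> spc tilted_space" "y \<in> spc hexagonal_plane" for v y
  proof -
    \<comment> \<open>\<open>c\<close> is chosen for this cancellation; the terms in
      \<open>w\<close> then meet \<open>neg\<close> and drop out.\<close>
    have "c * (3 * r / 2) = 1 / 2" using assms by (simp add: c_def)
    then show ?thesis
      using elem_tensor_add_left[OF mem(5) scaleR_in_spc[OF X that(1)] that(2)]
        elem_tensor_scaleR_left[OF that, of "3 * r / 2"]
      by (simp only: e_def scaleR_add_right scaleR_scaleR)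
  qed
  show ?thesis
    unfolding w0 w1 w_def[symmetric] neg shift[OF mem(1,3)] shift[OF mem(2,4)] half_identity_def
    by (simp add: e_def scaleR_add_right scaleR_diff_right)
qed

lemma projective_norm_elem_tensor_le:
  assumes "normed_space X" "normed_space Y" "x \<in> spc X" "y \<in> spc Y"
  shows "projective_norm X Y (elem_tensor X Y x y) \<le> nrm X x * nrm Y y"
  using projective_norm_sum_elem_tensor_le[OF assms(1,2), of 1 "\<lambda>_. x" "\<lambda>_. y"] assms(3,4) by simp

text \<open>Each of the three terms has norm at most \<open>c\<close>, in total
  \<open>3 * c = 1 / r = 1 + tilt n\<close>. The bound 1 arises only in the limit over
  \<open>n\<close>, each \<open>n\<close> using its own representation.\<close>

lemma projective_norm_half_identity: "projective_norm tilted_space hexagonal_plane half_identity \<le> 1"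
proof -
  let ?X = tilted_space and ?Y = hexagonal_plane and ?V = "tensor_nspace tilted_space hexagonal_plane"
  note X = normed_space_tilted_space
  have Y: "normed_space ?Y" using banach_space_hexagonal_plane by (simp add: banach_space_iff)
  note V = normed_space_tensor_nspace[OF X Y]
  have "projective_norm ?X ?Y half_identity \<le> 1 + tilt n" for n
  proof -
    define r where "r = 1 / (1 + tilt n)"
    define c where "c = 1 / (3 * r)"
    have r: "r > 0" using tilt_bounds[of n] by (simp add: r_def)
    have bound: "nrm ?V (c *\<^sub>R elem_tensor ?X ?Y (step_fun n a b) y) \<le> c \<and>
        c *\<^sub>R elem_tensor ?X ?Y (step_fun n a b) y \<in> spc ?V"
      if "a \<in> {r, - r / 2}" "b \<in> {r, - r / 2}" "- a - b \<in> {r, - r / 2}" "y \<in> spc ?Y" "nrm ?Y y = 1" for a b y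
    proof
      have e: "elem_tensor ?X ?Y (step_fun n a b) y \<in> spc ?V"
        using elem_tensor_in_algebraic_tensor[OF step_fun_in_tilted_space that(4)] by simp
      have "nrm ?V (elem_tensor ?X ?Y (step_fun n a b) y) \<le> 1"
        using projective_norm_elem_tensor_le[OF X Y step_fun_in_tilted_space that(4), of n a b]
          nrm_step_fun_le[OF r_def that(1-3)] that(5) by simp
      then show "nrm ?V (c *\<^sub>R elem_tensor ?X ?Y (step_fun n a b) y) \<le> c"
        using nrm_scaleR[OF V e, of c] r mult_left_mono[of _ 1 c] by (simp add: c_def)
      show "c *\<^sub>R elem_tensor ?X ?Y (step_fun n a b) y \<in> spc ?V" by (rule scaleR_in_spc[OF V e])
    qed
    define t where "t = (-1) *\<^sub>R (unit_fun 0 + unit_fun 1)"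
    define v0 where "v0 = c *\<^sub>R elem_tensor ?X ?Y (step_fun n r (- r / 2)) (unit_fun 0)"
    define v1 where "v1 = c *\<^sub>R elem_tensor ?X ?Y (step_fun n (- r / 2) r) (unit_fun 1)"
    define v2 where "v2 = c *\<^sub>R elem_tensor ?X ?Y (step_fun n (- r / 2) (- r / 2)) t"
    have "t \<in> spc ?Y" "nrm ?Y t = 1" "nrm ?Y (unit_fun 0) = 1" "nrm ?Y (unit_fun 1) = 1"
      by (auto simp: t_def hexagonal_plane_def unit_fun_def scaleR_fun_def)
    then have v: "nrm ?V v0 \<le> c" "nrm ?V v1 \<le> c" "nrm ?V v2 \<le> c" "v0 \<in> spc ?V" "v1 \<in> spc ?V" "v2 \<in> spc ?V"
      using bound unit_fun_in_hexagonal_plane by (simp_all add: v0_def v1_def v2_def)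
    have "half_identity = v0 + v1 + v2"
      using half_identity_eq[of r n] r by (simp add: v0_def v1_def v2_def c_def t_def)
    then have "projective_norm ?X ?Y half_identity \<le> c + c + c"
      using nrm_triangle[OF V add_in_spc[OF V v(4,5)] v(6)] nrm_triangle[OF V v(4,5)] v(1-3) by simp
    also have "\<dots> = 1 + tilt n"
    proof -
      have "c = (1 + tilt n) / 3" by (simp add: c_def r_def)
      then show ?thesis by simp
    qed
    finally show ?thesis .
  qed
  moreover have "(\<lambda>n. 1 + tilt n) \<longlonglongrightarrow> 1 + 0"
    unfolding tilt_def by (intro tendsto_intros) real_asymp
  ultimately show ?thesis by (intro LIMSEQ_le_const[of _ 1]) auto
qed

lemma half_identity_not_NA_proj:
  defines "u \<equiv> to_completion (tensor_nspace tilted_space hexagonal_plane) half_identity"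
  shows "u \<in> proj_tensor tilted_space hexagonal_plane" "u \<notin> NA_proj tilted_space hexagonal_plane"
proof -
  let ?X = tilted_space and ?Y = hexagonal_plane
  note X = normed_space_tilted_space
  have Y: "normed_space ?Y" using banach_space_hexagonal_plane by (simp add: banach_space_iff)
  note V = normed_space_tensor_nspace[OF X Y]
  have "half_identity \<in> spc (tensor_nspace ?X ?Y)"
    unfolding half_identity_def
    by (intro add_in_spc[OF V] scaleR_in_spc[OF V])
      (simp_all add: elem_tensor_in_algebraic_tensor unit_fun_in_tilted_space unit_fun_in_hexagonal_plane)
  then have alg: "half_identity \<in> algebraic_tensor ?X ?Y" by simp
  have B: "bilinear_form_on (spc ?X) (spc ?Y) plane_pairing"
    by (auto simp: bilinear_form_on_def linear_map_on_def plane_pairing_def scaleR_fun_def algebra_simps)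
  \<comment> \<open>The pairing acts as the trace, and half the identity of a plane has trace 1, so
    the upper bound for the norm is sharp.\<close>
  have "half_identity plane_pairing = 1"
    by (simp add: half_identity_def scaleR_fun_def elem_tensor_apply[OF B] plane_pairing_def unit_fun_def)
  then show "u \<notin> NA_proj ?X ?Y"
    unfolding u_def using projective_norm_half_identity
    by (intro to_completion_not_NA_proj[OF X Y alg B plane_pairing_le]) auto
  show "u \<in> proj_tensor ?X ?Y"
    using to_completion_in_completion[OF V] alg by (simp add: u_def proj_tensor_def)
qed

theorem mainTheorem20:
  shows
    "(\<exists>(Z :: ((real \<Rightarrow> real) \<times> ((real \<Rightarrow> real) \<Rightarrow> real)) nspace) (Y :: (real \<Rightarrow> real) nspace).
        banach_space Z \<and> banach_space Y \<and> property_alpha Z \<and> NA_proj Z Y \<noteq> proj_tensor Z Y) \<and>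
     (\<forall>(X :: 'a::real_vector nspace) (Y :: 'b::real_vector nspace) u.
        banach_space X \<longrightarrow> banach_space Y \<longrightarrow> u \<in> proj_tensor X Y \<longrightarrow> u \<notin> NA_proj X Y \<longrightarrow>
        (\<exists>(Z :: ('a \<times> ('a \<Rightarrow> real)) nspace) \<iota> J.
           banach_space Z \<and> property_alpha Z \<and>
           one_complemented_via \<iota> X Z \<and>
           canonical_tensor_embedding \<iota> X Z Y J \<and>
           J u \<notin> NA_proj Z Y))"
proof (intro conjI allI impI)
  let ?u = "to_completion (tensor_nspace tilted_space hexagonal_plane) half_identity"
  from alpha_space_preserves_nonattainment[OF banach_space_tilted_space banach_space_hexagonal_plane
      half_identity_not_NA_proj]
  obtain Z :: "((real \<Rightarrow> real) \<times> ((real \<Rightarrow> real) \<Rightarrow> real)) nspace" and \<iota> J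
    where Z: "banach_space Z" "property_alpha Z"
      and J: "canonical_tensor_embedding \<iota> tilted_space Z hexagonal_plane J" "J ?u \<notin> NA_proj Z hexagonal_plane"
    by (elim exE conjE) (rule that)
  have "J ?u \<in> proj_tensor Z hexagonal_plane"
    using J(1) half_identity_not_NA_proj(1)
    by (auto simp: canonical_tensor_embedding_def completion_isometry_def proj_tensor_def)
  then have "NA_proj Z hexagonal_plane \<noteq> proj_tensor Z hexagonal_plane" using J(2) by metis
  with Z banach_space_hexagonal_plane
  show "\<exists>(Z :: ((real \<Rightarrow> real) \<times> ((real \<Rightarrow> real) \<Rightarrow> real)) nspace) (Y :: (real \<Rightarrow> real) nspace).
      banach_space Z \<and> banach_space Y \<and> property_alpha Z \<and> NA_proj Z Y \<noteq> proj_tensor Z Y"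
    by (intro exI conjI)
qed (rule alpha_space_preserves_nonattainment)

end
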